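(* Let $n>1$ be an integer, $e_n=e^{\pi i/n}$, and for $\epsilon>0$ let $N_\epsilon(z)=\epsilon N(z/\epsilon)$, where $N(z)=z(1-z^{-n})^{2/n}$. (1) The map $e_n^{-1}N_\epsilon(e_nN_\epsilon^{-1}(w))$ is a family in $\epsilon^n$ varying from the identity, and its first and second variation cocycles (first and second derivatives in the parameter $\epsilon^n$ at $0$) are $$\frac{4}{n\,w^{n-1}}\frac{d}{dw}\qquad\text{and}\qquad\frac{16(1-n)}{n^2\,w^{2n-1}}\frac{d}{dw}.$$ (2) The pushforward of the differential $\omega=-w^{n-1}dw$ by $N_\epsilon(e_nN_\epsilon^{-1}(w))$ extends to a holomorphic differential on $\mathbb C$ with an order $n-1$ zero at the origin. (3) If the construction is performed in a coordinate $w$ in a small disc on a compact Riemann surface $R$ in which an Abelian differential has the normal form $-w^{n-1}dw$, the deformation of the differential is isoperiodic (the periods are not changed), and the integral norm of the differential is not changed.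
   Context: $N$ is the Riemann mapping from $\{|z|>1\}\subset\hat{\mathbb C}$ (with branch chosen so that $N(z)\sim z$ at infinity) to the complement of the regular $n$-star at the origin, formed by $n$ equal length radial slits at angles $(1+2k)\pi/n$. $N_\epsilon$ has domain $\{|z|>\epsilon\}$ and its image is the complement of the star $\Sigma_\epsilon$ scaled by $\epsilon$; $N_\epsilon^{-1}$ is its inverse on that complement. The pushforward by the (injective) map $A_\epsilon(w)=N_\epsilon(e_nN_\epsilon^{-1}(w))$, defined on $\mathbb C\setminus\Sigma_\epsilon$, is the pullback by its inverse; it is a priori defined on the complement of the image slits (again $\Sigma_\epsilon$). A holomorphic family $A_\epsilon(w)$ with $A_0(w)=w$, holomorphic away from a small neighborhood of $w=0$, has variation cocycles the vector fields $\dot A(w)\frac{d}{dw}$ and $\ddot A(w)\frac{d}{dw}$ (first and second derivatives in the indicated parameter, at parameter value $0$) on an annulus around $w=0$. Construction on a surface: for $\epsilon$ small and the slits $\Sigma_\epsilon$ contained in a disc $\{|w|<\rho\}$ of the coordinate, the deformed surface is obtained by cutting $R$ open along $\Sigma_\epsilon$ and regluing the slit edges via $A_\epsilon$, i.e. $\{|w|<\rho\}\setminus\Sigma_\epsilon$ is identified by $\zeta=A_\epsilon(w)$ with its image in the $\zeta$-plane and the image slits are filled in. The deformed differential is the extension of the original differential on $R\setminus\Sigma_\epsilon$. Periods are compared on cycles disjoint from the disc; the integral norm of $\omega$ is $\frac i2\int\omega\wedge\overline{\omega}$. *)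

theory Defs
  imports "HOL-Complex_Analysis.Complex_Analysis"
begin

section \<open>The slit mapping\<close>

text \<open>
  For \<open>norm z > 1\<close> the number \<open>1 - 1 / z ^ n\<close> has positive real part, so the principal
  branch of the power is holomorphic there and tends to \<open>1\<close> at infinity.
\<close>

definition star_map :: "nat \<Rightarrow> complex \<Rightarrow> complex" where
  "star_map n z = z * (1 - 1 / z ^ n) powr (2 / of_nat n)"

definition scaled_star_map :: "nat \<Rightarrow> real \<Rightarrow> complex \<Rightarrow> complex" where
  "scaled_star_map n \<epsilon> z = of_real \<epsilon> * star_map n (z / of_real \<epsilon>)"

text \<open>
  The common length of the slits is the maximum of \<open>norm (star_map n z)\<close> on the unit circle;
  see \<open>bij_betw_scaled_star_map\<close> below.
\<close>

definition star :: "nat \<Rightarrow> complex set" where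
  "star n = {of_real r * cis ((1 + 2 * real k) * pi / real n) | r k.
               0 \<le> r \<and> r \<le> 4 powr (1 / real n) \<and> k < n}"

definition slits :: "nat \<Rightarrow> real \<Rightarrow> complex set" where
  "slits n \<epsilon> = (\<lambda>w. of_real \<epsilon> * w) ` star n"

definition scaled_star_map_inv :: "nat \<Rightarrow> real \<Rightarrow> complex \<Rightarrow> complex" where
  "scaled_star_map_inv n \<epsilon> = inv_into {z. norm z > \<epsilon>} (scaled_star_map n \<epsilon>)"

definition e_root :: "nat \<Rightarrow> complex" where
  "e_root n = exp (of_real pi * \<i> / of_nat n)"

definition slit_map :: "nat \<Rightarrow> real \<Rightarrow> complex \<Rightarrow> complex" where
  "slit_map n \<epsilon> w = scaled_star_map n \<epsilon> (e_root n * scaled_star_map_inv n \<epsilon> w)"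

lemma star_map_power:
  assumes "n > 0" "norm z > 1"
  shows "star_map n z ^ n = z ^ n + 1 / z ^ n - 2"
proof -
  have z: "z \<noteq> 0" using assms by auto
  have "norm (z ^ n) > 1" using assms by (simp add: norm_power one_less_power)
  hence x: "1 - 1 / z ^ n \<noteq> 0" by auto
  have "((1 - 1 / z ^ n) powr (2 / of_nat n)) ^ n = (1 - 1 / z ^ n) ^ 2"
  proof -
    have "((1 - 1 / z ^ n) powr (2 / of_nat n)) ^ n
        = exp (of_nat n * (2 / of_nat n * Ln (1 - 1 / z ^ n)))"
      using x by (simp only: powr_def exp_of_nat_mult if_False)
    also have "\<dots> = exp (of_nat 2 * Ln (1 - 1 / z ^ n))"
      using assms by simp
    also have "\<dots> = (1 - 1 / z ^ n) ^ 2"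
      using x by (subst exp_of_nat_mult) simp
    finally show ?thesis .
  qed
  hence "star_map n z ^ n = z ^ n * (1 - 1 / z ^ n) ^ 2"
    by (simp add: star_map_def power_mult_distrib)
  also have "\<dots> = z ^ n + 1 / z ^ n - 2"
    using z by (simp add: field_simps power2_eq_square)
  finally show ?thesis .
qed

lemma mem_star_iff:
  assumes "n > 0"
  shows "w \<in> star n \<longleftrightarrow> (\<exists>s::real. 0 \<le> s \<and> s \<le> 4 \<and> w ^ n = - of_real s)"
proof
  assume "w \<in> star n"
  then obtain r k where rk: "w = of_real r * cis ((1 + 2 * real k) * pi / real n)"
    "0 \<le> r" "r \<le> 4 powr (1 / real n)" by (auto simp: star_def)
  have "r ^ n \<le> (4 powr (1 / real n)) ^ n" using rk by (intro power_mono)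
  also have "\<dots> = 4" using assms by (simp add: powr_power)
  finally have "r ^ n \<le> 4" .
  moreover have "cis ((1 + 2 * real k) * pi / real n) ^ n = cis ((1 + 2 * real k) * pi)"
    unfolding Complex.DeMoivre using assms by simp
  moreover have "cis ((1 + 2 * real k) * pi) = -1"
    using cos_npi[of "1 + 2 * k"] sin_npi[of "1 + 2 * k"] by (simp add: complex_eq_iff)
  ultimately have "w ^ n = - of_real (r ^ n)" "r ^ n \<le> 4"
    by (auto simp: rk(1) power_mult_distrib)
  thus "\<exists>s::real. 0 \<le> s \<and> s \<le> 4 \<and> w ^ n = - of_real s"
    using rk by (intro exI[of _ "r ^ n"]) auto
next
  assume "\<exists>s::real. 0 \<le> s \<and> s \<le> 4 \<and> w ^ n = - of_real s"
  then obtain s :: real where s: "0 \<le> s" "s \<le> 4" "w ^ n = - of_real s" by auto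
  define r where "r = norm w"
  define \<theta> where "\<theta> = Arg w"
  have w: "w = of_real r * cis \<theta>"
    unfolding r_def \<theta>_def using rcis_cmod_Arg[of w] by (simp add: rcis_def)
  have rn: "r ^ n = s"
    using s by (simp add: r_def flip: norm_power)
  have rle: "r \<le> 4 powr (1 / real n)"
  proof (rule power_le_imp_le_base)
    show "r ^ Suc (n - 1) \<le> (4 powr (1 / real n)) ^ Suc (n - 1)"
      using assms rn s by (simp add: powr_power flip: power_Suc)
  qed auto
  show "w \<in> star n"
  proof (cases "r = 0")
    case True
    hence "w = of_real 0 * cis ((1 + 2 * real 0) * pi / real n)" using w by simp
    thus ?thesis unfolding star_def using assms by (intro CollectI exI[of _ 0]) auto
  next
    case False
    have "of_real (r ^ n) * cis (real n * \<theta>) = - of_real (r ^ n)"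
      using s(3) unfolding rn[symmetric] by (simp add: w power_mult_distrib Complex.DeMoivre)
    hence "of_real (r ^ n) * (cis (real n * \<theta>) + 1) = 0" by (simp add: algebra_simps)
    hence "cis (real n * \<theta>) = -1" using False by (simp add: eq_neg_iff_add_eq_0)
    hence "cis (real n * \<theta>) = cis pi" by simp
    hence "exp (\<i> * of_real (real n * \<theta>)) = exp (\<i> * of_real pi)"
      by (simp add: cis_conv_exp)
    then obtain m :: int where "\<i> * of_real (real n * \<theta>) = \<i> * of_real pi + (of_int (2 * m) * pi) * \<i>"
      unfolding exp_eq by (auto simp: mult_ac)
    hence "\<i> * of_real (real n * \<theta>) = \<i> * of_real (pi + of_int (2 * m) * pi)"
      by (simp add: algebra_simps)
    hence eq: "real n * \<theta> = pi + of_int (2 * m) * pi"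
      by (metis complex_i_not_zero mult_cancel_left of_real_eq_iff)
    define k where "k = nat (m mod int n)"
    have k: "k < n" "int k = m mod int n" using assms by (auto simp: k_def nat_less_iff)
    have mk: "m = int k + int n * (m div int n)" using k by simp
    have "\<theta> = (1 + 2 * real k) * pi / real n + 2 * pi * of_int (m div int n)"
    proof -
      have "real_of_int m = real k + real n * of_int (m div int n)"
        using arg_cong[OF mk, of real_of_int] by simp
      hence "real n * \<theta> = pi + 2 * (real k + real n * of_int (m div int n)) * pi"
        using eq by simp
      thus ?thesis using assms by (simp add: field_simps)
    qed
    hence "cis \<theta> = cis ((1 + 2 * real k) * pi / real n)"
      by (simp add: flip: cis_mult)
    thus ?thesis unfolding star_def using w rle k
      by (intro CollectI exI[of _ r] exI[of _ k]) (auto simp: r_def)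
  qed
qed

lemma bij_betw_star_map:
  assumes n: "n > 0"
  shows "bij_betw (star_map n) {z. norm z > 1} (- star n)"
  unfolding bij_betw_def
proof safe
  have big: "norm (z ^ n) > 1" if "norm z > 1" for z :: complex
    using that n by (simp add: norm_power one_less_power)
  show "inj_on (star_map n) {z. norm z > 1}"
  proof (rule inj_onI, clarify)
    fix z z' :: complex
    assume z: "norm z > 1" "norm z' > 1" and eq: "star_map n z = star_map n z'"
    define u v where "u = z ^ n" and "v = z' ^ n"
    have uv: "norm u > 1" "norm v > 1" using z big by (auto simp: u_def v_def)
    hence nz: "u \<noteq> 0" "v \<noteq> 0" by auto
    have "u + 1 / u = v + 1 / v"
      using eq star_map_power[OF n z(1)] star_map_power[OF n z(2)] by (simp add: u_def v_def)
    hence "(u - v) * (u * v - 1) = 0" using nz by (simp add: field_simps)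
    moreover have "norm (u * v) > 1" using uv by (simp add: norm_mult less_1_mult)
    hence "u * v \<noteq> 1" by auto
    ultimately have "u = v" by simp
    moreover have "(1 - 1 / u) powr (2 / of_nat n) \<noteq> 0" using uv by auto
    moreover have "z * (1 - 1 / u) powr (2 / of_nat n) = z' * (1 - 1 / v) powr (2 / of_nat n)"
      using eq by (simp only: star_map_def u_def v_def)
    ultimately show "z = z'" by (metis mult_right_cancel)
  qed
next
  fix z assume z: "norm z > 1" and "star_map n z \<in> star n"
  then obtain s :: real where s: "0 \<le> s" "s \<le> 4" "star_map n z ^ n = - of_real s"
    using mem_star_iff[OF n] by auto
  define u where "u = z ^ n"
  have u: "norm u > 1" using z n by (simp add: u_def norm_power one_less_power)
  have u0: "u \<noteq> 0" using u by auto
  have "u + 1 / u - 2 = - of_real s" using star_map_power[OF n z] s by (simp add: u_def)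
  hence q: "u ^ 2 = of_real (2 - s) * u - 1"
    using u0 by (simp add: field_simps power2_eq_square)
  have im: "Im u * (2 * Re u - (2 - s)) = 0"
    using arg_cong[OF q, of Im] by (simp add: power2_eq_square algebra_simps)
  have re: "(Re u)\<^sup>2 - (Im u)\<^sup>2 = (2 - s) * Re u - 1"
    using arg_cong[OF q, of Re] by (simp add: power2_eq_square)
  have "(Re u)\<^sup>2 + (Im u)\<^sup>2 = 1"
  proof (cases "Im u = 0")
    case True
    have "(Re u - (2 - s) / 2)\<^sup>2 = ((2 - s)\<^sup>2 - 4) / 4"
      using re True by (simp add: power2_eq_square field_simps)
    moreover have "(2 - s)\<^sup>2 - 4 = - (s * (4 - s))" by (simp add: power2_eq_square algebra_simps)
    moreover have "s * (4 - s) \<ge> 0" using s by simp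
    ultimately have "(Re u - (2 - s) / 2)\<^sup>2 \<le> 0" "(2 - s)\<^sup>2 - 4 \<ge> 0"
      using zero_le_power2[of "Re u - (2 - s) / 2"] by (auto simp: divide_le_0_iff)
    hence "Re u = (2 - s) / 2" "(2 - s)\<^sup>2 = 4"
      using \<open>(2 - s)\<^sup>2 - 4 = - (s * (4 - s))\<close> \<open>s * (4 - s) \<ge> 0\<close> by auto
    hence "(Re u)\<^sup>2 = 1" by (simp only: power_divide) simp
    thus ?thesis using True by simp
  next
    case False
    hence r: "2 - s = 2 * Re u" using im by simp
    show ?thesis using re unfolding r by (simp add: power2_eq_square)
  qed
  thus False using u by (simp add: cmod_def)
next
  fix w assume w: "w \<notin> star n"
  define x where "x = w ^ n"
  define d where "d = csqrt ((x + 2)\<^sup>2 - 4)"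
  define u1 u2 where "u1 = (x + 2 + d) / 2" and "u2 = (x + 2 - d) / 2"
  have d2: "d\<^sup>2 = (x + 2)\<^sup>2 - 4" by (simp add: d_def)
  have prod: "u1 * u2 = 1"
    using d2 by (simp add: u1_def u2_def power2_eq_square algebra_simps)
  have sum: "u1 + u2 = x + 2" by (simp add: u1_def u2_def field_simps)
  have ne: "norm u1 \<noteq> 1"
  proof
    assume "norm u1 = 1"
    hence "u1 * cnj u1 = 1" by (simp add: complex_norm_square[symmetric])
    hence "u2 = cnj u1" using prod by (metis mult_cancel_left mult_zero_left zero_neq_one)
    hence "x = - of_real (2 - 2 * Re u1)" using sum complex_add_cnj[of u1]
      by (simp add: algebra_simps)
    moreover have "\<bar>Re u1\<bar> \<le> 1" using abs_Re_le_cmod[of u1] \<open>norm u1 = 1\<close> by simp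
    ultimately have "w \<in> star n" unfolding mem_star_iff[OF n] x_def
      by (intro exI[of _ "2 - 2 * Re u1"]) auto
    thus False using w by simp
  qed
  have np: "norm u1 * norm u2 = 1" using prod by (metis norm_mult norm_one)
  obtain u v where u: "norm u > 1" "u * v = 1" "u + v = x + 2"
  proof (cases "norm u1 > 1")
    case True thus ?thesis using that[of u1 u2] prod sum by auto
  next
    case False
    hence "norm u1 < 1" using ne by simp
    moreover have "norm u2 > 0" using prod by auto
    ultimately have "norm u2 > 1" using np by (smt (verit) mult_less_cancel_right2)
    thus ?thesis using that[of u2 u1] prod sum by (auto simp: mult.commute add.commute)
  qed
  have u0: "u \<noteq> 0" using u by auto
  have v: "v = 1 / u" using u(2) u0 by (simp add: field_simps)
  define z0 where "z0 = exp (Ln u / of_nat n)"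
  have z0: "z0 ^ n = u" using n u0 by (simp add: z0_def flip: exp_of_nat_mult)
  have nz0: "norm z0 > 1"
  proof (rule ccontr)
    assume "\<not> norm z0 > 1"
    hence "norm z0 ^ n \<le> 1" by (simp add: power_le_one)
    thus False using u z0 by (simp flip: norm_power)
  qed
  have e: "star_map n z0 ^ n = w ^ n"
    using star_map_power[OF n nz0] u v z0 by (simp add: x_def)
  have s0: "star_map n z0 \<noteq> 0"
  proof
    assume "star_map n z0 = 0"
    hence "w = 0" using e n by (simp add: zero_power)
    thus False using w mem_star_iff[OF n, of 0] n by (auto simp: zero_power)
  qed
  define \<eta> where "\<eta> = w / star_map n z0"
  have \<eta>: "\<eta> ^ n = 1" "\<eta> * star_map n z0 = w"
    using e s0 by (simp_all only: \<eta>_def power_divide) (simp_all flip: e)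
  have "norm \<eta> = 1" using \<eta>(1) n
    by (metis norm_one norm_power power_eq_1_iff norm_ge_zero not_gr_zero abs_norm_cancel)
  moreover have "star_map n (\<eta> * z0) = w"
    using \<eta> by (simp add: star_map_def power_mult_distrib mult_ac)
  ultimately show "w \<in> star_map n ` {z. norm z > 1}"
    using nz0 by (intro image_eqI[of _ _ "\<eta> * z0"]) (auto simp: norm_mult)
qed

lemma bij_betw_scaled_star_map:
  assumes "n > 0" "\<epsilon> > 0"
  shows "bij_betw (scaled_star_map n \<epsilon>) {z. norm z > \<epsilon>} (- slits n \<epsilon>)"
proof -
  define E where "E = complex_of_real \<epsilon>"
  have E: "E \<noteq> 0" "norm E = \<epsilon>" using assms by (auto simp: E_def)
  have 1: "bij_betw (\<lambda>z. z / E) {z. norm z > \<epsilon>} {z. norm z > 1}"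
    by (rule bij_betwI[of _ _ _ "\<lambda>z. E * z"]) (use E assms in \<open>auto simp: norm_divide norm_mult\<close>)
  have 2: "bij_betw (\<lambda>z. E * z) (- star n) (- slits n \<epsilon>)"
  proof (rule bij_betwI[of _ _ _ "\<lambda>z. z / E"])
    have iff: "E * z \<in> slits n \<epsilon> \<longleftrightarrow> z \<in> star n" for z
      using E by (auto simp: slits_def E_def[symmetric])
    show "(\<lambda>z. E * z) \<in> - star n \<rightarrow> - slits n \<epsilon>" using iff by auto
    show "(\<lambda>z. z / E) \<in> - slits n \<epsilon> \<rightarrow> - star n" using iff[of "z / E" for z] E by auto
  qed (use E in auto)
  have "bij_betw ((\<lambda>z. E * z) \<circ> (star_map n \<circ> (\<lambda>z. z / E))) {z. norm z > \<epsilon>} (- slits n \<epsilon>)"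
    by (intro bij_betw_trans[OF bij_betw_trans[OF 1 bij_betw_star_map] 2] assms)
  thus ?thesis by (simp add: scaled_star_map_def[abs_def] o_def E_def)
qed


section \<open>Holomorphic families and pushforward in the plane\<close>

definition holomorphic_family ::
    "complex set \<Rightarrow> complex set \<Rightarrow> (complex \<Rightarrow> complex \<Rightarrow> complex) \<Rightarrow> bool" where
  "holomorphic_family T W F \<longleftrightarrow>
     continuous_on (T \<times> W) (\<lambda>(t, w). F t w) \<and>
     (\<forall>w\<in>W. (\<lambda>t. F t w) holomorphic_on T) \<and>
     (\<forall>t\<in>T. F t holomorphic_on W)"

text \<open>
  Coefficient of the pushforward of \<open>f(w) dw\<close> by a map \<open>A\<close> injective on \<open>S\<close>, that is, of the
  pullback by its inverse.
\<close>

definition pushforward :: "(complex \<Rightarrow> complex) \<Rightarrow> complex set \<Rightarrow> (complex \<Rightarrow> complex) \<Rightarrow> complex \<Rightarrow> complex"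
  where "pushforward A S f \<zeta> = f (inv_into S A \<zeta>) * deriv (inv_into S A) \<zeta>"


section \<open>Riemann surfaces\<close>

type_synonym 'a chart = "'a set \<times> ('a \<Rightarrow> complex)"

record 'a surface =
  surf_top :: "'a topology"
  surf_atlas :: "'a chart set"

definition is_chart :: "'a topology \<Rightarrow> 'a chart \<Rightarrow> bool" where
  "is_chart T c \<longleftrightarrow> openin T (fst c) \<and> open (snd c ` fst c) \<and>
     homeomorphic_map (subtopology T (fst c)) (top_of_set (snd c ` fst c)) (snd c)"

definition transition :: "'a chart \<Rightarrow> 'a chart \<Rightarrow> complex \<Rightarrow> complex" where
  "transition c d = snd d \<circ> inv_into (fst c) (snd c)"

definition compatible :: "'a chart \<Rightarrow> 'a chart \<Rightarrow> bool" where
  "compatible c d \<longleftrightarrow>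
     transition c d holomorphic_on snd c ` (fst c \<inter> fst d) \<and>
     transition d c holomorphic_on snd d ` (fst c \<inter> fst d)"

text \<open>The atlas need not be maximal.\<close>

definition compact_riemann_surface :: "'a surface \<Rightarrow> bool" where
  "compact_riemann_surface X \<longleftrightarrow>
     Hausdorff_space (surf_top X) \<and> connected_space (surf_top X) \<and> compact_space (surf_top X) \<and>
     (\<Union>c\<in>surf_atlas X. fst c) = topspace (surf_top X) \<and>
     (\<forall>c\<in>surf_atlas X. is_chart (surf_top X) c) \<and>
     (\<forall>c\<in>surf_atlas X. \<forall>d\<in>surf_atlas X. compatible c d)"

definition coordinate :: "'a surface \<Rightarrow> 'a chart \<Rightarrow> bool" where
  "coordinate X c \<longleftrightarrow> is_chart (surf_top X) c \<and> (\<forall>d\<in>surf_atlas X. compatible c d)"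


section \<open>Abelian differentials\<close>

text \<open>
  A differential is given by its coefficients: it is \<open>\<omega> c p dz\<close> at the point \<open>p\<close> in the chart
  \<open>c = (U, z)\<close> of the atlas.
\<close>

type_synonym 'a differential = "'a chart \<Rightarrow> 'a \<Rightarrow> complex"

definition transition_deriv :: "'a chart \<Rightarrow> 'a chart \<Rightarrow> 'a \<Rightarrow> complex" where
  "transition_deriv c d p = deriv (transition c d) (snd c p)"

definition abelian_differential :: "'a surface \<Rightarrow> 'a differential \<Rightarrow> bool" where
  "abelian_differential X \<omega> \<longleftrightarrow>
     (\<forall>c\<in>surf_atlas X. (\<lambda>z. \<omega> c (inv_into (fst c) (snd c) z)) holomorphic_on snd c ` fst c) \<and>
     (\<forall>c\<in>surf_atlas X. \<forall>d\<in>surf_atlas X. \<forall>p\<in>fst c \<inter> fst d.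
        \<omega> c p = \<omega> d p * transition_deriv c d p)"

text \<open>\<open>\<omega> = f(w) dw\<close> in a coordinate \<open>c = (D, w)\<close> that may lie outside the atlas.\<close>

definition has_local_form ::
    "'a surface \<Rightarrow> 'a differential \<Rightarrow> 'a chart \<Rightarrow> (complex \<Rightarrow> complex) \<Rightarrow> bool" where
  "has_local_form X \<omega> c f \<longleftrightarrow>
     (\<forall>d\<in>surf_atlas X. \<forall>p\<in>fst c \<inter> fst d. f (snd c p) = \<omega> d p * transition_deriv c d p)"


section \<open>Periods\<close>

definition surface_path :: "'a surface \<Rightarrow> (real \<Rightarrow> 'a) \<Rightarrow> bool" where
  "surface_path X \<gamma> \<longleftrightarrow> pathin (surf_top X) \<gamma> \<and>
     (\<forall>c\<in>surf_atlas X. \<forall>a b. 0 \<le> a \<and> a \<le> b \<and> b \<le> 1 \<and> \<gamma> ` {a..b} \<subseteq> fst c \<longrightarrow>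
        (snd c \<circ> \<gamma>) piecewise_C1_differentiable_on {a..b})"

text \<open>
  The integrand is the value of \<open>\<omega>\<close> on the velocity vector, which does not depend on the chart
  chosen at \<open>\<gamma> t\<close>.
\<close>

definition line_integral :: "'a surface \<Rightarrow> 'a differential \<Rightarrow> (real \<Rightarrow> 'a) \<Rightarrow> complex" where
  "line_integral X \<omega> \<gamma> = integral {0..1} (\<lambda>t.
     let c = (SOME c. c \<in> surf_atlas X \<and> \<gamma> t \<in> fst c)
     in \<omega> c (\<gamma> t) * vector_derivative (snd c \<circ> \<gamma>) (at t within {0..1}))"

text \<open>A chain is a formal integer combination of paths; a cycle is a chain with zero boundary.\<close>

type_synonym 'a chain = "(int \<times> (real \<Rightarrow> 'a)) list"

definition is_cycle :: "'a surface \<Rightarrow> 'a chain \<Rightarrow> bool" where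
  "is_cycle X C \<longleftrightarrow> (\<forall>(m, \<gamma>)\<in>set C. surface_path X \<gamma>) \<and>
     (\<forall>p. (\<Sum>(m, \<gamma>)\<leftarrow>C. m * (of_bool (\<gamma> 1 = p) - of_bool (\<gamma> 0 = p))) = 0)"

definition period :: "'a surface \<Rightarrow> 'a differential \<Rightarrow> 'a chain \<Rightarrow> complex" where
  "period X \<omega> C = (\<Sum>(m, \<gamma>)\<leftarrow>C. of_int m * line_integral X \<omega> \<gamma>)"


section \<open>The integral norm\<close>

text \<open>
  The integral of the 2-form with coefficient \<open>\<eta> c p\<close> with respect to \<open>dz \<and> d(cnj z) = -2i dx \<and> dy\<close>
  in the chart \<open>c\<close>. A finite cover by charts is cut into disjoint pieces, each lying in a
  chart; by the change of variables formula the value does not depend on the cover.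
\<close>

definition finite_chart_cover :: "'a surface \<Rightarrow> 'a chart list \<Rightarrow> bool" where
  "finite_chart_cover X cs \<longleftrightarrow>
     set cs \<subseteq> surf_atlas X \<and> (\<Union>c\<in>set cs. fst c) = topspace (surf_top X)"

definition integral_over_cover :: "'a chart list \<Rightarrow> ('a chart \<Rightarrow> 'a \<Rightarrow> complex) \<Rightarrow> complex" where
  "integral_over_cover cs \<eta> = (\<Sum>i<length cs.
     - 2 * \<i> * (LINT z : snd (cs ! i) ` (fst (cs ! i) - (\<Union>j<i. fst (cs ! j))) | lborel.
                  \<eta> (cs ! i) (inv_into (fst (cs ! i)) (snd (cs ! i)) z)))"

definition surface_integral :: "'a surface \<Rightarrow> ('a chart \<Rightarrow> 'a \<Rightarrow> complex) \<Rightarrow> complex" where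
  "surface_integral X \<eta> = integral_over_cover (SOME cs. finite_chart_cover X cs) \<eta>"

definition integral_norm :: "'a surface \<Rightarrow> 'a differential \<Rightarrow> complex" where
  "integral_norm X \<omega> = \<i> / 2 * surface_integral X (\<lambda>c p. \<omega> c p * cnj (\<omega> c p))"


section \<open>Cutting and regluing\<close>

text \<open>
  The surface \<open>X\<close> is cut open along the part of the coordinate disc \<open>c = (D, w)\<close> where
  \<open>w \<in> S\<close>. The points of the reglued surface are the points of the complement of the cut (\<open>Inl\<close>) and
  the filled-in points of \<open>S\<close> in the \<open>\<zeta>\<close>-plane (\<open>Inr\<close>). The region \<open>filled_region c S A\<close> of
  the \<open>\<zeta>\<close>-plane is mapped to the reglued surface by \<open>glue c S A\<close>, which expresses the identification
  \<open>\<zeta> = A w\<close>; the topology is the quotient topology of the gluing.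
\<close>

definition cut_set :: "'a chart \<Rightarrow> complex set \<Rightarrow> 'a set" where
  "cut_set c S = {p \<in> fst c. snd c p \<in> S}"

definition filled_region :: "'a chart \<Rightarrow> complex set \<Rightarrow> (complex \<Rightarrow> complex) \<Rightarrow> complex set" where
  "filled_region c S A = A ` (snd c ` fst c - S) \<union> S"

definition glue ::
    "'a chart \<Rightarrow> complex set \<Rightarrow> (complex \<Rightarrow> complex) \<Rightarrow> complex \<Rightarrow> 'a + complex" where
  "glue c S A \<zeta> =
     (if \<zeta> \<in> S then Inr \<zeta>
      else Inl (inv_into (fst c) (snd c) (inv_into (snd c ` fst c - S) A \<zeta>)))"

definition reglue_open :: "'a surface \<Rightarrow> 'a chart \<Rightarrow> complex set \<Rightarrow> (complex \<Rightarrow> complex) \<Rightarrow>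
    ('a + complex) set \<Rightarrow> bool" where
  "reglue_open X c S A W \<longleftrightarrow>
     W \<subseteq> Inl ` (topspace (surf_top X) - cut_set c S) \<union> Inr ` S \<and>
     openin (surf_top X) {p \<in> topspace (surf_top X) - cut_set c S. Inl p \<in> W} \<and>
     open {\<zeta> \<in> filled_region c S A. glue c S A \<zeta> \<in> W}"

lemma istopology_reglue_open: "istopology (reglue_open X c S A)"
  unfolding istopology_def
proof (intro conjI allI impI)
  fix V W assume V: "reglue_open X c S A V" and W: "reglue_open X c S A W"
  let ?Q = "\<lambda>W. {p \<in> topspace (surf_top X) - cut_set c S. Inl p \<in> W}"
  let ?R = "\<lambda>W. {\<zeta> \<in> filled_region c S A. glue c S A \<zeta> \<in> W}"
  have "?Q (V \<inter> W) = ?Q V \<inter> ?Q W" "?R (V \<inter> W) = ?R V \<inter> ?R W" by auto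
  thus "reglue_open X c S A (V \<inter> W)" using V W unfolding reglue_open_def by auto
next
  fix K assume K: "\<forall>W\<in>K. reglue_open X c S A W"
  let ?Q = "\<lambda>W. {p \<in> topspace (surf_top X) - cut_set c S. Inl p \<in> W}"
  let ?R = "\<lambda>W. {\<zeta> \<in> filled_region c S A. glue c S A \<zeta> \<in> W}"
  have "?Q (\<Union>K) = \<Union>(?Q ` K)" "?R (\<Union>K) = \<Union>(?R ` K)" by auto
  thus "reglue_open X c S A (\<Union>K)" using K unfolding reglue_open_def by auto
qed

definition cut_chart :: "complex set \<Rightarrow> 'a chart \<Rightarrow> 'a chart \<Rightarrow> ('a + complex) chart" where
  "cut_chart S c d = (Inl ` (fst d - cut_set c S), snd d \<circ> projl)"

definition filled_chart ::
    "'a chart \<Rightarrow> complex set \<Rightarrow> (complex \<Rightarrow> complex) \<Rightarrow> ('a + complex) chart" where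
  "filled_chart c S A =
     (Inl ` (fst c - cut_set c S) \<union> Inr ` S, case_sum (\<lambda>p. A (snd c p)) (\<lambda>\<zeta>. \<zeta>))"

definition reglue ::
    "'a surface \<Rightarrow> 'a chart \<Rightarrow> complex set \<Rightarrow> (complex \<Rightarrow> complex) \<Rightarrow> ('a + complex) surface" where
  "reglue X c S A =
     \<lparr>surf_top = topology (reglue_open X c S A),
      surf_atlas = insert (filled_chart c S A) (cut_chart S c ` surf_atlas X)\<rparr>"

text \<open>\<open>\<omega>'\<close> on the reglued surface extends the restriction of \<open>\<omega>\<close> to the complement of the cut.\<close>

definition extends_differential :: "'a surface \<Rightarrow> 'a chart \<Rightarrow> complex set \<Rightarrow> 'a differential \<Rightarrow>
    ('a + complex) differential \<Rightarrow> bool" where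
  "extends_differential X c S \<omega> \<omega>' \<longleftrightarrow>
     (\<forall>d\<in>surf_atlas X. \<forall>p\<in>fst d - cut_set c S. \<omega>' (cut_chart S c d) (Inl p) = \<omega> d p)"

end

theory Submission
  imports Defs
begin

text \<open>
  With \<open>u = z ^ n\<close> the star map satisfies \<open>star_map n z ^ n = u + 1 / u - 2\<close>, and multiplying \<open>z\<close> by
  \<open>e_root n\<close> replaces \<open>u\<close> by \<open>- u\<close>. Hence \<open>A = slit_map n \<epsilon>\<close> satisfies \<open>A w ^ n = - (w ^ n) - 4 * \<epsilon> ^ n\<close>,
  and more precisely \<open>A w = e_root n * w * (1 + 4 * \<epsilon> ^ n / w ^ n) powr (1 / n)\<close> with the principal
  branch on the whole complement of the slits. This gives the expansion in \<open>\<epsilon> ^ n\<close>, and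
  differentiating the \<open>n\<close>-th power gives \<open>- w ^ (n - 1) dw = \<zeta> ^ (n - 1) d\<zeta>\<close> for \<open>\<zeta> = A w\<close>, so the
  pushforward extends over the slits.

  The filled-in region of the \<open>\<zeta>\<close>-plane is the set where \<open>norm (\<zeta> ^ n + 4 * \<epsilon> ^ n) < \<rho> ^ n\<close>, an open set
  that is starlike about \<open>0\<close>; this makes the reglued surface a compact connected Riemann surface.
  Nothing changes along cycles off the disc. The area form of the new differential is the old
  one off a null set, and the area of a piece lying in two charts may be computed in either, so
  the two norms agree by cutting both surfaces into common pieces.
\<close>

section \<open>The slit map\<close>

text \<open>Knowing \<open>A w ^ n\<close> fixes \<open>A w\<close> only up to an
  \<open>n\<close>-th root of unity. The branch is settled by a direct identity: for
  \<open>q = 1 / u\<close>, so that \<open>norm q < 1\<close>, one has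
  \<open>(1 + q) ^ 2 = (1 - q) ^ 2 + 4 * q\<close>. This is the origin of the constant 4 in
  \<open>4 * \<epsilon> ^ n\<close>, and hence of the 4 and 16 in the cocycles.

  The comparison of the surfaces is shaped by two uses of \<open>SOME\<close>: the chart at each
  point of a path in \<open>line_integral\<close>, and the finite cover in
  \<open>surface_integral\<close>. The choices made on the two surfaces are unrelated, and a chosen
  chart of the new one may be the filled chart, so independence of the choice has to come before any
  comparison. For areas this is done with nonnegative extended integrals, where additivity and
  change of chart hold without integrability; compactness supplies finiteness.

  The coordinate disc is open and may have boundary points in the surface. A smaller disc, of radius
  strictly between the slit length and \<open>\<rho>\<close>, leaves the room in which such points
  are separated from the filled-in slits.\<close>

text \<open>The argument of \<open>v\<close> is below pi/2 in absolute value, so twice the logarithm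
  is still in the principal strip.\<close>

lemma Ln_square_Re_pos:
  assumes "Re v > 0"
  shows "Ln (v\<^sup>2) = 2 * Ln v"
proof (rule Ln_unique)
  have v: "v \<noteq> 0" using assms by auto
  show "exp (2 * Ln v) = v\<^sup>2"
    using v by (metis exp_Ln exp_double)
  have "\<bar>Im (Ln v)\<bar> < pi / 2" using assms v Re_Ln_pos_lt by blast
  thus "- pi < Im (2 * Ln v)" "Im (2 * Ln v) \<le> pi" by auto
qed

lemma Ln_divide_Re_pos:
  assumes "Re a > 0" "Re b > 0"
  shows "Ln (a / b) = Ln a - Ln b"
proof (rule Ln_unique)
  have nz: "a \<noteq> 0" "b \<noteq> 0" using assms by auto
  thus "exp (Ln a - Ln b) = a / b" by (simp add: exp_diff)
  have "\<bar>Im (Ln a)\<bar> < pi / 2" "\<bar>Im (Ln b)\<bar> < pi / 2"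
    using assms nz Re_Ln_pos_lt by blast+
  thus "- pi < Im (Ln a - Ln b)" "Im (Ln a - Ln b) \<le> pi" by (auto simp: abs_if split: if_splits)
qed

text \<open>For \<open>norm q < 1\<close> the quotient \<open>(1 + q) / (1 - q)\<close> lies in the right half plane, so no branch
  of the power is crossed.\<close>

lemma cayley_powr:
  fixes q a :: complex
  assumes "norm q < 1"
  shows "(1 + q) powr (2 * a) = (1 - q) powr (2 * a) * (1 + 4 * q / (1 - q)\<^sup>2) powr a"
proof -
  have q: "\<bar>Re q\<bar> < 1" using assms abs_Re_le_cmod[of q] by linarith
  have re: "Re (1 + q) > 0" "Re (1 - q) > 0" using q by auto
  hence nz: "1 + q \<noteq> 0" "1 - q \<noteq> 0" by (metis less_irrefl zero_complex.sel(1))+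
  define v where "v = (1 + q) / (1 - q)"
  have v2: "1 + 4 * q / (1 - q)\<^sup>2 = v\<^sup>2"
    using nz by (simp add: v_def power_divide field_simps) (simp add: power2_eq_square algebra_simps)
  \<comment> \<open>The real part of \<open>v\<close> has the sign of the real part of numerator
    times conjugate denominator. As \<open>q - cnj q\<close> is imaginary, that part is
    \<open>1 - (norm q) ^ 2\<close>.\<close>
  have "(1 + q) * cnj (1 - q) = of_real (1 - (norm q)\<^sup>2) + (q - cnj q)"
    by (simp add: algebra_simps complex_norm_square del: of_real_power)
  moreover have "Re (of_real (1 - (norm q)\<^sup>2) + (q - cnj q)) = 1 - (norm q)\<^sup>2" by simp
  moreover have "(norm q)\<^sup>2 < 1" using assms by (simp add: power_less_one_iff)
  ultimately have "Re ((1 + q) * cnj (1 - q)) > 0" by simp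
  hence "Re v > 0"
    unfolding v_def by (subst complex_div_cnj) (use nz in \<open>simp add: divide_pos_pos del: complex_cnj_diff\<close>)
  have "v \<noteq> 0" using nz by (simp add: v_def)
  have L: "Ln (v\<^sup>2) = 2 * (Ln (1 + q) - Ln (1 - q))"
    using Ln_square_Re_pos[OF \<open>Re v > 0\<close>] Ln_divide_Re_pos[OF re] by (simp add: v_def)
  have "2 * a * Ln (1 + q) = 2 * a * Ln (1 - q) + a * Ln (v\<^sup>2)"
    unfolding L by (simp add: algebra_simps)
  thus ?thesis using nz \<open>v \<noteq> 0\<close> unfolding v2 by (simp add: powr_def exp_add)
qed

lemma e_root_power [simp]:
  assumes "n > 0"
  shows "e_root n ^ n = -1"
proof -
  have "e_root n ^ n = exp (of_nat n * (of_real pi * \<i> / of_nat n))"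
    unfolding e_root_def by (rule exp_of_nat_mult [symmetric])
  also have "\<dots> = -1" using assms by (simp add: mult.commute)
  finally show ?thesis .
qed

lemma norm_e_root [simp]: "norm (e_root n) = 1"
proof -
  have "e_root n = cis (pi / n)" by (simp add: e_root_def cis_conv_exp field_simps)
  thus ?thesis by simp
qed

lemma e_root_nonzero [simp]: "e_root n \<noteq> 0"
  using norm_e_root[of n] by force

section \<open>The slits as a subset of the plane\<close>

text \<open>Reduces questions about the star to the single number \<open>w ^ n\<close>: the slits
  are the whole preimage of a real segment under the \<open>n\<close>-th power, so no angles appear
  in the later estimates.\<close>

lemma mem_slits_iff:
  assumes "n > 0" "\<epsilon> > 0"
  shows "w \<in> slits n \<epsilon> \<longleftrightarrow> (\<exists>s::real. 0 \<le> s \<and> s \<le> 4 * \<epsilon> ^ n \<and> w ^ n = - of_real s)"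
proof -
  have e: "\<epsilon> ^ n > 0" "of_real \<epsilon> \<noteq> (0::complex)" using assms by auto
  have "w \<in> slits n \<epsilon> \<longleftrightarrow> w / of_real \<epsilon> \<in> star n"
    unfolding slits_def using e(2) by (force simp: image_iff)
  also have "\<dots> \<longleftrightarrow> (\<exists>s::real. 0 \<le> s \<and> s \<le> 4 \<and> w ^ n = - of_real (s * \<epsilon> ^ n))"
    unfolding mem_star_iff[OF assms(1)] using e(2)
    by (auto simp: power_divide field_simps)
  also have "\<dots> \<longleftrightarrow> (\<exists>s::real. 0 \<le> s \<and> s \<le> 4 * \<epsilon> ^ n \<and> w ^ n = - of_real s)"
  proof
    assume "\<exists>s::real. 0 \<le> s \<and> s \<le> 4 \<and> w ^ n = - of_real (s * \<epsilon> ^ n)"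
    then obtain s :: real where "0 \<le> s" "s \<le> 4" "w ^ n = - of_real (s * \<epsilon> ^ n)" by blast
    thus "\<exists>s::real. 0 \<le> s \<and> s \<le> 4 * \<epsilon> ^ n \<and> w ^ n = - of_real s"
      using e by (intro exI[of _ "s * \<epsilon> ^ n"]) auto
  next
    assume "\<exists>s::real. 0 \<le> s \<and> s \<le> 4 * \<epsilon> ^ n \<and> w ^ n = - of_real s"
    then obtain s :: real where "0 \<le> s" "s \<le> 4 * \<epsilon> ^ n" "w ^ n = - of_real s" by blast
    thus "\<exists>s::real. 0 \<le> s \<and> s \<le> 4 \<and> w ^ n = - of_real (s * \<epsilon> ^ n)"
      using e by (intro exI[of _ "s / \<epsilon> ^ n"]) (auto simp: divide_le_eq)
  qed
  finally show ?thesis .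
qed

lemma zero_in_slits:
  assumes "n > 0" "\<epsilon> > 0"
  shows "0 \<in> slits n \<epsilon>"
  unfolding mem_slits_iff[OF assms] using assms by (intro exI[of _ 0]) (auto simp: zero_power)

text \<open>The form used for topology and measure: a finite union of segments is compact, and each
  segment is a null set.\<close>

lemma slits_eq_segments:
  assumes "\<epsilon> > 0"
  shows "slits n \<epsilon> = (\<Union>k<n. closed_segment 0
           (of_real (\<epsilon> * 4 powr (1 / real n)) * cis ((1 + 2 * real k) * pi / real n)))"
    (is "_ = (\<Union>k<n. closed_segment 0 (of_real (\<epsilon> * ?L) * ?c k))")
proof -
  have L: "?L > 0" by simp
  have "slits n \<epsilon> = {of_real (\<epsilon> * r) * ?c k | r k. 0 \<le> r \<and> r \<le> ?L \<and> k < n}"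
    unfolding slits_def star_def by (force simp: image_iff mult.assoc)
  also have "\<dots> = (\<Union>k<n. closed_segment 0 (of_real (\<epsilon> * ?L) * ?c k))"
  proof (intro set_eqI iffI)
    fix x assume "x \<in> {of_real (\<epsilon> * r) * ?c k | r k. 0 \<le> r \<and> r \<le> ?L \<and> k < n}"
    then obtain r k where "x = of_real (\<epsilon> * r) * ?c k" "0 \<le> r" "r \<le> ?L" "k < n" by blast
    moreover from this have "x = (r / ?L) *\<^sub>R (of_real (\<epsilon> * ?L) * ?c k)"
      using L by (simp add: scaleR_conv_of_real)
    ultimately show "x \<in> (\<Union>k<n. closed_segment 0 (of_real (\<epsilon> * ?L) * ?c k))"
      using L unfolding closed_segment_def
      by (intro UN_I[of k]) (auto intro!: exI[of _ "r / ?L"] simp: divide_le_eq)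
  next
    fix x assume "x \<in> (\<Union>k<n. closed_segment 0 (of_real (\<epsilon> * ?L) * ?c k))"
    then obtain u k where "x = u *\<^sub>R (of_real (\<epsilon> * ?L) * ?c k)" "0 \<le> u" "u \<le> 1" "k < n"
      by (auto simp: closed_segment_def)
    moreover from this have "x = of_real (\<epsilon> * (u * ?L)) * ?c k"
      by (simp add: scaleR_conv_of_real)
    moreover have "u * ?L \<le> ?L" using \<open>u \<le> 1\<close> L by (simp add: mult_left_le_one_le \<open>0 \<le> u\<close>)
    ultimately show "x \<in> {of_real (\<epsilon> * r) * ?c k | r k. 0 \<le> r \<and> r \<le> ?L \<and> k < n}"
      using L by (intro CollectI exI[of _ "u * ?L"] exI[of _ k]) auto
  qed
  finally show ?thesis .
qed

lemma compact_slits: "\<epsilon> > 0 \<Longrightarrow> compact (slits n \<epsilon>)"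
  by (simp add: slits_eq_segments compact_UN)

lemma open_Compl_slits: "\<epsilon> > 0 \<Longrightarrow> open (- slits n \<epsilon>)"
  using compact_slits by (simp add: compact_imp_closed open_Compl)

text \<open>Each segment issues from 0 and so lies in a real line, a subspace of dimension at most 1
  in the plane.\<close>

lemma negligible_slits:
  assumes "\<epsilon> > 0"
  shows "negligible (slits n \<epsilon>)"
proof -
  have "negligible (closed_segment 0 c)" for c :: complex
  proof (rule negligible_lowdim)
    have "closed_segment 0 c \<subseteq> span {c}"
      by (auto simp: closed_segment_def span_mul span_base)
    hence "dim (closed_segment 0 c) \<le> card {c}"
      by (intro dim_le_card) auto
    thus "dim (closed_segment 0 c) < DIM(complex)" by simp
  qed
  thus ?thesis using assms by (auto simp: slits_eq_segments)
qed

section \<open>Closed form of the slit map\<close>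

text \<open>The cut of the principal branch is met only over the slits: a value
  \<open>r \<le> 0\<close> forces \<open>w ^ n = - 4 * \<epsilon> ^ n / (1 - r)\<close>, and
  \<open>1 - r \<ge> 1\<close> puts this into the segment.\<close>

lemma slit_map_base_not_nonpos:
  assumes "n > 0" "\<epsilon> > 0" "w \<notin> slits n \<epsilon>"
  shows "1 + 4 * of_real (\<epsilon> ^ n) / w ^ n \<notin> \<real>\<^sub>\<le>\<^sub>0"
proof
  have w: "w ^ n \<noteq> 0" using assms zero_in_slits by auto
  assume "1 + 4 * of_real (\<epsilon> ^ n) / w ^ n \<in> \<real>\<^sub>\<le>\<^sub>0"
  then obtain r where r: "r \<le> 0" "1 + 4 * of_real (\<epsilon> ^ n) / w ^ n = complex_of_real r"
    by (auto elim: nonpos_Reals_cases)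
  have "4 * of_real (\<epsilon> ^ n) = w ^ n * complex_of_real (r - 1)"
    using r(2) w by (simp add: field_simps)
  moreover have "complex_of_real (r - 1) \<noteq> 0" using r by (simp only: of_real_eq_0_iff)
  ultimately have "w ^ n = - of_real (4 * \<epsilon> ^ n / (1 - r))"
    by (simp add: field_simps)
  moreover have "4 * \<epsilon> ^ n / (1 - r) \<le> 4 * \<epsilon> ^ n" "4 * \<epsilon> ^ n / (1 - r) \<ge> 0"
    using r assms by (auto simp: divide_le_eq mult_le_cancel_left1)
  ultimately show False using assms mem_slits_iff by blast
qed

text \<open>Eliminates the inverse of the star map. With \<open>y = z / \<epsilon>\<close> and
  \<open>q = 1 / y ^ n\<close>, rotating \<open>y\<close> by \<open>e_root n\<close> turns the
  factor \<open>(1 - q) powr (2 / n)\<close> into \<open>(1 + q) powr (2 / n)\<close>. By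
  \<open>cayley_powr\<close> the ratio of the two depends only on \<open>q / (1 - q) ^ 2\<close>,
  the Koebe function, and this is exactly \<open>\<epsilon> ^ n / w ^ n\<close>.\<close>

lemma slit_map_eq:
  assumes "n > 0" "\<epsilon> > 0" "w \<notin> slits n \<epsilon>"
  shows "slit_map n \<epsilon> w
           = e_root n * w * (1 + 4 * of_real (\<epsilon> ^ n) / w ^ n) powr (1 / of_nat n)"
proof -
  define z where "z = scaled_star_map_inv n \<epsilon> w"
  define y where "y = z / of_real \<epsilon>"
  define q where "q = 1 / y ^ n"
  have im: "w \<in> scaled_star_map n \<epsilon> ` {z. norm z > \<epsilon>}"
    using bij_betw_scaled_star_map[OF assms(1,2)] assms(3) by (auto simp: bij_betw_def)
  have z: "norm z > \<epsilon>" "scaled_star_map n \<epsilon> z = w"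
    using inv_into_into[OF im] f_inv_into_f[OF im] by (auto simp: z_def scaled_star_map_inv_def)
  have y: "norm y > 1" using z assms by (simp add: y_def norm_divide)
  hence y0: "y ^ n \<noteq> 0" by auto
  have "norm (y ^ n) > 1" using y assms by (simp add: norm_power one_less_power)
  hence q: "norm q < 1" using assms y0 by (simp add: q_def norm_divide divide_less_eq_1)
  hence q1: "1 - q \<noteq> 0" by auto
  have w: "w = of_real \<epsilon> * (y * (1 - q) powr (2 / of_nat n))"
    using z by (simp add: scaled_star_map_def star_map_def y_def q_def)
  have "star_map n y ^ n = (1 - q)\<^sup>2 / q"
  proof -
    have "(1 - 1 / u)\<^sup>2 / (1 / u) = u + 1 / u - 2" if "u \<noteq> 0" for u :: complex
      using that by (simp add: field_simps power2_eq_square)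
    thus ?thesis using y0 star_map_power[OF assms(1) y] by (simp add: q_def)
  qed
  moreover have "w ^ n = of_real (\<epsilon> ^ n) * (star_map n y) ^ n"
    using z by (simp add: scaled_star_map_def y_def power_mult_distrib flip: z(2))
  ultimately have "w ^ n = of_real (\<epsilon> ^ n) * ((1 - q)\<^sup>2 / q)" by simp
  hence "4 * of_real (\<epsilon> ^ n) / w ^ n = 4 * q / (1 - q)\<^sup>2"
    using q1 assms by simp
  hence eq: "(1 + q) powr (2 / of_nat n)
        = (1 - q) powr (2 / of_nat n) * (1 + 4 * of_real (\<epsilon> ^ n) / w ^ n) powr (1 / of_nat n)"
    using cayley_powr[OF q, of "1 / of_nat n"] by simp
  have "slit_map n \<epsilon> w = of_real \<epsilon> * star_map n (e_root n * y)"
    by (simp add: slit_map_def scaled_star_map_def z_def[symmetric] y_def)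
  also have "star_map n (e_root n * y) = e_root n * y * (1 + q) powr (2 / of_nat n)"
    using assms by (simp add: star_map_def power_mult_distrib q_def)
  finally show ?thesis unfolding eq by (subst (2) w) simp
qed

lemma slit_map_power:
  assumes "n > 0" "\<epsilon> > 0" "w \<notin> slits n \<epsilon>"
  shows "slit_map n \<epsilon> w ^ n = - (w ^ n) - 4 * of_real (\<epsilon> ^ n)"
proof -
  define b where "b = 1 + 4 * of_real (\<epsilon> ^ n) / w ^ n"
  have w: "w ^ n \<noteq> 0" using assms zero_in_slits by auto
  have "b \<noteq> 0" using slit_map_base_not_nonpos[OF assms] by (auto simp: b_def)
  hence "(b powr (1 / of_nat n)) ^ n = b"
    using assms by (simp add: powr_def flip: exp_of_nat_mult)
  hence "slit_map n \<epsilon> w ^ n = - (w ^ n * b)"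
    unfolding slit_map_eq[OF assms] using assms by (simp add: power_mult_distrib b_def)
  also have "w ^ n * b = w ^ n + 4 * of_real (\<epsilon> ^ n)" using w by (simp add: b_def field_simps)
  finally show ?thesis by simp
qed

text \<open>The slit map is conjugate to a rotation, and \<open>{z. norm z > \<epsilon>}\<close> is
  invariant under rotation.\<close>

lemma bij_betw_slit_map:
  assumes "n > 0" "\<epsilon> > 0"
  shows "bij_betw (slit_map n \<epsilon>) (- slits n \<epsilon>) (- slits n \<epsilon>)"
proof -
  let ?E = "{z::complex. norm z > \<epsilon>}"
  have N: "bij_betw (scaled_star_map n \<epsilon>) ?E (- slits n \<epsilon>)"
    by (rule bij_betw_scaled_star_map) fact+
  have rot: "bij_betw ((*) (e_root n)) ?E ?E"
    by (rule bij_betwI[of _ _ _ "\<lambda>z. z / e_root n"]) (auto simp: norm_mult norm_divide)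
  have "bij_betw (scaled_star_map n \<epsilon> \<circ> ((*) (e_root n) \<circ> scaled_star_map_inv n \<epsilon>))
          (- slits n \<epsilon>) (- slits n \<epsilon>)"
    unfolding scaled_star_map_inv_def
    by (intro bij_betw_trans[OF bij_betw_trans[OF bij_betw_inv_into[OF N] rot] N])
  thus ?thesis by (simp add: slit_map_def[abs_def] o_def)
qed

lemma holomorphic_slit_map:
  assumes "n > 0" "\<epsilon> > 0"
  shows "slit_map n \<epsilon> holomorphic_on - slits n \<epsilon>"
proof (rule holomorphic_transform)
  show "(\<lambda>w. e_root n * w * (1 + 4 * of_real (\<epsilon> ^ n) / w ^ n) powr (1 / of_nat n))
          holomorphic_on - slits n \<epsilon>"
    using slit_map_base_not_nonpos[OF assms] zero_in_slits[OF assms]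
    by (auto intro!: holomorphic_intros)
qed (use slit_map_eq[OF assms] in auto)

text \<open>An injective holomorphic map has a holomorphic inverse; it is identified here with
  \<open>inv_into\<close>, the form that occurs in \<open>pushforward\<close>.\<close>

lemma holomorphic_inv_slit_map:
  assumes "n > 0" "\<epsilon> > 0"
  shows "inv_into (- slits n \<epsilon>) (slit_map n \<epsilon>) holomorphic_on - slits n \<epsilon>"
proof -
  let ?S = "- slits n \<epsilon>" and ?A = "slit_map n \<epsilon>"
  have op: "open ?S" using assms(2) by (rule open_Compl_slits)
  have inj: "inj_on ?A ?S" and im: "?A ` ?S = ?S"
    using bij_betw_slit_map[OF assms] by (auto simp: bij_betw_def)
  obtain g where g: "g holomorphic_on ?A ` ?S" "\<And>z. z \<in> ?S \<Longrightarrow> g (?A z) = z"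
    using holomorphic_has_inverse[OF holomorphic_slit_map[OF assms] op inj] by metis
  show ?thesis
  proof (rule holomorphic_transform)
    show "g holomorphic_on ?S" using g im by simp
    show "g x = inv_into ?S ?A x" if "x \<in> ?S" for x
      using g(2)[of "inv_into ?S ?A x"] that im by (metis f_inv_into_f inv_into_into)
  qed
qed

section \<open>Transformation of the differential\<close>

text \<open>Stated for a general \<open>h\<close> because the relation
  \<open>w ^ n + \<zeta> ^ n = - 4 * \<epsilon> ^ n\<close> is symmetric: it is applied both to the
  slit map and to its inverse.\<close>

lemma power_eq_imp_deriv_eq:
  assumes "n > 0" "open U" "h holomorphic_on U" "z \<in> U"
    and eq: "\<And>x. x \<in> U \<Longrightarrow> h x ^ n = - (x ^ n) - c"
  shows "h z ^ (n - 1) * deriv h z = - (z ^ (n - 1))"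
proof -
  have "(h has_field_derivative deriv h z) (at z)"
    using assms by (intro holomorphic_derivI)
  hence "((\<lambda>x. h x ^ n) has_field_derivative of_nat n * h z ^ (n - 1) * deriv h z) (at z)"
    by (auto intro!: derivative_eq_intros)
  moreover have "((\<lambda>x. h x ^ n) has_field_derivative - (of_nat n * z ^ (n - 1))) (at z)"
  proof (rule has_field_derivative_transform_within_open[OF _ assms(2,4)])
    show "((\<lambda>x. - (x ^ n) - c) has_field_derivative - (of_nat n * z ^ (n - 1))) (at z)"
      by (auto intro!: derivative_eq_intros)
  qed (simp add: eq)
  ultimately have "of_nat n * h z ^ (n - 1) * deriv h z = - (of_nat n * z ^ (n - 1))"
    by (rule DERIV_unique)
  hence "of_nat n * (h z ^ (n - 1) * deriv h z) = of_nat n * (- (z ^ (n - 1)))"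
    by (simp only: mult.assoc mult_minus_right)
  thus ?thesis using assms(1) by (simp only: mult_cancel_left) auto
qed

lemma slit_map_power_deriv:
  assumes "n > 0" "\<epsilon> > 0" "w \<notin> slits n \<epsilon>"
  shows "slit_map n \<epsilon> w ^ (n - 1) * deriv (slit_map n \<epsilon>) w = - (w ^ (n - 1))"
  by (rule power_eq_imp_deriv_eq[OF assms(1) open_Compl_slits holomorphic_slit_map _ slit_map_power])
    (use assms in auto)

lemma pushforward_slit_map:
  assumes "n > 0" "\<epsilon> > 0" "\<zeta> \<notin> slits n \<epsilon>"
  shows "pushforward (slit_map n \<epsilon>) (- slits n \<epsilon>) (\<lambda>w. - (w ^ (n - 1))) \<zeta> = \<zeta> ^ (n - 1)"
proof -
  let ?S = "- slits n \<epsilon>" and ?A = "slit_map n \<epsilon>"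
  define B where "B = inv_into ?S ?A"
  have im: "?A ` ?S = ?S" by (rule bij_betw_imp_surj_on[OF bij_betw_slit_map[OF assms(1,2)]])
  have "B \<eta> ^ n = - (\<eta> ^ n) - 4 * of_real (\<epsilon> ^ n)" if "\<eta> \<in> ?S" for \<eta>
  proof -
    have "B \<eta> \<in> ?S" "?A (B \<eta>) = \<eta>"
      using that im inv_into_into[of \<eta> ?A ?S] f_inv_into_f[of \<eta> ?A ?S] by (auto simp: B_def)
    thus ?thesis using slit_map_power[OF assms(1,2), of "B \<eta>"] by auto
  qed
  moreover have "B holomorphic_on ?S"
    using holomorphic_inv_slit_map[OF assms(1,2)] by (simp add: B_def)
  ultimately have "B \<zeta> ^ (n - 1) * deriv B \<zeta> = - (\<zeta> ^ (n - 1))"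
    using assms by (intro power_eq_imp_deriv_eq[OF assms(1) open_Compl_slits]) auto
  thus ?thesis by (simp add: pushforward_def B_def)
qed

section \<open>The family in \<open>\<epsilon> ^ n\<close> and its variation cocycles\<close>

text \<open>For \<open>norm t < r ^ n / 4\<close> and \<open>norm w > r\<close> the base
  \<open>1 + 4 * t / w ^ n\<close> is within distance 1 of 1. So one \<open>\<delta>\<close> serves
  all \<open>w\<close> and all complex \<open>t\<close>, and the principal branch never meets its
  cut. The cocycles come from the binomial series with exponent \<open>a = 1 / n\<close>: they are
  \<open>w * a * c\<close> and \<open>w * a * (a - 1) * c ^ 2\<close> with
  \<open>c = 4 / w ^ n\<close>.\<close>

lemma slit_map_family:
  assumes n: "n > 0" and "r > 0"
  shows "\<exists>\<delta>>0. \<exists>F.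
        holomorphic_family {t. norm t < \<delta>} {w. norm w > r} F \<and>
        (\<forall>w. norm w > r \<longrightarrow>
           F 0 w = w \<and>
           (\<forall>\<epsilon>>0. \<epsilon> ^ n < \<delta> \<longrightarrow>
              w \<notin> slits n \<epsilon> \<and> inverse (e_root n) * slit_map n \<epsilon> w = F (of_real (\<epsilon> ^ n)) w) \<and>
           deriv (\<lambda>t. F t w) 0 = 4 / (of_nat n * w ^ (n - 1)) \<and>
           (deriv ^^ 2) (\<lambda>t. F t w) 0
             = 16 * (1 - of_nat n) / ((of_nat n)\<^sup>2 * w ^ (2 * n - 1)))"
proof -
  define a :: complex where "a = 1 / of_nat n"
  define \<delta> where "\<delta> = r ^ n / 4"
  define F :: "complex \<Rightarrow> complex \<Rightarrow> complex" where "F = (\<lambda>t w. w * (1 + 4 * t / w ^ n) powr a)"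
  have \<delta>: "\<delta> > 0" using assms by (simp add: \<delta>_def)
  have wr: "norm (w ^ n) \<ge> 4 * \<delta>" "w \<noteq> 0" if "norm w > r" for w :: complex
  proof -
    have "r ^ n \<le> norm w ^ n" using that assms by (intro power_mono) auto
    thus "norm (w ^ n) \<ge> 4 * \<delta>" by (simp add: norm_power \<delta>_def)
    show "w \<noteq> 0" using that assms by auto
  qed
  have base: "1 + 4 * t / w ^ n \<notin> \<real>\<^sub>\<le>\<^sub>0" if "norm t < \<delta>" "norm w > r" for t w :: complex
  proof -
    have "norm (4 * t / w ^ n) < 1"
      using wr[OF that(2)] that(1) \<delta> by (auto simp: norm_divide norm_mult divide_less_eq)
    hence "Re (1 + 4 * t / w ^ n) > 0"
      using abs_Re_le_cmod[of "4 * t / w ^ n"] by simp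
    thus ?thesis by (auto simp: complex_nonpos_Reals_iff)
  qed
  have nz: "1 + 4 * t / w ^ n \<noteq> 0" if "norm t < \<delta>" "norm w > r" for t w :: complex
    using base[OF that] by auto
  have fam: "holomorphic_family {t. norm t < \<delta>} {w. norm w > r} F"
    unfolding holomorphic_family_def
  proof (intro conjI ballI)
    show "continuous_on ({t. norm t < \<delta>} \<times> {w. norm w > r}) (\<lambda>(t, w). F t w)"
    proof (rule continuous_on_eq)
      show "continuous_on ({t. norm t < \<delta>} \<times> {w. norm w > r})
              (\<lambda>x. snd x * exp (a * Ln (1 + 4 * fst x / snd x ^ n)))"
        by (intro continuous_intros) (use base wr in auto)
    qed (use nz in \<open>auto simp: F_def powr_def\<close>)
    show "(\<lambda>t. F t w) holomorphic_on {t. norm t < \<delta>}" if "w \<in> {w. norm w > r}" for w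
      unfolding F_def using base that wr by (auto intro!: holomorphic_intros)
    show "F t holomorphic_on {w. norm w > r}" if "t \<in> {t. norm t < \<delta>}" for t
      unfolding F_def using base that wr by (auto intro!: holomorphic_intros)
  qed
  have "F 0 w = w \<and>
           (\<forall>\<epsilon>>0. \<epsilon> ^ n < \<delta> \<longrightarrow>
              w \<notin> slits n \<epsilon> \<and> inverse (e_root n) * slit_map n \<epsilon> w = F (of_real (\<epsilon> ^ n)) w) \<and>
           deriv (\<lambda>t. F t w) 0 = 4 / (of_nat n * w ^ (n - 1)) \<and>
           (deriv ^^ 2) (\<lambda>t. F t w) 0
             = 16 * (1 - of_nat n) / ((of_nat n)\<^sup>2 * w ^ (2 * n - 1))"
    if w: "norm w > r" for w
  proof (intro conjI allI impI)
    show "F 0 w = w" by (simp add: F_def)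
  next
    fix \<epsilon> :: real assume \<epsilon>: "\<epsilon> > 0" "\<epsilon> ^ n < \<delta>"
    show ns: "w \<notin> slits n \<epsilon>"
    proof
      assume "w \<in> slits n \<epsilon>"
      then obtain s :: real where "0 \<le> s" "s \<le> 4 * \<epsilon> ^ n" "w ^ n = - of_real s"
        using mem_slits_iff[OF n \<epsilon>(1)] by blast
      thus False using wr(1)[OF w] \<epsilon> by auto
    qed
    show "inverse (e_root n) * slit_map n \<epsilon> w = F (of_real (\<epsilon> ^ n)) w"
      using slit_map_eq[OF n \<epsilon>(1) ns] by (simp add: F_def a_def field_simps)
  next
    define c where "c = 4 / w ^ n"
    have c0: "c \<noteq> 0" "w \<noteq> 0" using wr[OF w] by (auto simp: c_def)
    have wn: "w ^ n = w * w ^ (n - 1)" using n by (cases n) auto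
    \<comment> \<open>The exponent is left free: it is \<open>a\<close> for the first derivative and
      \<open>a - 1\<close> for the second.\<close>
    have D: "((\<lambda>t. (1 + t * c) powr s) has_field_derivative s * c * (1 + t * c) powr (s - 1)) (at t)"
      if "norm t < \<delta>" for s t
    proof -
      have "1 + t * c \<notin> \<real>\<^sub>\<le>\<^sub>0" using base[OF that w] by (simp add: c_def mult.commute)
      thus ?thesis by (auto intro!: derivative_eq_intros)
    qed
    have F: "F = (\<lambda>t w. w * (1 + t * (4 / w ^ n)) powr a)" by (simp add: F_def mult.commute)
    have d1: "deriv (\<lambda>t. F t w) t = w * (a * c * (1 + t * c) powr (a - 1))" if "norm t < \<delta>" for t
      unfolding F c_def[symmetric] by (intro DERIV_imp_deriv DERIV_cmult D that)
    show "deriv (\<lambda>t. F t w) 0 = 4 / (of_nat n * w ^ (n - 1))"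
      using \<delta> c0 by (subst d1) (auto simp: a_def c_def wn)
    have "(deriv ^^ 2) (\<lambda>t. F t w) 0 = deriv (\<lambda>t. deriv (\<lambda>t. F t w) t) 0"
      by (simp add: numeral_2_eq_2)
    \<comment> \<open>The formula for the first derivative is known only for
      \<open>norm t < \<delta>\<close>, so it is substituted as an equality near 0.\<close>
    also have "\<dots> = deriv (\<lambda>t. w * (a * c * (1 + t * c) powr (a - 1))) 0"
    proof (rule deriv_cong_ev)
      have "eventually (\<lambda>t::complex. t \<in> ball 0 \<delta>) (nhds 0)"
        using \<delta> by (intro eventually_nhds_in_open) auto
      thus "eventually (\<lambda>t. deriv (\<lambda>t. F t w) t = w * (a * c * (1 + t * c) powr (a - 1))) (nhds 0)"
        by eventually_elim (auto simp: d1)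
    qed auto
    also have "\<dots> = w * (a * c * ((a - 1) * c * (1 + 0 * c) powr (a - 1 - 1)))"
      using \<delta> by (intro DERIV_imp_deriv DERIV_cmult D) auto
    also have "\<dots> = w * a * (a - 1) * c\<^sup>2" by (simp add: power2_eq_square)
    also have "a * (a - 1) = (1 - of_nat n) / (of_nat n)\<^sup>2"
      using n by (simp add: a_def field_simps power2_eq_square)
    hence "w * a * (a - 1) * c\<^sup>2 = w * ((1 - of_nat n) / (of_nat n)\<^sup>2) * c\<^sup>2"
      by (metis mult.assoc)
    also have "w * c\<^sup>2 = 16 / w ^ (2 * n - 1)"
    proof -
      have "w * w ^ (2 * n - 1) = w ^ (2 * n)" using n by (cases n) auto
      also have "\<dots> = (w ^ n)\<^sup>2" by (simp add: power_mult mult.commute flip: power_mult)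
      finally show ?thesis using c0 by (simp add: c_def power_divide field_simps)
    qed
    hence "w * ((1 - of_nat n) / (of_nat n)\<^sup>2) * c\<^sup>2
        = (16 / w ^ (2 * n - 1)) * ((1 - of_nat n) / (of_nat n)\<^sup>2)" by (metis mult.assoc mult.commute)
    finally show "(deriv ^^ 2) (\<lambda>t. F t w) 0
             = 16 * (1 - of_nat n) / ((of_nat n)\<^sup>2 * w ^ (2 * n - 1))"
      by (simp add: mult.commute)
  qed
  thus ?thesis using fam \<delta> by blast
qed

text \<open>The pushforward is the restriction of an entire monomial, so the extension across the
  slits is given by the same formula. The hypothesis \<open>n > 1\<close> makes 0 a zero of it, and
  a nonzero value of \<open>g\<close> is what gives \<open>zorder\<close> its meaning.\<close>

lemma pushforward_slit_map_extends:
  assumes "n > 1" "\<epsilon> > 0"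
  shows "\<exists>g. g holomorphic_on UNIV \<and>
             (\<forall>\<zeta>\<in>- slits n \<epsilon>.
                g \<zeta> = pushforward (slit_map n \<epsilon>) (- slits n \<epsilon>) (\<lambda>w. - (w ^ (n - 1))) \<zeta>) \<and>
             (\<exists>\<zeta>. g \<zeta> \<noteq> 0) \<and> g 0 = 0 \<and> zorder g 0 = int n - 1"
proof (intro exI[of _ "\<lambda>\<zeta>. \<zeta> ^ (n - 1)"] conjI ballI)
  show "\<exists>\<zeta>::complex. \<zeta> ^ (n - 1) \<noteq> 0" by (intro exI[of _ 1]) simp
  show "zorder (\<lambda>\<zeta>::complex. \<zeta> ^ (n - 1)) 0 = int n - 1"
    using assms by (intro zorder_eqI[of UNIV _ "\<lambda>_. 1"]) (auto simp: power_int_def of_nat_diff nat_diff_distrib)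
  show "\<zeta> ^ (n - 1) = pushforward (slit_map n \<epsilon>) (- slits n \<epsilon>) (\<lambda>w. - (w ^ (n - 1))) \<zeta>"
    if "\<zeta> \<in> - slits n \<epsilon>" for \<zeta>
    by (rule pushforward_slit_map [symmetric]) (use that assms in auto)
qed (use assms in \<open>auto intro!: holomorphic_intros\<close>)


section \<open>Holomorphic change of variables in the plane\<close>

text \<open>A bridge between two notions of integral: areas are nonnegative, possibly infinite
  integrals, whereas change of variables speaks of absolute integrability. The value
  \<open>\<infinity>\<close> records that the latter fails.\<close>

lemma nn_integral_eq_absolutely_integrable:
  fixes h :: "'a::euclidean_space \<Rightarrow> real"
  assumes meas: "(\<lambda>x. indicator S x * h x) \<in> borel_measurable borel"
    and nonneg: "\<And>x. x \<in> S \<Longrightarrow> h x \<ge> 0"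
  shows "(\<integral>\<^sup>+x. ennreal (indicator S x * h x) \<partial>lborel)
           = (if h absolutely_integrable_on S then ennreal (integral S h) else \<infinity>)"
proof -
  let ?h = "\<lambda>x. indicator S x * h x"
  have pos: "0 \<le> ?h x" for x using nonneg by (auto simp: indicator_def)
  have meas': "?h \<in> borel_measurable lborel" using meas by simp
  have iff: "h absolutely_integrable_on S \<longleftrightarrow> integrable lborel ?h"
    using integrable_completion[OF meas'] by (simp add: set_integrable_def)
  show ?thesis
  proof (cases "h absolutely_integrable_on S")
    case True
    have "integral S h = (LINT x:S|lebesgue. h x)"
      using set_lebesgue_integral_eq_integral(2)[OF True] by simp
    also have "\<dots> = integral\<^sup>L lborel ?h"
      using integral_completion[OF meas'] by (simp add: set_lebesgue_integral_def)
    finally show ?thesis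
      using True iff pos by (simp add: nn_integral_eq_integral)
  next
    case False
    have "(\<integral>\<^sup>+x. ennreal (?h x) \<partial>lborel) = \<infinity>"
    proof (rule ccontr)
      assume "(\<integral>\<^sup>+x. ennreal (?h x) \<partial>lborel) \<noteq> \<infinity>"
      hence "integrable lborel ?h"
        using meas' pos by (intro integrableI_nonneg) (auto simp: top.not_eq_extremum)
      thus False using False iff by simp
    qed
    thus ?thesis using False by simp
  qed
qed

text \<open>The plane as \<open>real ^ 2\<close>, the setting of the change of variables theorem
  with its Jacobian determinant.\<close>

definition vec_of_complex :: "complex \<Rightarrow> real ^ 2" where
  "vec_of_complex z = vector [Re z, Im z]"

definition complex_of_vec :: "real ^ 2 \<Rightarrow> complex" where
  "complex_of_vec x = Complex (x $ 1) (x $ 2)"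

lemma complex_of_vec_of_complex [simp]: "complex_of_vec (vec_of_complex z) = z"
  by (simp add: vec_of_complex_def complex_of_vec_def)

lemma vec_of_complex_of_vec [simp]: "vec_of_complex (complex_of_vec x) = x"
  by (simp add: vec_of_complex_def complex_of_vec_def vec_eq_iff forall_2)

lemma bounded_linear_vec_of_complex: "bounded_linear vec_of_complex"
  unfolding linear_conv_bounded_linear[symmetric] vec_of_complex_def
  by (rule linearI) (simp_all add: vec_eq_iff forall_2)

lemma bounded_linear_complex_of_vec: "bounded_linear complex_of_vec"
  unfolding linear_conv_bounded_linear[symmetric] complex_of_vec_def
  by (rule linearI) (simp_all add: complex_eq_iff)

lemma Basis_real2: "(Basis :: (real ^ 2) set) = {axis 1 1, axis 2 1}"
  by (auto simp: Basis_vec_def UNIV_2)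

lemma vimage_complex_of_vec_box:
  "complex_of_vec -` box l u = box (vec_of_complex l) (vec_of_complex u)"
  by (auto simp: mem_box Basis_real2 Basis_complex_def complex_of_vec_def vec_of_complex_def
        inner_axis)

lemma borel_measurable_complex_of_vec [measurable]:
  "complex_of_vec \<in> borel_measurable borel"
  by (intro borel_measurable_continuous_onI linear_continuous_on bounded_linear_complex_of_vec)

text \<open>Boxes correspond to boxes with the same side lengths, and these values determine
  Lebesgue measure.\<close>

lemma distr_complex_of_vec: "distr lborel borel complex_of_vec = (lborel :: complex measure)"
proof (rule lborel_eqI [symmetric])
  fix l u :: complex assume le: "\<And>b. b \<in> Basis \<Longrightarrow> l \<bullet> b \<le> u \<bullet> b"
  have ax: "axis 1 1 \<noteq> (axis 2 1 :: real ^ 2)" by (simp add: axis_eq_axis)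
  have "emeasure (distr lborel borel complex_of_vec) (box l u)
      = emeasure lborel (box (vec_of_complex l) (vec_of_complex u))"
    by (simp add: emeasure_distr vimage_complex_of_vec_box)
  also have "\<dots> = ennreal (\<Prod>b\<in>Basis. (vec_of_complex u - vec_of_complex l) \<bullet> b)"
    using le[of 1] le[of \<i>] ax by (intro emeasure_lborel_box)
      (auto simp: Basis_real2 inner_axis vec_of_complex_def Basis_complex_def)
  also have "(\<Prod>b\<in>Basis. (vec_of_complex u - vec_of_complex l) \<bullet> b) = (\<Prod>b\<in>Basis. (u - l) \<bullet> b)"
    using ax by (simp add: Basis_real2 Basis_complex_def inner_axis vec_of_complex_def)
  finally show "emeasure (distr lborel borel complex_of_vec) (box l u)
      = ennreal (\<Prod>b\<in>Basis. (u - l) \<bullet> b)" .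
qed simp

lemma nn_integral_complex_of_vec:
  fixes f :: "complex \<Rightarrow> ennreal"
  assumes "f \<in> borel_measurable borel"
  shows "(\<integral>\<^sup>+z. f z \<partial>lborel) = (\<integral>\<^sup>+x. f (complex_of_vec x) \<partial>lborel)"
proof -
  have "(\<integral>\<^sup>+z. f z \<partial>lborel) = (\<integral>\<^sup>+z. f z \<partial>distr lborel borel complex_of_vec)"
    by (simp only: distr_complex_of_vec)
  also have "\<dots> = (\<integral>\<^sup>+x. f (complex_of_vec x) \<partial>lborel)"
    using assms by (intro nn_integral_distr) auto
  finally show ?thesis .
qed

text \<open>Multiplication by \<open>a + i b\<close> has matrix rows \<open>(a, -b)\<close> and
  \<open>(b, a)\<close>. So the real Jacobian of a holomorphic map is the squared modulus of its
  derivative.\<close>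

lemma det_complex_mult: "det (matrix (vec_of_complex \<circ> (*) c \<circ> complex_of_vec)) = (norm c)\<^sup>2"
  by (simp add: det_2 matrix_def vec_of_complex_def complex_of_vec_def axis_def cmod_power2
      flip: power2_eq_square)

lemma nn_integral_holomorphic_substitution:
  fixes f :: "complex \<Rightarrow> real"
  assumes S: "S \<in> sets borel" and gS: "g ` S \<in> sets borel"
    and hol: "g holomorphic_on U" "open U" "S \<subseteq> U" and inj: "inj_on g S"
    and nonneg: "\<And>z. f z \<ge> 0"
    and meas: "(\<lambda>z. indicator (g ` S) z * f z) \<in> borel_measurable borel"
      "(\<lambda>z. indicator S z * ((norm (deriv g z))\<^sup>2 * f (g z))) \<in> borel_measurable borel"
  shows "(\<integral>\<^sup>+z. ennreal (indicator (g ` S) z * f z) \<partial>lborel)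
           = (\<integral>\<^sup>+z. ennreal (indicator S z * ((norm (deriv g z))\<^sup>2 * f (g z))) \<partial>lborel)"
proof -
  define G where "G = vec_of_complex \<circ> g \<circ> complex_of_vec"
  define G' where "G' = (\<lambda>x. vec_of_complex \<circ> (*) (deriv g (complex_of_vec x)) \<circ> complex_of_vec)"
  define T where "T = complex_of_vec -` S"
  have GT: "G ` T = complex_of_vec -` (g ` S)"
  proof (intro set_eqI iffI)
    fix x assume "x \<in> complex_of_vec -` (g ` S)"
    then obtain z where z: "z \<in> S" "complex_of_vec x = g z" by auto
    hence "x = G (vec_of_complex z)" by (simp add: G_def flip: z(2))
    thus "x \<in> G ` T" using z by (auto simp: T_def)
  qed (auto simp: G_def T_def)
  have ind: "indicator S (complex_of_vec x) = (indicator T x :: real)"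
      "indicator (g ` S) (complex_of_vec x) = (indicator (G ` T) x :: real)" for x
    unfolding GT by (auto simp: T_def indicator_def)
  have Tb: "T \<in> sets borel"
    using measurable_sets[OF borel_measurable_complex_of_vec S] by (simp add: T_def)
  have der: "(G has_derivative G' x) (at x within T)" if "x \<in> T" for x
  proof -
    have "(g has_field_derivative deriv g (complex_of_vec x)) (at (complex_of_vec x))"
      using that hol by (intro holomorphic_derivI[OF hol(1,2)]) (auto simp: T_def)
    hence *: "(g has_derivative (*) (deriv g (complex_of_vec x))) (at (complex_of_vec x) within W)" for W
      by (simp add: has_field_derivative_def has_derivative_at_withinI)
    have "(g \<circ> complex_of_vec has_derivative (*) (deriv g (complex_of_vec x)) \<circ> complex_of_vec)
        (at x within T)"
      by (intro diff_chain_within bounded_linear_imp_has_derivative bounded_linear_complex_of_vec *)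
    hence "(vec_of_complex \<circ> (g \<circ> complex_of_vec) has_derivative
        vec_of_complex \<circ> ((*) (deriv g (complex_of_vec x)) \<circ> complex_of_vec)) (at x within T)"
      by (rule diff_chain_within) (rule bounded_linear_imp_has_derivative bounded_linear_vec_of_complex)+
    thus ?thesis by (simp add: G_def G'_def comp_assoc)
  qed
  have injG: "inj_on G T"
  proof (rule inj_onI)
    fix x y assume xy: "x \<in> T" "y \<in> T" "G x = G y"
    hence "complex_of_vec (G x) = complex_of_vec (G y)" by simp
    hence "complex_of_vec x = complex_of_vec y"
      using xy inj by (auto simp: G_def T_def inj_on_def)
    thus "x = y" by (metis vec_of_complex_of_vec)
  qed
  \<comment> \<open>The integrand is wrapped into \<open>real ^ 1\<close> to fit a theorem on
    vector-valued functions. Leaving the value \<open>b\<close> free gives, from one equivalence,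
    both the transfer of integrability and the equality of the integrals.\<close>
  have cov: "((\<lambda>x. (norm (deriv g (complex_of_vec x)))\<^sup>2 * f (g (complex_of_vec x))) absolutely_integrable_on T
        \<and> integral T (\<lambda>x. (norm (deriv g (complex_of_vec x)))\<^sup>2 * f (g (complex_of_vec x))) = b)
     \<longleftrightarrow> ((\<lambda>x. f (complex_of_vec x)) absolutely_integrable_on (G ` T)
        \<and> integral (G ` T) (\<lambda>x. f (complex_of_vec x)) = b)" for b
    using has_absolute_integral_change_of_variables[OF _ der injG,
        of "\<lambda>x. vec (f (complex_of_vec x)) :: real ^ 1" "vec b"] Tb
    unfolding absolutely_integrable_on_1_iff integral_on_1_eq
    by (simp add: G'_def det_complex_mult G_def)
  have "(\<integral>\<^sup>+z. ennreal (indicator (g ` S) z * f z) \<partial>lborel)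
      = (\<integral>\<^sup>+x. ennreal (indicator (G ` T) x * f (complex_of_vec x)) \<partial>lborel)"
    using meas(1) by (subst nn_integral_complex_of_vec) (auto simp: ind)
  also have "\<dots> = (if (\<lambda>x. f (complex_of_vec x)) absolutely_integrable_on (G ` T)
      then ennreal (integral (G ` T) (\<lambda>x. f (complex_of_vec x))) else \<infinity>)"
    using measurable_compose[OF borel_measurable_complex_of_vec meas(1)] nonneg
    by (intro nn_integral_eq_absolutely_integrable) (auto simp: ind)
  also have "\<dots> = (if (\<lambda>x. (norm (deriv g (complex_of_vec x)))\<^sup>2 * f (g (complex_of_vec x)))
        absolutely_integrable_on T
      then ennreal (integral T (\<lambda>x. (norm (deriv g (complex_of_vec x)))\<^sup>2 * f (g (complex_of_vec x))))
      else \<infinity>)"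
  proof -
    have "(\<lambda>x. (norm (deriv g (complex_of_vec x)))\<^sup>2 * f (g (complex_of_vec x))) absolutely_integrable_on T
        \<longleftrightarrow> (\<lambda>x. f (complex_of_vec x)) absolutely_integrable_on (G ` T)" using cov by blast
    moreover have "integral (G ` T) (\<lambda>x. f (complex_of_vec x))
        = integral T (\<lambda>x. (norm (deriv g (complex_of_vec x)))\<^sup>2 * f (g (complex_of_vec x)))"
      if "(\<lambda>x. f (complex_of_vec x)) absolutely_integrable_on (G ` T)" using cov that by blast
    ultimately show ?thesis by (simp cong: if_cong)
  qed
  also have "\<dots> = (\<integral>\<^sup>+x. ennreal (indicator T x *
      ((norm (deriv g (complex_of_vec x)))\<^sup>2 * f (g (complex_of_vec x)))) \<partial>lborel)"
    using measurable_compose[OF borel_measurable_complex_of_vec meas(2)] nonneg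
    by (intro nn_integral_eq_absolutely_integrable [symmetric]) (auto simp: ind)
  also have "\<dots> = (\<integral>\<^sup>+z. ennreal (indicator S z * ((norm (deriv g z))\<^sup>2 * f (g z))) \<partial>lborel)"
    using nn_integral_complex_of_vec[of "\<lambda>z. ennreal (indicator S z * ((norm (deriv g z))\<^sup>2 * f (g z)))"]
      meas(2) by (simp add: ind)
  finally show ?thesis .
qed


section \<open>Charts\<close>

lemma is_chart_openin: "is_chart T c \<Longrightarrow> openin T (fst c)"
  by (simp add: is_chart_def)

lemma is_chart_inj_on: "is_chart T c \<Longrightarrow> inj_on (snd c) (fst c)"
  using homeomorphic_imp_injective_map[of "subtopology T (fst c)" _ "snd c"] openin_subset[of T "fst c"]
  by (auto simp: is_chart_def inf_absorb2)

lemma is_chart_open_image: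
  assumes "is_chart T c" "openin T V" "V \<subseteq> fst c"
  shows "open (snd c ` V)"
proof -
  have V: "openin (subtopology T (fst c)) V"
    using assms by (simp add: openin_open_subtopology is_chart_def)
  have "openin (top_of_set (snd c ` fst c)) (snd c ` V)"
    using assms V homeomorphic_map_openness_eq[of "subtopology T (fst c)" _ "snd c" V]
    unfolding is_chart_def by blast
  thus ?thesis using assms by (auto simp: is_chart_def openin_open_eq)
qed

lemma is_chart_open_preimage:
  assumes "is_chart T c" "open W"
  shows "openin T {p \<in> fst c. snd c p \<in> W}"
proof -
  have "continuous_map (subtopology T (fst c)) euclidean (snd c)"
    using assms homeomorphic_imp_continuous_map unfolding is_chart_def
    by (metis continuous_map_in_subtopology)
  moreover have top: "topspace (subtopology T (fst c)) = fst c"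
    using openin_subset[OF is_chart_openin[OF assms(1)]] by auto
  ultimately have "openin (subtopology T (fst c)) {p \<in> fst c. snd c p \<in> W}"
    using assms(2) openin_continuous_map_preimage[of "subtopology T (fst c)" euclidean "snd c" W]
    unfolding top by simp
  thus ?thesis
    using assms by (simp add: is_chart_def openin_open_subtopology)
qed

text \<open>As \<open>U\<close> is open, the subspace topologies in \<open>is_chart\<close> can be
  replaced by conditions on sets open in \<open>T\<close>.\<close>

lemma is_chartI:
  assumes U: "openin T U" and inj: "inj_on z U"
    and image: "\<And>V. openin T V \<Longrightarrow> V \<subseteq> U \<Longrightarrow> open (z ` V)"
    and preimage: "\<And>W. open W \<Longrightarrow> openin T {p \<in> U. z p \<in> W}"
  shows "is_chart T (U, z)"
proof -
  have top: "topspace (subtopology T U) = U" using openin_subset[OF U] by auto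
  have "homeomorphic_map (subtopology T U) (top_of_set (z ` U)) z"
  proof (rule bijective_open_imp_homeomorphic_map)
    show "continuous_map (subtopology T U) (top_of_set (z ` U)) z"
      unfolding continuous_map_in_subtopology
    proof
      show "continuous_map (subtopology T U) euclidean z"
        unfolding continuous_map_def top
        using preimage openin_open_subtopology[OF U] by auto
    qed (simp add: top)
    show "open_map (subtopology T U) (top_of_set (z ` U)) z"
      unfolding open_map_def openin_open_subtopology[OF U]
      using image by (auto intro!: open_openin_trans[of "z ` U"] simp: openin_open_eq U)
  qed (simp_all only: top inj topspace_euclidean_subtopology)
  thus ?thesis using U image by (simp add: is_chart_def)
qed

lemma chart_inv_snd:
  assumes "is_chart T c" "p \<in> fst c"
  shows "inv_into (fst c) (snd c) (snd c p) = p"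
  using is_chart_inj_on[OF assms(1)] assms(2) by (rule inv_into_f_f)

lemma transition_snd:
  assumes "is_chart T c" "p \<in> fst c"
  shows "transition c d (snd c p) = snd d p"
  using chart_inv_snd[OF assms] by (simp add: transition_def)

lemma has_field_derivative_transition:
  assumes "is_chart T c" "is_chart T d" "compatible c d" "p \<in> fst c" "p \<in> fst d"
  shows "(transition c d has_field_derivative transition_deriv c d p) (at (snd c p))"
  unfolding transition_deriv_def
proof (rule holomorphic_derivI)
  show "transition c d holomorphic_on snd c ` (fst c \<inter> fst d)"
    using assms by (simp add: compatible_def)
  show "open (snd c ` (fst c \<inter> fst d))"
    using assms by (intro is_chart_open_image[OF assms(1)] openin_Int) (auto simp: is_chart_def)
qed (use assms in auto)

text \<open>Chain rule on the triple overlap: it is open, so \<open>deriv\<close> only sees points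
  where the composite equals the direct transition.\<close>

lemma transition_deriv_chain:
  assumes "is_chart T c" "is_chart T d" "is_chart T e" "compatible c d" "compatible d e"
    and p: "p \<in> fst c" "p \<in> fst d" "p \<in> fst e"
  shows "transition_deriv c e p = transition_deriv d e p * transition_deriv c d p"
proof -
  let ?O = "snd c ` (fst c \<inter> fst d \<inter> fst e)"
  have "(transition d e has_field_derivative transition_deriv d e p) (at (transition c d (snd c p)))"
    "(transition c d has_field_derivative transition_deriv c d p) (at (snd c p))"
    unfolding transition_snd[OF assms(1) p(1)]
    by (rule has_field_derivative_transition; fact)+
  hence "(transition d e \<circ> transition c d has_field_derivative
      transition_deriv d e p * transition_deriv c d p) (at (snd c p))"
    by (rule DERIV_chain)
  moreover have "open ?O"
    using assms by (intro is_chart_open_image[OF assms(1)] openin_Int) (auto simp: is_chart_def)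
  ultimately have "(transition c e has_field_derivative
      transition_deriv d e p * transition_deriv c d p) (at (snd c p))"
    by (rule has_field_derivative_transform_within_open)
      (use assms in \<open>auto simp: transition_snd\<close>)
  thus ?thesis unfolding transition_deriv_def by (rule DERIV_imp_deriv)
qed

lemma transition_deriv_self:
  assumes "is_chart T c" "p \<in> fst c"
  shows "transition_deriv c c p = 1"
proof -
  have "(transition c c has_field_derivative 1) (at (snd c p))"
    using DERIV_ident is_chart_open_image[OF assms(1) is_chart_openin[OF assms(1)] subset_refl]
    by (rule has_field_derivative_transform_within_open)
      (use assms in \<open>auto simp: transition_snd\<close>)
  thus ?thesis unfolding transition_deriv_def by (rule DERIV_imp_deriv)
qed

lemma transition_deriv_inverse:
  assumes "is_chart T c" "is_chart T d" "compatible c d" "p \<in> fst c" "p \<in> fst d"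
  shows "transition_deriv d c p * transition_deriv c d p = 1"
proof -
  have "compatible d c" using assms(3) by (simp add: compatible_def inf_commute)
  thus ?thesis
    using transition_deriv_chain[OF assms(1,2,1,3) _ assms(4,5,4)] transition_deriv_self[OF assms(1,4)]
    by simp
qed

lemma compact_riemann_surfaceD:
  assumes "compact_riemann_surface X"
  shows "c \<in> surf_atlas X \<Longrightarrow> is_chart (surf_top X) c"
    and "c \<in> surf_atlas X \<Longrightarrow> d \<in> surf_atlas X \<Longrightarrow> compatible c d"
    and "(\<Union>c\<in>surf_atlas X. fst c) = topspace (surf_top X)"
    and "Hausdorff_space (surf_top X)" "connected_space (surf_top X)" "compact_space (surf_top X)"
  using assms unfolding compact_riemann_surface_def by blast+

lemma differential_continuous_on:
  assumes "abelian_differential X \<omega>" "c \<in> surf_atlas X"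
  shows "continuous_on (snd c ` fst c) (\<lambda>z. \<omega> c (inv_into (fst c) (snd c) z))"
  using assms by (auto simp: abelian_differential_def intro: holomorphic_on_imp_continuous_on)


section \<open>The area form of a differential\<close>

text \<open>The sets cut out by covers are of this kind. The class is closed under intersection, is
  carried along by homeomorphisms between open sets, and has Borel images in charts, so no
  sigma-algebra on the surface is introduced.\<close>

definition diff_of_opens :: "'a topology \<Rightarrow> 'a set \<Rightarrow> bool" where
  "diff_of_opens T E \<longleftrightarrow> (\<exists>U V. openin T U \<and> openin T V \<and> E = U - V)"

lemma diff_of_opensI: "openin T U \<Longrightarrow> openin T V \<Longrightarrow> diff_of_opens T (U - V)"
  by (auto simp: diff_of_opens_def)

lemma diff_of_opens_open: "openin T U \<Longrightarrow> diff_of_opens T U"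
  using diff_of_opensI[of T U "{}"] by simp

lemma diff_of_opens_Int:
  assumes "diff_of_opens T E" "diff_of_opens T F"
  shows "diff_of_opens T (E \<inter> F)"
proof -
  obtain U V U' V' where "openin T U" "openin T V" "E = U - V" "openin T U'" "openin T V'" "F = U' - V'"
    using assms by (auto simp: diff_of_opens_def)
  moreover have "(U - V) \<inter> (U' - V') = (U \<inter> U') - (V \<union> V')" by auto
  ultimately show ?thesis by (auto intro: diff_of_opensI)
qed

lemma sets_borel_chart_image:
  assumes c: "is_chart T c" and E: "diff_of_opens T E" "E \<subseteq> fst c"
  shows "snd c ` E \<in> sets borel"
proof -
  obtain U V where UV: "openin T U" "openin T V" "E = U - V"
    using E by (auto simp: diff_of_opens_def)
  have "E = (U \<inter> fst c) - (V \<inter> fst c)" using UV E by auto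
  hence "snd c ` E = snd c ` (U \<inter> fst c) - snd c ` (V \<inter> fst c)"
    using inj_on_image_set_diff[OF is_chart_inj_on[OF c], of "U \<inter> fst c" "V \<inter> fst c"] by auto
  moreover have "open (snd c ` (U \<inter> fst c))" "open (snd c ` (V \<inter> fst c))"
    using UV c by (auto intro!: is_chart_open_image[OF c] openin_Int is_chart_openin)
  ultimately show ?thesis by auto
qed

text \<open>The area of \<open>E\<close> in the flat metric given by the modulus of
  \<open>\<omega>\<close>, computed in the chart \<open>c\<close>. Values in \<open>ennreal\<close>
  allow summing and changing charts before finiteness is known.\<close>

definition area_on :: "'a differential \<Rightarrow> 'a chart \<Rightarrow> 'a set \<Rightarrow> ennreal" where
  "area_on \<omega> c E = (\<integral>\<^sup>+z. ennreal (indicator (snd c ` E) z *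
                      (norm (\<omega> c (inv_into (fst c) (snd c) z)))\<^sup>2) \<partial>lborel)"

lemma area_density_measurable:
  assumes "is_chart (surf_top X) c" "abelian_differential X \<omega>" "c \<in> surf_atlas X"
    and "diff_of_opens (surf_top X) E" "E \<subseteq> fst c"
  shows "(\<lambda>z. indicator (snd c ` E) z * (norm (\<omega> c (inv_into (fst c) (snd c) z)))\<^sup>2)
           \<in> borel_measurable borel"
proof -
  have "continuous_on (snd c ` E) (\<lambda>z. (norm (\<omega> c (inv_into (fst c) (snd c) z)))\<^sup>2)"
    by (intro continuous_intros continuous_on_subset[OF differential_continuous_on[OF assms(2,3)]])
      (use assms in auto)
  from borel_measurable_continuous_on_indicator[OF sets_borel_chart_image[OF assms(1,4,5)] this]
  show ?thesis by simp
qed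

lemma area_on_mono: "E \<subseteq> F \<Longrightarrow> area_on \<omega> c E \<le> area_on \<omega> c F"
  unfolding area_on_def by (intro nn_integral_mono ennreal_leI) (auto simp: indicator_def)

text \<open>Negligibility refers to the completed measure and \<open>E\<close> need not have a Borel
  image, hence the passage to a Borel null set containing it.\<close>

lemma area_on_negligible:
  assumes "negligible (snd c ` E)"
  shows "area_on \<omega> c E = 0"
proof -
  have "snd c ` E \<in> null_sets lebesgue" using assms by (simp add: negligible_iff_null_sets)
  then obtain N where "N \<in> null_sets lborel" "snd c ` E \<subseteq> N"
    by (auto simp: null_sets_completion_iff2)
  hence "AE z in lborel. z \<notin> snd c ` E"
    using AE_not_in[of N lborel] by (auto elim!: eventually_mono)
  hence "area_on \<omega> c E = (\<integral>\<^sup>+z. 0 \<partial>(lborel :: complex measure))"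
    unfolding area_on_def by (intro nn_integral_cong_AE) (auto elim!: eventually_mono)
  thus ?thesis by simp
qed

lemma area_on_UN_disjoint:
  assumes "is_chart (surf_top X) c" "abelian_differential X \<omega>" "c \<in> surf_atlas X"
    and "finite I" "\<And>i. i \<in> I \<Longrightarrow> diff_of_opens (surf_top X) (E i)" "\<And>i. i \<in> I \<Longrightarrow> E i \<subseteq> fst c"
    and disj: "disjoint_family_on E I"
  shows "area_on \<omega> c (\<Union>i\<in>I. E i) = (\<Sum>i\<in>I. area_on \<omega> c (E i))"
proof -
  have "disjoint_family_on (\<lambda>i. snd c ` E i) I"
    unfolding disjoint_family_on_def
  proof (intro ballI impI)
    fix i j assume ij: "i \<in> I" "j \<in> I" "i \<noteq> j"
    have "snd c ` E i \<inter> snd c ` E j = snd c ` (E i \<inter> E j)"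
      using is_chart_inj_on[OF assms(1)] assms(6) ij by (intro inj_on_image_Int[symmetric]) auto
    thus "snd c ` E i \<inter> snd c ` E j = {}" using disj ij by (auto simp: disjoint_family_on_def)
  qed
  hence ind: "indicator (snd c ` (\<Union>i\<in>I. E i)) z = (\<Sum>i\<in>I. indicator (snd c ` E i) z :: real)" for z
    using assms(4) by (simp add: image_UN indicator_UN_disjoint)
  have "area_on \<omega> c (\<Union>i\<in>I. E i) = (\<integral>\<^sup>+z. (\<Sum>i\<in>I. ennreal (indicator (snd c ` E i) z *
                      (norm (\<omega> c (inv_into (fst c) (snd c) z)))\<^sup>2)) \<partial>lborel)"
    unfolding area_on_def ind by (simp add: sum_distrib_right flip: sum_ennreal)
  also have "\<dots> = (\<Sum>i\<in>I. area_on \<omega> c (E i))"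
    unfolding area_on_def
    by (intro nn_integral_sum) (use area_density_measurable[OF assms(1-3)] assms(5,6) in auto)
  finally show ?thesis .
qed

text \<open>The coefficients in two charts differ by the derivative of the transition map, whose
  squared modulus is the Jacobian.\<close>

lemma area_on_chart_change:
  assumes X: "compact_riemann_surface X" and \<omega>: "abelian_differential X \<omega>"
    and cd: "c \<in> surf_atlas X" "d \<in> surf_atlas X"
    and E: "diff_of_opens (surf_top X) E" "E \<subseteq> fst c" "E \<subseteq> fst d"
  shows "area_on \<omega> c E = area_on \<omega> d E"
proof -
  note ch = compact_riemann_surfaceD(1)[OF X cd(1)] compact_riemann_surfaceD(1)[OF X cd(2)]
  note comp = compact_riemann_surfaceD(2)[OF X cd]
  let ?g = "transition c d"
  let ?f = "\<lambda>z. (norm (\<omega> d (inv_into (fst d) (snd d) z)))\<^sup>2"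
  have im: "?g ` (snd c ` E) = snd d ` E"
    using E by (auto simp: image_comp transition_snd[OF ch(1)] intro!: image_cong)
  have eq: "indicator (snd c ` E) z * ((norm (deriv ?g z))\<^sup>2 * ?f (?g z))
      = indicator (snd c ` E) z * (norm (\<omega> c (inv_into (fst c) (snd c) z)))\<^sup>2" for z
  proof (cases "z \<in> snd c ` E")
    case True
    then obtain p where p: "p \<in> E" "z = snd c p" by auto
    hence pcd: "p \<in> fst c" "p \<in> fst d" using E by auto
    hence "\<omega> c p = \<omega> d p * transition_deriv c d p"
      using cd \<omega> unfolding abelian_differential_def by blast
    moreover have "?f (?g z) = (norm (\<omega> d p))\<^sup>2" "inv_into (fst c) (snd c) z = p"
      using p(2) pcd ch by (simp_all only: transition_snd chart_inv_snd)
    ultimately show ?thesis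
      using p by (simp add: transition_deriv_def norm_mult power_mult_distrib)
  qed auto
  have "area_on \<omega> d E
      = (\<integral>\<^sup>+z. ennreal (indicator (?g ` (snd c ` E)) z * ?f z) \<partial>lborel)"
    by (simp add: area_on_def im)
  also have "\<dots> = (\<integral>\<^sup>+z. ennreal (indicator (snd c ` E) z *
      ((norm (deriv ?g z))\<^sup>2 * ?f (?g z))) \<partial>lborel)"
  proof (rule nn_integral_holomorphic_substitution)
    show "snd c ` E \<in> sets borel" "?g ` (snd c ` E) \<in> sets borel"
      using E ch by (auto simp: im intro: sets_borel_chart_image)
    show "?g holomorphic_on snd c ` (fst c \<inter> fst d)" using comp by (simp add: compatible_def)
    show "open (snd c ` (fst c \<inter> fst d))"
      using ch by (auto intro!: is_chart_open_image[OF ch(1)] openin_Int is_chart_openin)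
    show "snd c ` E \<subseteq> snd c ` (fst c \<inter> fst d)" using E by auto
    show "inj_on ?g (snd c ` E)"
    proof (rule inj_onI)
      fix x y assume "x \<in> snd c ` E" "y \<in> snd c ` E" "?g x = ?g y"
      then obtain p q where pq: "p \<in> E" "q \<in> E" "x = snd c p" "y = snd c q" by blast
      have "p \<in> fst c" "q \<in> fst c" using pq E(2) by blast+
      hence "snd d p = snd d q"
        using \<open>?g x = ?g y\<close> pq by (metis transition_snd[OF ch(1)])
      hence "p = q" using inj_onD[OF is_chart_inj_on[OF ch(2)]] pq E(3) by blast
      thus "x = y" using pq by simp
    qed
    show "(\<lambda>z. indicator (?g ` (snd c ` E)) z * ?f z) \<in> borel_measurable borel"
      unfolding im by (rule area_density_measurable[OF ch(2) \<omega> cd(2) E(1,3)])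
    show "(\<lambda>z. indicator (snd c ` E) z * ((norm (deriv ?g z))\<^sup>2 * ?f (?g z))) \<in> borel_measurable borel"
      unfolding eq by (rule area_density_measurable[OF ch(1) \<omega> cd(1) E(1,2)])
  qed auto
  also have "\<dots> = area_on \<omega> c E" unfolding eq area_on_def ..
  finally show ?thesis by simp
qed

lemma finite_area_nhd:
  assumes X: "compact_riemann_surface X" and \<omega>: "abelian_differential X \<omega>"
    and p: "p \<in> topspace (surf_top X)"
  obtains c V where "c \<in> surf_atlas X" "openin (surf_top X) V" "V \<subseteq> fst c" "p \<in> V"
    "area_on \<omega> c V < \<infinity>"
proof -
  obtain c where c: "c \<in> surf_atlas X" "p \<in> fst c"
    using p unfolding compact_riemann_surfaceD(3)[OF X, symmetric] by blast
  note ch = compact_riemann_surfaceD(1)[OF X c(1)]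
  let ?f = "\<lambda>z. (norm (\<omega> c (inv_into (fst c) (snd c) z)))\<^sup>2"
  have "open (snd c ` fst c)" using ch by (simp add: is_chart_def)
  then obtain r where r: "r > 0" "cball (snd c p) r \<subseteq> snd c ` fst c"
    using c(2) by (meson imageI open_contains_cball)
  have "continuous_on (cball (snd c p) r) ?f"
    by (intro continuous_intros continuous_on_subset[OF differential_continuous_on[OF \<omega> c(1)]] r)
  hence "bounded (?f ` cball (snd c p) r)"
    by (intro compact_imp_bounded compact_continuous_image) auto
  then obtain M where M: "\<And>z. z \<in> cball (snd c p) r \<Longrightarrow> ?f z \<le> M"
    by (auto simp: bounded_iff simp del: mem_cball)
  define V where "V = {q \<in> fst c. snd c q \<in> ball (snd c p) r}"
  have "area_on \<omega> c V \<le> (\<integral>\<^sup>+z. ennreal M * indicator (cball (snd c p) r) z \<partial>lborel)"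
    unfolding area_on_def
  proof (rule nn_integral_mono)
    fix z
    show "ennreal (indicator (snd c ` V) z * ?f z) \<le> ennreal M * indicator (cball (snd c p) r) z"
      using M[of z] by (auto simp: V_def indicator_def intro!: ennreal_leI)
  qed
  also have "\<dots> = ennreal M * emeasure lborel (cball (snd c p) r)"
    by (simp add: nn_integral_cmult_indicator)
  also have "\<dots> < \<infinity>"
    using emeasure_bounded_finite[of "cball (snd c p) r"] by (simp add: ennreal_mult_less_top)
  finally have "area_on \<omega> c V < \<infinity>" .
  moreover have "openin (surf_top X) V"
    unfolding V_def using ch by (rule is_chart_open_preimage) simp
  ultimately show ?thesis
    using c r by (intro that[of c V]) (auto simp: V_def)
qed

text \<open>The coefficient of \<open>\<omega>\<close> may be unbounded in the chart
  \<open>c\<close>, so finiteness is global: compactness gives finitely many sets of finite area,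
  each measured in a chart of its own, and \<open>E\<close> is split along them.\<close>

lemma area_on_finite:
  assumes X: "compact_riemann_surface X" and \<omega>: "abelian_differential X \<omega>"
    and c: "c \<in> surf_atlas X" and E: "diff_of_opens (surf_top X) E" "E \<subseteq> fst c"
  shows "area_on \<omega> c E < \<infinity>"
proof -
  note ch = compact_riemann_surfaceD(1)[OF X]
  define \<U> where "\<U> = {V. openin (surf_top X) V \<and>
    (\<exists>d\<in>surf_atlas X. V \<subseteq> fst d \<and> area_on \<omega> d V < \<infinity>)}"
  have "topspace (surf_top X) \<subseteq> \<Union>\<U>"
  proof
    fix p assume "p \<in> topspace (surf_top X)"
    from finite_area_nhd[OF X \<omega> this] obtain d V where "d \<in> surf_atlas X" "openin (surf_top X) V"
      "V \<subseteq> fst d" "p \<in> V" "area_on \<omega> d V < \<infinity>" .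
    thus "p \<in> \<Union>\<U>" by (auto simp: \<U>_def)
  qed
  moreover have "\<forall>U\<in>\<U>. openin (surf_top X) U" by (simp add: \<U>_def)
  ultimately obtain \<F> where \<F>: "finite \<F>" "\<F> \<subseteq> \<U>" "topspace (surf_top X) \<subseteq> \<Union>\<F>"
    using compact_riemann_surfaceD(6)[OF X] unfolding compact_space_alt by meson
  have "\<forall>V\<in>\<F>. \<exists>d\<in>surf_atlas X. V \<subseteq> fst d \<and> area_on \<omega> d V < \<infinity>"
    using \<F>(2) by (auto simp: \<U>_def)
  then obtain d where d: "\<And>V. V \<in> \<F> \<Longrightarrow> d V \<in> surf_atlas X" "\<And>V. V \<in> \<F> \<Longrightarrow> V \<subseteq> fst (d V)"
    "\<And>V. V \<in> \<F> \<Longrightarrow> area_on \<omega> (d V) V < \<infinity>" by (metis)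
  have EV: "diff_of_opens (surf_top X) (E \<inter> V)" if "V \<in> \<F>" for V
    using that \<F>(2) by (intro diff_of_opens_Int[OF E(1)] diff_of_opens_open) (auto simp: \<U>_def)
  have sub: "E \<subseteq> \<Union>\<F>"
    using E(2) openin_subset[OF is_chart_openin[OF ch[OF c]]] \<F>(3) by blast
  \<comment> \<open>The sets of the subcover may overlap, so only an inequality is available; it
    suffices for finiteness.\<close>
  have "area_on \<omega> c E \<le> (\<integral>\<^sup>+z. (\<Sum>V\<in>\<F>. ennreal (indicator (snd c ` (E \<inter> V)) z *
                      (norm (\<omega> c (inv_into (fst c) (snd c) z)))\<^sup>2)) \<partial>lborel)"
    unfolding area_on_def
  proof (rule nn_integral_mono)
    fix z
    let ?a = "(norm (\<omega> c (inv_into (fst c) (snd c) z)))\<^sup>2"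
    show "ennreal (indicator (snd c ` E) z * ?a)
        \<le> (\<Sum>V\<in>\<F>. ennreal (indicator (snd c ` (E \<inter> V)) z * ?a))"
    proof (cases "z \<in> snd c ` E")
      case True
      then obtain V where V: "V \<in> \<F>" "z \<in> snd c ` (E \<inter> V)" using sub by blast
      have "ennreal (indicator (snd c ` (E \<inter> V)) z * ?a)
        \<le> (\<Sum>V\<in>\<F>. ennreal (indicator (snd c ` (E \<inter> V)) z * ?a))"
        using V \<F>(1) by (intro member_le_sum) auto
      thus ?thesis using V True by simp
    qed auto
  qed
  also have "\<dots> = (\<Sum>V\<in>\<F>. area_on \<omega> c (E \<inter> V))"
    unfolding area_on_def
  proof (rule nn_integral_sum)
    fix V assume "V \<in> \<F>"
    hence "(\<lambda>z. indicator (snd c ` (E \<inter> V)) z * (norm (\<omega> c (inv_into (fst c) (snd c) z)))\<^sup>2)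
        \<in> borel_measurable borel"
      using E by (intro area_density_measurable[OF ch[OF c] \<omega> c] EV) auto
    thus "(\<lambda>z. ennreal (indicator (snd c ` (E \<inter> V)) z * (norm (\<omega> c (inv_into (fst c) (snd c) z)))\<^sup>2))
        \<in> borel_measurable lborel" by simp
  qed
  also have "\<dots> = (\<Sum>V\<in>\<F>. area_on \<omega> (d V) (E \<inter> V))"
    using E d EV by (intro sum.cong refl area_on_chart_change[OF X \<omega> c]) auto
  also have "\<dots> < \<infinity>"
  proof -
    have "area_on \<omega> (d V) (E \<inter> V) < \<infinity>" if "V \<in> \<F>" for V
      using area_on_mono[of "E \<inter> V" V \<omega> "d V"] d(3)[OF that] by auto
    thus ?thesis using \<F>(1) by (simp add: less_top)
  qed
  finally show ?thesis .
qed

section \<open>The integral norm as a sum of areas\<close>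

definition cover_piece :: "'a chart list \<Rightarrow> nat \<Rightarrow> 'a set" where
  "cover_piece cs i = fst (cs ! i) - (\<Union>j<i. fst (cs ! j))"

lemma cover_piece_subset: "cover_piece cs i \<subseteq> fst (cs ! i)"
  by (auto simp: cover_piece_def)

lemma disjoint_family_on_cover_piece: "disjoint_family_on (cover_piece cs) I"
proof -
  have "cover_piece cs i \<inter> cover_piece cs j = {}" if "i < j" for i j
    using that by (auto simp: cover_piece_def)
  thus ?thesis unfolding disjoint_family_on_def by (metis inf_commute linorder_neqE_nat)
qed

lemma UN_cover_piece: "(\<Union>i<length cs. cover_piece cs i) = (\<Union>c\<in>set cs. fst c)"
proof (intro equalityI subsetI)
  fix p assume "p \<in> (\<Union>c\<in>set cs. fst c)"
  hence "\<exists>i. i < length cs \<and> p \<in> fst (cs ! i)" by (metis UN_iff in_set_conv_nth)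
  then obtain i where i: "i < length cs" "p \<in> fst (cs ! i)"
    and least: "\<And>j. j < i \<Longrightarrow> \<not> (j < length cs \<and> p \<in> fst (cs ! j))"
    using exists_least_iff[of "\<lambda>i. i < length cs \<and> p \<in> fst (cs ! i)"] by blast
  hence "p \<in> cover_piece cs i" by (auto simp: cover_piece_def)
  thus "p \<in> (\<Union>i<length cs. cover_piece cs i)" using i by blast
qed (auto simp: cover_piece_def)

lemma diff_of_opens_cover_piece:
  assumes "compact_riemann_surface X" "finite_chart_cover X cs" "i < length cs"
  shows "diff_of_opens (surf_top X) (cover_piece cs i)"
proof -
  have "openin (surf_top X) (fst (cs ! j))" if "j < length cs" for j
    using assms(2) that
    by (intro is_chart_openin compact_riemann_surfaceD(1)[OF assms(1)])
      (auto simp: finite_chart_cover_def)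
  thus ?thesis
    unfolding cover_piece_def using assms(3) by (intro diff_of_opensI openin_Union) auto
qed

lemma exists_finite_chart_cover:
  assumes X: "compact_riemann_surface X"
  shows "\<exists>cs. finite_chart_cover X cs"
proof -
  have "openin (surf_top X) (fst c)" if "c \<in> surf_atlas X" for c
    using that by (intro is_chart_openin compact_riemann_surfaceD(1)[OF X])
  hence "\<forall>U\<in>fst ` surf_atlas X. openin (surf_top X) U" by blast
  moreover have "topspace (surf_top X) \<subseteq> \<Union>(fst ` surf_atlas X)"
    using compact_riemann_surfaceD(3)[OF X] by simp
  ultimately obtain \<F> where \<F>: "finite \<F>" "\<F> \<subseteq> fst ` surf_atlas X" "topspace (surf_top X) \<subseteq> \<Union>\<F>"
    using compact_riemann_surfaceD(6)[OF X] unfolding compact_space_alt by meson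
  then obtain C where C: "C \<subseteq> surf_atlas X" "finite C" "\<F> = fst ` C"
    by (meson finite_subset_image)
  then obtain cs where "set cs = C" using finite_list by blast
  moreover have "(\<Union>c\<in>C. fst c) = topspace (surf_top X)"
    using C \<F>(3) compact_riemann_surfaceD(3)[OF X] by auto
  ultimately show ?thesis using C by (auto simp: finite_chart_cover_def)
qed

text \<open>Nothing is known about the cover chosen by \<open>SOME\<close> except that it is one,
  hence the existential form. The factors \<open>\<i> / 2\<close> and \<open>- 2 * \<i>\<close>
  cancel, and finiteness of the areas lets \<open>enn2real\<close> pass through the sum.\<close>

lemma integral_norm_eq_area:
  assumes X: "compact_riemann_surface X" and \<omega>: "abelian_differential X \<omega>"
  shows "\<exists>cs. finite_chart_cover X cs \<and>
    integral_norm X \<omega> = of_real (enn2real (\<Sum>i<length cs. area_on \<omega> (cs ! i) (cover_piece cs i)))"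
proof -
  define cs where "cs = (SOME cs. finite_chart_cover X cs)"
  have cs: "finite_chart_cover X cs"
    using someI_ex[OF exists_finite_chart_cover[OF X]] by (simp add: cs_def)
  let ?\<eta> = "\<lambda>c p. \<omega> c p * cnj (\<omega> c p)"
  have piece: "cs ! i \<in> surf_atlas X" "diff_of_opens (surf_top X) (cover_piece cs i)" if "i < length cs" for i
    using that cs diff_of_opens_cover_piece[OF X cs] by (auto simp: finite_chart_cover_def)
  have int: "(LINT z : snd (cs ! i) ` cover_piece cs i | lborel.
                  ?\<eta> (cs ! i) (inv_into (fst (cs ! i)) (snd (cs ! i)) z))
      = of_real (enn2real (area_on \<omega> (cs ! i) (cover_piece cs i)))" if i: "i < length cs" for i
  proof -
    let ?c = "cs ! i"
    let ?h = "\<lambda>z. indicator (snd ?c ` cover_piece cs i) z * (norm (\<omega> ?c (inv_into (fst ?c) (snd ?c) z)))\<^sup>2"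
    have "(LINT z : snd ?c ` cover_piece cs i | lborel. ?\<eta> ?c (inv_into (fst ?c) (snd ?c) z))
        = (LINT z | lborel. complex_of_real (?h z))"
      unfolding set_lebesgue_integral_def
      by (intro Bochner_Integration.integral_cong refl)
        (simp add: scaleR_conv_of_real complex_norm_square del: of_real_power)
    also have "\<dots> = of_real (LINT z | lborel. ?h z)" by (rule integral_complex_of_real)
    also have "(LINT z | lborel. ?h z) = enn2real (area_on \<omega> ?c (cover_piece cs i))"
      unfolding area_on_def
    proof (rule integral_eq_nn_integral)
      show "?h \<in> borel_measurable lborel"
        using area_density_measurable[OF compact_riemann_surfaceD(1)[OF X piece(1)[OF i]] \<omega> piece[OF i]]
          cover_piece_subset[of cs i] by simp
    qed auto
    finally show ?thesis .
  qed
  have fin: "area_on \<omega> (cs ! i) (cover_piece cs i) < \<infinity>" if "i < length cs" for i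
    using piece[OF that] by (intro area_on_finite[OF X \<omega>] cover_piece_subset)
  have "integral_norm X \<omega> = \<i> / 2 * (\<Sum>i<length cs. - 2 * \<i> *
      of_real (enn2real (area_on \<omega> (cs ! i) (cover_piece cs i))))"
    unfolding integral_norm_def surface_integral_def cs_def[symmetric] integral_over_cover_def
    using int by (simp add: cover_piece_def)
  also have "\<dots> = of_real (\<Sum>i<length cs. enn2real (area_on \<omega> (cs ! i) (cover_piece cs i)))"
    by (simp add: sum_distrib_left)
  also have "(\<Sum>i<length cs. enn2real (area_on \<omega> (cs ! i) (cover_piece cs i)))
      = enn2real (\<Sum>i<length cs. area_on \<omega> (cs ! i) (cover_piece cs i))"
    using fin by (subst enn2real_sum) auto
  finally show ?thesis using cs by blast
qed

text \<open>Compares the sums for unrelated covers of two surfaces that share, up to null sets, an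
  open part \<open>M\<close> embedded by \<open>f\<close>. Both sums are refined to the same double
  sum over the pieces lying in the \<open>i\<close>-th piece of one cover and the
  \<open>j\<close>-th of the other, so this also disposes of the choice of cover.\<close>

lemma area_sum_transfer:
  fixes X :: "'a surface" and Y :: "'b surface"
  assumes X: "compact_riemann_surface X" "abelian_differential X \<omega>" "finite_chart_cover X cs"
    and Y: "compact_riemann_surface Y" "abelian_differential Y \<omega>'" "finite_chart_cover Y ds"
    and M: "openin (surf_top X) M" and f: "inj_on f M" "f ` M \<subseteq> topspace (surf_top Y)"
    and top: "\<And>V. V \<subseteq> M \<Longrightarrow> openin (surf_top Y) (f ` V) \<longleftrightarrow> openin (surf_top X) V"
    and nullX: "\<And>c. c \<in> surf_atlas X \<Longrightarrow> area_on \<omega> c (fst c - M) = 0"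
    and nullY: "\<And>d. d \<in> surf_atlas Y \<Longrightarrow> area_on \<omega>' d (fst d - f ` M) = 0"
    and eq: "\<And>c d E. c \<in> surf_atlas X \<Longrightarrow> d \<in> surf_atlas Y \<Longrightarrow> diff_of_opens (surf_top X) E \<Longrightarrow>
      E \<subseteq> fst c \<inter> M \<Longrightarrow> f ` E \<subseteq> fst d \<Longrightarrow> area_on \<omega> c E = area_on \<omega>' d (f ` E)"
  shows "(\<Sum>i<length cs. area_on \<omega> (cs ! i) (cover_piece cs i))
       = (\<Sum>j<length ds. area_on \<omega>' (ds ! j) (cover_piece ds j))"
proof -
  \<comment> \<open>Discards the null part of a piece. It is applied to both surfaces, so its point
    type is generalised; the index type \<open>bool\<close> turns additivity over a family into
    additivity over two sets.\<close>
  have split: "area_on \<eta> c P = area_on \<eta> c (P \<inter> N)"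
    if Z: "compact_riemann_surface Z" "abelian_differential Z \<eta>" "c \<in> surf_atlas Z"
      "diff_of_opens (surf_top Z) P" "P \<subseteq> fst c" "openin (surf_top Z) N" "area_on \<eta> c (fst c - N) = 0"
    for Z :: "'z surface" and \<eta> c P N
  proof -
    obtain U V where UV: "openin (surf_top Z) U" "openin (surf_top Z) V" "P = U - V"
      using Z(4) by (auto simp: diff_of_opens_def)
    define E where "E = (\<lambda>b::bool. if b then P \<inter> N else P - N)"
    have "P - N = U - (V \<union> N)" using UV by auto
    hence "diff_of_opens (surf_top Z) (P - N)" using UV Z(6) by (auto intro: diff_of_opensI)
    moreover have "diff_of_opens (surf_top Z) (P \<inter> N)"
      using Z(4,6) by (blast intro: diff_of_opens_Int diff_of_opens_open)
    ultimately have "area_on \<eta> c (\<Union>b\<in>UNIV. E b) = (\<Sum>b\<in>UNIV. area_on \<eta> c (E b))"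
      using Z(5) by (intro area_on_UN_disjoint[OF compact_riemann_surfaceD(1)[OF Z(1,3)] Z(2,3)])
        (auto simp: E_def disjoint_family_on_def)
    moreover have "(\<Union>b\<in>UNIV. E b) = P" by (auto simp: E_def UNIV_bool)
    moreover have "area_on \<eta> c (P - N) \<le> area_on \<eta> c (fst c - N)"
      using Z(5) by (intro area_on_mono) auto
    ultimately show ?thesis using Z(7) by (simp add: E_def UNIV_bool)
  qed
  have fM: "openin (surf_top Y) (f ` M)" using top[of M] M by simp
  let ?P = "cover_piece cs" and ?Q = "cover_piece ds"
  \<comment> \<open>The common refinement, kept on the side of \<open>X\<close>; its counterpart on
    \<open>Y\<close> is the image under \<open>f\<close>.\<close>
  define E where "E = (\<lambda>i j. ?P i \<inter> (M \<inter> {p \<in> M. f p \<in> ?Q j}))"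
  have csX: "cs ! i \<in> surf_atlas X" "diff_of_opens (surf_top X) (?P i)" if "i < length cs" for i
    using that X(3) diff_of_opens_cover_piece[OF X(1,3)] by (auto simp: finite_chart_cover_def)
  have dsY: "ds ! j \<in> surf_atlas Y" "diff_of_opens (surf_top Y) (?Q j)" if "j < length ds" for j
    using that Y(3) diff_of_opens_cover_piece[OF Y(1,3)] by (auto simp: finite_chart_cover_def)
  have preim: "diff_of_opens (surf_top X) {p \<in> M. f p \<in> Q}"
    if Q: "diff_of_opens (surf_top Y) Q" for Q
  proof -
    obtain U V where UV: "openin (surf_top Y) U" "openin (surf_top Y) V" "Q = U - V"
      using Q by (auto simp: diff_of_opens_def)
    have op: "openin (surf_top X) {p \<in> M. f p \<in> W}" if "openin (surf_top Y) W" for W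
    proof -
      have "f ` {p \<in> M. f p \<in> W} = f ` M \<inter> W" by auto
      thus ?thesis using top[of "{p \<in> M. f p \<in> W}"] that fM by auto
    qed
    have "{p \<in> M. f p \<in> Q} = {p \<in> M. f p \<in> U} - {p \<in> M. f p \<in> V}" using UV by auto
    thus ?thesis using op UV by (auto intro: diff_of_opensI)
  qed
  have Ed: "diff_of_opens (surf_top X) (E i j)" if "i < length cs" "j < length ds" for i j
    unfolding E_def using that M by (intro diff_of_opens_Int diff_of_opens_open preim csX dsY)
  have dim: "diff_of_opens (surf_top Y) (f ` F)" if F: "diff_of_opens (surf_top X) F" "F \<subseteq> M" for F
  proof -
    obtain U V where UV: "openin (surf_top X) U" "openin (surf_top X) V" "F = U - V"
      using F by (auto simp: diff_of_opens_def)
    have "F = (U \<inter> M) - (V \<inter> M)" using UV F by auto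
    hence "f ` F = f ` (U \<inter> M) - f ` (V \<inter> M)"
      using inj_on_image_set_diff[OF f(1), of "U \<inter> M" "V \<inter> M"] by auto
    moreover have "openin (surf_top Y) (f ` (U \<inter> M))" "openin (surf_top Y) (f ` (V \<inter> M))"
      using top[of "U \<inter> M"] top[of "V \<inter> M"] UV M by (auto intro: openin_Int)
    ultimately show ?thesis by (auto intro: diff_of_opensI)
  qed
  have covX: "(\<Union>i<length cs. ?P i) = topspace (surf_top X)"
    and covY: "(\<Union>j<length ds. ?Q j) = topspace (surf_top Y)"
    using X(3) Y(3) by (auto simp: UN_cover_piece finite_chart_cover_def)
  have "(\<Sum>i<length cs. area_on \<omega> (cs ! i) (?P i))
      = (\<Sum>i<length cs. \<Sum>j<length ds. area_on \<omega> (cs ! i) (E i j))"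
  proof (rule sum.cong[OF refl])
    fix i assume "i \<in> {..<length cs}"
    hence i: "i < length cs" by simp
    have "f p \<in> (\<Union>j<length ds. ?Q j)" if "p \<in> M" for p using that covY f(2) by blast
    hence "?P i \<inter> M = (\<Union>j<length ds. E i j)"
      unfolding E_def by blast
    moreover have "area_on \<omega> (cs ! i) (?P i) = area_on \<omega> (cs ! i) (?P i \<inter> M)"
      using i by (intro split[OF X(1,2) csX(1) csX(2) cover_piece_subset M nullX] csX)
    moreover have "area_on \<omega> (cs ! i) (\<Union>j<length ds. E i j)
        = (\<Sum>j<length ds. area_on \<omega> (cs ! i) (E i j))"
    proof (rule area_on_UN_disjoint[OF compact_riemann_surfaceD(1)[OF X(1) csX(1)[OF i]] X(2) csX(1)[OF i]])
      show "disjoint_family_on (E i) {..<length ds}"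
        using disjoint_family_on_cover_piece[of ds "{..<length ds}"]
        unfolding disjoint_family_on_def E_def by blast
      show "E i j \<subseteq> fst (cs ! i)" for j using cover_piece_subset[of cs i] unfolding E_def by blast
    qed (use Ed i in auto)
    ultimately show "area_on \<omega> (cs ! i) (?P i) = (\<Sum>j<length ds. area_on \<omega> (cs ! i) (E i j))"
      by metis
  qed
  also have "\<dots> = (\<Sum>i<length cs. \<Sum>j<length ds. area_on \<omega>' (ds ! j) (f ` E i j))"
  proof (intro sum.cong refl eq csX dsY Ed)
    fix i j
    show "E i j \<subseteq> fst (cs ! i) \<inter> M" "f ` E i j \<subseteq> fst (ds ! j)"
      using cover_piece_subset[of cs i] cover_piece_subset[of ds j] unfolding E_def by blast+
  qed auto
  also have "\<dots> = (\<Sum>j<length ds. \<Sum>i<length cs. area_on \<omega>' (ds ! j) (f ` E i j))"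
    by (rule sum.swap)
  also have "\<dots> = (\<Sum>j<length ds. area_on \<omega>' (ds ! j) (?Q j))"
  proof (rule sum.cong[OF refl])
    fix j assume "j \<in> {..<length ds}"
    hence j: "j < length ds" by simp
    have "p \<in> (\<Union>i<length cs. ?P i)" if "p \<in> M" for p using that covX openin_subset[OF M] by blast
    hence "?Q j \<inter> f ` M = (\<Union>i<length cs. f ` E i j)"
      unfolding E_def by blast
    moreover have "area_on \<omega>' (ds ! j) (?Q j) = area_on \<omega>' (ds ! j) (?Q j \<inter> f ` M)"
      using j by (intro split[OF Y(1,2) dsY(1) dsY(2) cover_piece_subset fM nullY] dsY)
    moreover have "area_on \<omega>' (ds ! j) (\<Union>i<length cs. f ` E i j)
        = (\<Sum>i<length cs. area_on \<omega>' (ds ! j) (f ` E i j))"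
    proof (rule area_on_UN_disjoint[OF compact_riemann_surfaceD(1)[OF Y(1) dsY(1)[OF j]] Y(2) dsY(1)[OF j]])
      show "disjoint_family_on (\<lambda>i. f ` E i j) {..<length cs}"
        unfolding disjoint_family_on_def
      proof (intro ballI impI)
        fix i k :: nat assume "i \<noteq> k"
        hence "?P i \<inter> ?P k = {}"
          using disjoint_family_on_cover_piece[of cs UNIV] by (auto simp: disjoint_family_on_def)
        moreover have "f ` E i j \<inter> f ` E k j = f ` (E i j \<inter> E k j)"
          using f(1) by (intro inj_on_image_Int[symmetric]) (auto simp: E_def)
        ultimately show "f ` E i j \<inter> f ` E k j = {}" by (auto simp: E_def)
      qed
      show "f ` E i j \<subseteq> fst (ds ! j)" for i using cover_piece_subset[of ds j] unfolding E_def by blast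
      show "diff_of_opens (surf_top Y) (f ` E i j)" if "i \<in> {..<length cs}" for i
        using that j by (intro dim Ed) (auto simp: E_def)
    qed auto
    ultimately show "(\<Sum>i<length cs. area_on \<omega>' (ds ! j) (f ` E i j)) = area_on \<omega>' (ds ! j) (?Q j)"
      by metis
  qed
  finally show ?thesis .
qed


section \<open>Line integrals\<close>

text \<open>The path stays in the chart \<open>c\<close> only near \<open>t\<close>, so
  \<open>snd d \<circ> \<gamma>\<close> equals the composite with the transition only there; this is
  enough for the derivative within \<open>{0..1}\<close>, one-sided at the endpoints.\<close>

lemma has_vector_derivative_chart_change:
  assumes X: "compact_riemann_surface X" and \<gamma>: "pathin (surf_top X) \<gamma>"
    and cd: "c \<in> surf_atlas X" "d \<in> surf_atlas X"
    and t: "t \<in> {0..1}" "\<gamma> t \<in> fst c" "\<gamma> t \<in> fst d"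
    and v: "(snd c \<circ> \<gamma> has_vector_derivative v) (at t within {0..1})"
  shows "(snd d \<circ> \<gamma> has_vector_derivative transition_deriv c d (\<gamma> t) * v) (at t within {0..1})"
proof -
  note ch = compact_riemann_surfaceD(1)[OF X cd(1)] compact_riemann_surfaceD(1)[OF X cd(2)]
  have "(transition c d has_field_derivative transition_deriv c d (\<gamma> t)) (at (snd c (\<gamma> t)))"
    using ch compact_riemann_surfaceD(2)[OF X cd] t(2,3) by (rule has_field_derivative_transition)
  hence "(transition c d has_field_derivative transition_deriv c d (\<gamma> t))
      (at ((snd c \<circ> \<gamma>) t) within (snd c \<circ> \<gamma>) ` {0..1})"
    by (simp add: has_field_derivative_at_within)
  from field_vector_diff_chain_within[OF v this]
  have D: "(transition c d \<circ> (snd c \<circ> \<gamma>) has_vector_derivative transition_deriv c d (\<gamma> t) * v)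
      (at t within {0..1})" by (simp only: mult.commute)
  have "openin (top_of_set {0..1}) {s \<in> {0..1}. \<gamma> s \<in> fst c}"
    using openin_continuous_map_preimage[OF \<gamma>[unfolded pathin_def] is_chart_openin[OF ch(1)]] by simp
  then obtain U where U: "open U" "{s \<in> {0..1}. \<gamma> s \<in> fst c} = {0..1} \<inter> U"
    by (auto simp: openin_open)
  have "t \<in> U" using U(2) t by blast
  then obtain r where r: "r > 0" "ball t r \<subseteq> U" using U(1) openE by blast
  show ?thesis
  proof (rule has_vector_derivative_transform_within[OF D r(1) t(1)])
    fix s assume s: "s \<in> {0..1}" "dist s t < r"
    hence "s \<in> U" using r(2) by (auto simp: dist_commute)
    hence "\<gamma> s \<in> fst c" using s(1) U(2) by blast
    thus "(transition c d \<circ> (snd c \<circ> \<gamma>)) s = (snd d \<circ> \<gamma>) s"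
      using transition_snd[OF ch(1)] by simp
  qed
qed

text \<open>The exceptional set quantifies over all charts of a possibly infinite atlas. Near each
  parameter a single chart controls it: outside the finitely many corners there the path is
  differentiable in that chart, hence in every other. Compactness of \<open>{0..1}\<close> makes the
  total finite.\<close>

lemma finite_nondifferentiable_surface_path:
  assumes X: "compact_riemann_surface X" and \<gamma>: "surface_path X \<gamma>"
  shows "finite {t \<in> {0..1}. \<exists>d\<in>surf_atlas X. \<gamma> t \<in> fst d \<and>
           \<not> (snd d \<circ> \<gamma>) differentiable at t within {0..1}}" (is "finite ?B")
proof -
  have path: "pathin (surf_top X) \<gamma>" using \<gamma> by (simp add: surface_path_def)
  have local: "\<exists>U. open U \<and> t0 \<in> U \<and> finite (?B \<inter> U)" if t0: "t0 \<in> {0..1}" for t0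
  proof -
    have "\<gamma> t0 \<in> topspace (surf_top X)"
      using path t0 by (auto simp: pathin_def continuous_map_def)
    then obtain c where c: "c \<in> surf_atlas X" "\<gamma> t0 \<in> fst c"
      unfolding compact_riemann_surfaceD(3)[OF X, symmetric] by blast
    note ch = compact_riemann_surfaceD(1)[OF X c(1)]
    have "openin (top_of_set {0..1}) {s \<in> {0..1}. \<gamma> s \<in> fst c}"
      using openin_continuous_map_preimage[OF path[unfolded pathin_def] is_chart_openin[OF ch]] by simp
    then obtain O' where O': "open O'" "{s \<in> {0..1}. \<gamma> s \<in> fst c} = {0..1} \<inter> O'"
      by (auto simp: openin_open)
    have "t0 \<in> O'" using O'(2) t0 c by blast
    then obtain r where r: "r > 0" "cball t0 r \<subseteq> O'" using O'(1) open_contains_cball by blast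
    \<comment> \<open>Clipped to \<open>{0..1}\<close> so that the endpoints of the path are covered
      as well; piecewise smoothness is only assumed on closed subintervals mapped into one
      chart.\<close>
    define a b where "a = max 0 (t0 - r)" and "b = min 1 (t0 + r)"
    have ab: "0 \<le> a" "a \<le> b" "b \<le> 1" using t0 r by (auto simp: a_def b_def)
    have "{a..b} \<subseteq> {0..1} \<inter> cball t0 r"
      using r by (auto simp: a_def b_def cball_def dist_real_def)
    hence sub: "\<gamma> ` {a..b} \<subseteq> fst c" using O'(2) r(2) by blast
    hence "(snd c \<circ> \<gamma>) piecewise_C1_differentiable_on {a..b}"
      using \<gamma> c ab unfolding surface_path_def by blast
    then obtain S where S: "finite S" "(snd c \<circ> \<gamma>) C1_differentiable_on ({a..b} - S)"
      unfolding piecewise_C1_differentiable_on_def by blast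
    have "?B \<inter> ball t0 r \<subseteq> S"
    proof (rule subsetI, rule ccontr)
      fix t assume t: "t \<in> ?B \<inter> ball t0 r" "t \<notin> S"
      have t01: "t \<in> {0..1}" using t by blast
      have tab: "t \<in> {a..b}" using t by (auto simp: a_def b_def ball_def dist_real_def)
      hence tc: "\<gamma> t \<in> fst c" using sub by blast
      obtain d where d: "d \<in> surf_atlas X" "\<gamma> t \<in> fst d"
        "\<not> (snd d \<circ> \<gamma>) differentiable at t within {0..1}" using t by blast
      obtain v where "(snd c \<circ> \<gamma> has_vector_derivative v) (at t)"
        using S(2) tab t(2) unfolding C1_differentiable_on_def by blast
      hence "(snd c \<circ> \<gamma> has_vector_derivative v) (at t within {0..1})"
        by (rule has_vector_derivative_at_within)
      from has_vector_derivative_chart_change[OF X path c(1) d(1) t01 tc d(2) this]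
      show False using d(3) differentiableI_vector by blast
    qed
    hence "finite (?B \<inter> ball t0 r)" using S(1) finite_subset by blast
    thus ?thesis using r(1) by (intro exI[of _ "ball t0 r"]) auto
  qed
  have cpt: "compact {0..1::real}" by simp
  have "\<forall>V\<in>{U. open U \<and> finite (?B \<inter> U)}. open V" by blast
  moreover have "{0..1} \<subseteq> \<Union>{U. open U \<and> finite (?B \<inter> U)}" using local by blast
  ultimately obtain \<F> where \<F>: "\<F> \<subseteq> {U. open U \<and> finite (?B \<inter> U)}" "finite \<F>" "{0..1} \<subseteq> \<Union>\<F>"
    using cpt unfolding compact_eq_Heine_Borel by meson
  have "?B \<subseteq> (\<Union>U\<in>\<F>. ?B \<inter> U)" using \<F>(3) by blast
  moreover have "finite (\<Union>U\<in>\<F>. ?B \<inter> U)" using \<F>(1,2) by blast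
  ultimately show ?thesis by (rule finite_subset)
qed

text \<open>At the finitely many corners \<open>vector_derivative\<close> is a junk value and the integrand does depend
  on the chart.\<close>

lemma line_integral_chart_choice:
  assumes X: "compact_riemann_surface X" and \<omega>: "abelian_differential X \<omega>"
    and \<gamma>: "surface_path X \<gamma>"
    and d: "\<And>t. t \<in> {0..1} \<Longrightarrow> d t \<in> surf_atlas X" "\<And>t. t \<in> {0..1} \<Longrightarrow> \<gamma> t \<in> fst (d t)"
  shows "line_integral X \<omega> \<gamma> = integral {0..1} (\<lambda>t.
     \<omega> (d t) (\<gamma> t) * vector_derivative (snd (d t) \<circ> \<gamma>) (at t within {0..1}))"
  unfolding line_integral_def Let_def
proof (rule integral_spike)
  let ?B = "{t \<in> {0..1}. \<exists>d\<in>surf_atlas X. \<gamma> t \<in> fst d \<and>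
           \<not> (snd d \<circ> \<gamma>) differentiable at t within {0..1}}"
  show "negligible ?B"
    using finite_nondifferentiable_surface_path[OF X \<gamma>] by (rule negligible_finite)
  fix t assume t: "t \<in> {0..1} - ?B"
  define c where "c = (SOME c. c \<in> surf_atlas X \<and> \<gamma> t \<in> fst c)"
  have t01: "t \<in> {0..1}" using t by blast
  have dt: "d t \<in> surf_atlas X" "\<gamma> t \<in> fst (d t)" using d t01 by blast+
  have "c \<in> surf_atlas X \<and> \<gamma> t \<in> fst c"
    unfolding c_def by (rule someI[of _ "d t"]) (use dt in blast)
  hence c: "c \<in> surf_atlas X" "\<gamma> t \<in> fst c" by blast+
  have "(snd (d t) \<circ> \<gamma>) differentiable at t within {0..1}" using t dt by blast
  then obtain v where v: "(snd (d t) \<circ> \<gamma> has_vector_derivative v) (at t within {0..1})"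
    using vector_derivative_works by blast
  have path: "pathin (surf_top X) \<gamma>" using \<gamma> by (simp add: surface_path_def)
  have v': "(snd c \<circ> \<gamma> has_vector_derivative transition_deriv (d t) c (\<gamma> t) * v) (at t within {0..1})"
    by (rule has_vector_derivative_chart_change[OF X path dt(1) c(1) t01 dt(2) c(2) v])
  have "\<omega> (d t) (\<gamma> t) = \<omega> c (\<gamma> t) * transition_deriv (d t) c (\<gamma> t)"
    using \<omega> c dt unfolding abelian_differential_def by blast
  thus "\<omega> (d t) (\<gamma> t) * vector_derivative (snd (d t) \<circ> \<gamma>) (at t within {0..1})
      = \<omega> (SOME c. c \<in> surf_atlas X \<and> \<gamma> t \<in> fst c) (\<gamma> t) *
        vector_derivative (snd (SOME c. c \<in> surf_atlas X \<and> \<gamma> t \<in> fst c) \<circ> \<gamma>) (at t within {0..1})"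
    unfolding c_def[symmetric]
    using vector_derivative_within_closed_interval[OF _ t01 v]
      vector_derivative_within_closed_interval[OF _ t01 v'] by simp
qed


lemma is_chart_compactin_preimage:
  assumes c: "is_chart T c" and K: "compact K" "K \<subseteq> snd c ` fst c"
  shows "compactin T {p \<in> fst c. snd c p \<in> K}"
proof -
  have "homeomorphic_map (subtopology T (fst c)) (top_of_set (snd c ` fst c)) (snd c)"
    using c by (simp add: is_chart_def)
  moreover have "{p \<in> fst c. snd c p \<in> K} \<subseteq> topspace (subtopology T (fst c))"
    using openin_subset[OF is_chart_openin[OF c]] by auto
  moreover have "compactin (top_of_set (snd c ` fst c)) (snd c ` {p \<in> fst c. snd c p \<in> K})"
  proof -
    have "snd c ` {p \<in> fst c. snd c p \<in> K} = K" using K(2) by auto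
    thus ?thesis using K by (simp add: compactin_subtopology)
  qed
  ultimately have "compactin (subtopology T (fst c)) {p \<in> fst c. snd c p \<in> K}"
    using homeomorphic_map_compactness by blast
  thus ?thesis by (simp add: compactin_subtopology)
qed

section \<open>The reglued surface\<close>

text \<open>\<open>N\<close> and \<open>K\<close> are an open and a compact neighbourhood of the cut whose images under the gluing
  map close up to an open and a compact set of the \<open>\<zeta>\<close>-plane.\<close>

locale regluing =
  fixes X :: "'a surface" and D :: "'a set" and w :: "'a \<Rightarrow> complex"
    and S N K :: "complex set" and A :: "complex \<Rightarrow> complex"
  assumes X: "compact_riemann_surface X" and coord: "coordinate X (D, w)"
    and S: "compact S" "S \<noteq> {}" "S \<subseteq> N" and N: "open N" "N \<subseteq> K" and K: "compact K" "K \<subseteq> w ` D"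
    and A: "A holomorphic_on w ` D - S" "inj_on A (w ` D - S)" "A ` (w ` D - S) \<inter> S = {}"
    and fill: "open (A ` (w ` D - S) \<union> S)" "connected (A ` (w ` D - S) \<union> S)"
      "open (A ` (N - S) \<union> S)" "compact (A ` (K - S) \<union> S)"
begin

abbreviation "T \<equiv> surf_top X"
abbreviation "cset \<equiv> cut_set (D, w) S"
abbreviation "M \<equiv> topspace T - cset"
abbreviation "\<Omega> \<equiv> filled_region (D, w) S A"
abbreviation "G \<equiv> glue (D, w) S A"
abbreviation "Y \<equiv> reglue X (D, w) S A"
abbreviation "fc \<equiv> filled_chart (D, w) S A"
abbreviation "cc \<equiv> cut_chart S (D, w)"

section \<open>The coordinate disc and the gluing map\<close>

lemma chart_D: "is_chart T (D, w)"
  using coord by (simp add: coordinate_def)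

lemma compatible_D: "d \<in> surf_atlas X \<Longrightarrow> compatible (D, w) d"
  using coord by (simp add: coordinate_def)

lemma D_open: "openin T D" "D \<subseteq> topspace T" "inj_on w D"
  using is_chart_openin[OF chart_D] openin_subset is_chart_inj_on[OF chart_D] by auto

lemma open_preimage_D: "open W \<Longrightarrow> openin T {p \<in> D. w p \<in> W}"
  using is_chart_open_preimage[OF chart_D] by simp

lemma open_wD: "open (w ` D)" "open (w ` D - S)"
  using is_chart_open_image[OF chart_D] D_open S(1) by (auto simp: compact_imp_closed open_Diff)

lemma mem_cut [simp]: "p \<in> cset \<longleftrightarrow> p \<in> D \<and> w p \<in> S"
  by (simp add: cut_set_def)

text \<open>Closedness in the disc would not give closedness in \<open>X\<close>; compactness does,
  because \<open>X\<close> is Hausdorff.\<close>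

lemma closedin_preimage_compact: "compact C \<Longrightarrow> C \<subseteq> w ` D \<Longrightarrow> closedin T {p \<in> D. w p \<in> C}"
  using is_chart_compactin_preimage[OF chart_D, of C] compact_riemann_surfaceD(4)[OF X]
  by (simp add: compactin_imp_closedin)

lemma S_sub: "S \<subseteq> w ` D"
  using S N K by blast

lemma open_M: "openin T M"
proof -
  have "closedin T cset"
    using closedin_preimage_compact[OF S(1) S_sub] by (simp add: cut_set_def)
  thus ?thesis by (simp add: openin_diff)
qed

lemma openin_Y: "openin (surf_top Y) W \<longleftrightarrow> reglue_open X (D, w) S A W"
  by (simp add: reglue_def istopology_reglue_open topology_inverse')

lemma atlas_Y: "surf_atlas Y = insert fc (cc ` surf_atlas X)"
  by (simp add: reglue_def)

lemma A_notin_S: "p \<in> D \<Longrightarrow> w p \<notin> S \<Longrightarrow> A (w p) \<notin> S"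
  using A(3) by blast

lemma glue_A: "p \<in> D \<Longrightarrow> w p \<notin> S \<Longrightarrow> G (A (w p)) = Inl p"
  using A_notin_S A(2) D_open(3) by (simp add: glue_def)

lemma glue_S: "\<zeta> \<in> S \<Longrightarrow> G \<zeta> = Inr \<zeta>"
  by (simp add: glue_def)

lemma A_in_region: "p \<in> D \<Longrightarrow> w p \<notin> S \<Longrightarrow> A (w p) \<in> \<Omega>"
  by (auto simp: filled_region_def)

lemma region_cases:
  assumes "\<zeta> \<in> \<Omega>"
  obtains "\<zeta> \<in> S" | p where "p \<in> D" "w p \<notin> S" "\<zeta> = A (w p)"
  using assms by (auto simp: filled_region_def)

lemma fc_simps [simp]:
  "fst fc = Inl ` (D - cset) \<union> Inr ` S" "snd fc (Inl p) = A (w p)" "snd fc (Inr \<zeta>) = \<zeta>"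
  by (auto simp: filled_chart_def)

lemma cc_simps [simp]: "fst (cc d) = Inl ` (fst d - cset)" "snd (cc d) (Inl p) = snd d p"
  by (auto simp: cut_chart_def)

text \<open>With \<open>glue_fc\<close> this makes the gluing map and the filled coordinate mutually
  inverse, identifying the domain of the filled chart with a plane region.\<close>

lemma fc_glue: "\<zeta> \<in> \<Omega> \<Longrightarrow> snd fc (G \<zeta>) = \<zeta>"
  by (erule region_cases) (simp_all add: glue_A glue_S)

lemma glue_fc: "q \<in> fst fc \<Longrightarrow> G (snd fc q) = q"
  by (auto simp: glue_A glue_S)

lemma glue_in_fc: "\<zeta> \<in> \<Omega> \<Longrightarrow> G \<zeta> \<in> fst fc"
  by (erule region_cases) (auto simp: glue_A glue_S)

lemma fc_in_region: "q \<in> fst fc \<Longrightarrow> snd fc q \<in> \<Omega>"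
  by (auto simp: A_in_region) (auto simp: filled_region_def)

lemma glue_region: "G ` \<Omega> = fst fc"
proof (rule subset_antisym)
  show "fst fc \<subseteq> G ` \<Omega>"
  proof
    fix q assume "q \<in> fst fc"
    thus "q \<in> G ` \<Omega>" by (intro image_eqI[of q G "snd fc q"] glue_fc [symmetric] fc_in_region)
  qed
qed (intro image_subsetI glue_in_fc)

lemma inj_on_glue: "inj_on G \<Omega>"
  by (rule inj_on_inverseI[of _ "snd fc"]) (rule fc_glue)

lemma open_region: "open \<Omega>" "connected \<Omega>"
  using fill by (simp_all add: filled_region_def)

section \<open>The quotient topology\<close>

lemma openin_Y_D:
  assumes "openin (surf_top Y) W"
  shows "W \<subseteq> Inl ` M \<union> Inr ` S" "openin T {p \<in> M. Inl p \<in> W}" "open {\<zeta> \<in> \<Omega>. G \<zeta> \<in> W}"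
  using assms by (auto simp: openin_Y reglue_open_def)

text \<open>Off the cut the new topology is the old one. The trace of \<open>V\<close> in the
  \<zeta>-plane is the image under \<open>A\<close> of an open set, open because injective
  holomorphic maps are open.\<close>

lemma openin_Inl:
  assumes "V \<subseteq> M"
  shows "openin (surf_top Y) (Inl ` V) \<longleftrightarrow> openin T V"
proof
  have eq: "{p \<in> M. Inl p \<in> Inl ` V} = V" using assms by auto
  {
    assume "openin (surf_top Y) (Inl ` V)"
    from openin_Y_D(2)[OF this] show "openin T V" unfolding eq .
  }
  assume V: "openin T V"
  have "{\<zeta> \<in> \<Omega>. G \<zeta> \<in> Inl ` V} = A ` w ` (V \<inter> D)"
  proof (intro equalityI subsetI)
    fix \<zeta> assume "\<zeta> \<in> {\<zeta> \<in> \<Omega>. G \<zeta> \<in> Inl ` V}"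
    hence \<zeta>: "\<zeta> \<in> \<Omega>" "G \<zeta> \<in> Inl ` V" by auto
    thus "\<zeta> \<in> A ` w ` (V \<inter> D)"
      by (cases rule: region_cases) (auto simp: glue_S glue_A)
  next
    fix \<zeta> assume "\<zeta> \<in> A ` w ` (V \<inter> D)"
    then obtain p where p: "p \<in> V" "p \<in> D" "\<zeta> = A (w p)" by blast
    hence "w p \<notin> S" using assms by auto
    thus "\<zeta> \<in> {\<zeta> \<in> \<Omega>. G \<zeta> \<in> Inl ` V}" using p by (simp add: glue_A A_in_region)
  qed
  moreover have "open (A ` w ` (V \<inter> D))"
  proof (rule open_mapping_thm3)
    have sub: "w ` (V \<inter> D) \<subseteq> w ` D - S" using assms by auto
    show "A holomorphic_on w ` (V \<inter> D)" "inj_on A (w ` (V \<inter> D))"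
      using A(1,2) sub holomorphic_on_subset inj_on_subset by blast+
    show "open (w ` (V \<inter> D))"
      using is_chart_open_image[OF chart_D, of "V \<inter> D"] V D_open(1) by auto
  qed
  ultimately show "openin (surf_top Y) (Inl ` V)"
    unfolding openin_Y reglue_open_def eq using V assms by auto
qed

lemma fc_subset: "fst fc \<subseteq> Inl ` M \<union> Inr ` S"
  using D_open(2) by auto

text \<open>The complementary source of open sets. Here the trace on \<open>X\<close> is the
  preimage of \<open>V\<close> under \<open>A\<close> composed with the coordinate, so continuity of
  \<open>A\<close> is what counts.\<close>

lemma openin_glue:
  assumes V: "open V" "V \<subseteq> \<Omega>"
  shows "openin (surf_top Y) (G ` V)"
proof -
  have "{\<zeta> \<in> \<Omega>. G \<zeta> \<in> G ` V} = V"
    using inj_on_glue V(2) by (auto dest: inj_onD)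
  moreover have "{p \<in> M. Inl p \<in> G ` V} = {p \<in> D. w p \<in> (w ` D - S) \<inter> A -` V}"
  proof (intro equalityI subsetI)
    fix p assume "p \<in> {p \<in> M. Inl p \<in> G ` V}"
    then obtain \<zeta> where \<zeta>: "\<zeta> \<in> V" "\<zeta> \<in> \<Omega>" "G \<zeta> = Inl p" using V(2) by auto
    from \<zeta>(2) show "p \<in> {p \<in> D. w p \<in> (w ` D - S) \<inter> A -` V}"
      by (cases rule: region_cases) (use \<zeta> in \<open>auto simp: glue_A glue_S\<close>)
  next
    fix p assume "p \<in> {p \<in> D. w p \<in> (w ` D - S) \<inter> A -` V}"
    hence p: "p \<in> D" "w p \<notin> S" "A (w p) \<in> V" by auto
    hence "Inl p \<in> G ` V" by (metis glue_A image_eqI)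
    thus "p \<in> {p \<in> M. Inl p \<in> G ` V}" using p D_open(2) by auto
  qed
  moreover have "open ((w ` D - S) \<inter> A -` V)"
    using continuous_open_preimage[OF holomorphic_on_imp_continuous_on[OF A(1)] open_wD(2) V(1)] .
  hence "openin T {p \<in> D. w p \<in> (w ` D - S) \<inter> A -` V}"
    by (rule open_preimage_D)
  moreover have "G ` V \<subseteq> fst fc"
    using glue_in_fc V(2) by blast
  hence "G ` V \<subseteq> Inl ` M \<union> Inr ` S" using fc_subset by (rule order_trans)
  ultimately show ?thesis using V(1) unfolding openin_Y reglue_open_def by simp
qed

lemma topspace_Y: "topspace (surf_top Y) = Inl ` M \<union> Inr ` S"
proof (rule antisym)
  show "topspace (surf_top Y) \<subseteq> Inl ` M \<union> Inr ` S"
    using openin_Y_D(1)[OF openin_topspace] .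
  have "openin (surf_top Y) (Inl ` M)" using openin_Inl open_M by blast
  moreover have "openin (surf_top Y) (fst fc)"
    using openin_glue[OF open_region(1) subset_refl] by (simp only: glue_region)
  ultimately have "Inl ` M \<subseteq> topspace (surf_top Y)" "fst fc \<subseteq> topspace (surf_top Y)"
    by (simp_all only: openin_subset)
  moreover have "Inr ` S \<subseteq> fst fc" by simp
  ultimately show "Inl ` M \<union> Inr ` S \<subseteq> topspace (surf_top Y)" by blast
qed

section \<open>Charts and transition maps\<close>

lemma is_chart_cc:
  assumes "d \<in> surf_atlas X"
  shows "is_chart (surf_top Y) (cc d)"
proof -
  note ch = compact_riemann_surfaceD(1)[OF X assms]
  have sub: "fst d - cset \<subseteq> M" using openin_subset[OF is_chart_openin[OF ch]] by auto
  have eq: "fst d - cset = fst d \<inter> M" using openin_subset[OF is_chart_openin[OF ch]] by auto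
  have "is_chart (surf_top Y) (Inl ` (fst d - cset), snd d \<circ> projl)"
  proof (rule is_chartI)
    show "openin (surf_top Y) (Inl ` (fst d - cset))"
      unfolding openin_Inl[OF sub] unfolding eq by (intro openin_Int open_M is_chart_openin[OF ch])
    show "inj_on (snd d \<circ> projl) (Inl ` (fst d - cset))"
      using is_chart_inj_on[OF ch] by (auto simp: inj_on_def)
    fix V assume V: "openin (surf_top Y) V" "V \<subseteq> Inl ` (fst d - cset)"
    then obtain V' where V': "V' \<subseteq> fst d - cset" "V = Inl ` V'" by (meson subset_imageE)
    hence "openin T V'" using V sub by (metis openin_Inl order_trans)
    hence "open (snd d ` V')" using V' by (intro is_chart_open_image[OF ch]) auto
    thus "open ((snd d \<circ> projl) ` V)" using V' by (simp add: image_comp o_def)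
  next
    fix W :: "complex set" assume "open W"
    hence "openin T ({p \<in> fst d. snd d p \<in> W} \<inter> M)"
      by (intro openin_Int open_M is_chart_open_preimage[OF ch])
    hence "openin (surf_top Y) (Inl ` ({p \<in> fst d. snd d p \<in> W} \<inter> M))"
      by (subst openin_Inl) auto
    moreover have img: "{q \<in> Inl ` (fst d - cset). (snd d \<circ> projl) q \<in> W}
        = Inl ` ({p \<in> fst d. snd d p \<in> W} \<inter> M)"
      unfolding eq by auto
    ultimately show "openin (surf_top Y) {q \<in> Inl ` (fst d - cset). (snd d \<circ> projl) q \<in> W}"
      unfolding img by blast
  qed
  thus ?thesis by (simp add: cut_chart_def)
qed

lemma is_chart_fc: "is_chart (surf_top Y) fc"
proof -
  have "is_chart (surf_top Y) (fst fc, snd fc)"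
  proof (rule is_chartI)
    show "openin (surf_top Y) (fst fc)"
      using openin_glue[OF open_region(1) subset_refl] by (simp only: glue_region)
    show "inj_on (snd fc) (fst fc)" by (rule inj_on_inverseI[of _ G]) (rule glue_fc)
    fix V assume V: "openin (surf_top Y) V" "V \<subseteq> fst fc"
    have "snd fc ` V = {\<zeta> \<in> \<Omega>. G \<zeta> \<in> V}"
    proof (intro equalityI subsetI)
      fix \<zeta> assume "\<zeta> \<in> snd fc ` V"
      then obtain q where q: "q \<in> V" "\<zeta> = snd fc q" by blast
      hence "q \<in> fst fc" using V(2) by blast
      thus "\<zeta> \<in> {\<zeta> \<in> \<Omega>. G \<zeta> \<in> V}" using q fc_in_region glue_fc by auto
    next
      fix \<zeta> assume "\<zeta> \<in> {\<zeta> \<in> \<Omega>. G \<zeta> \<in> V}"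
      thus "\<zeta> \<in> snd fc ` V" using fc_glue by (metis (mono_tags, lifting) image_eqI mem_Collect_eq)
    qed
    thus "open (snd fc ` V)" using openin_Y_D(3)[OF V(1)] by simp
  next
    fix W :: "complex set" assume W: "open W"
    have "{q \<in> fst fc. snd fc q \<in> W} = G ` (\<Omega> \<inter> W)"
    proof (intro equalityI subsetI)
      fix q assume "q \<in> {q \<in> fst fc. snd fc q \<in> W}"
      thus "q \<in> G ` (\<Omega> \<inter> W)" using glue_fc fc_in_region
        by (metis (mono_tags, lifting) IntI image_eqI mem_Collect_eq)
    next
      fix q assume "q \<in> G ` (\<Omega> \<inter> W)"
      then obtain \<zeta> where "\<zeta> \<in> \<Omega>" "\<zeta> \<in> W" "q = G \<zeta>" by blast
      thus "q \<in> {q \<in> fst fc. snd fc q \<in> W}" using glue_in_fc fc_glue by simp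
    qed
    thus "openin (surf_top Y) {q \<in> fst fc. snd fc q \<in> W}"
      using openin_glue[of "\<Omega> \<inter> W"] W open_region(1) by (simp add: open_Int)
  qed
  thus ?thesis by (simp only: prod.collapse)
qed

lemma compatible_cc:
  assumes "d \<in> surf_atlas X" "e \<in> surf_atlas X"
  shows "transition (cc d) (cc e) holomorphic_on snd (cc d) ` (fst (cc d) \<inter> fst (cc e))"
proof (rule holomorphic_transform)
  note ch = compact_riemann_surfaceD(1)[OF X assms(1)]
  have im: "snd (cc d) ` (fst (cc d) \<inter> fst (cc e)) = snd d ` (fst d \<inter> fst e - cset)"
    by (force simp: image_iff)
  have "transition d e holomorphic_on snd d ` (fst d \<inter> fst e)"
    using compact_riemann_surfaceD(2)[OF X assms] by (simp add: compatible_def)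
  thus "transition d e holomorphic_on snd (cc d) ` (fst (cc d) \<inter> fst (cc e))"
    by (rule holomorphic_on_subset) (auto simp: im)
  fix z assume "z \<in> snd (cc d) ` (fst (cc d) \<inter> fst (cc e))"
  then obtain p where p: "p \<in> fst d" "p \<notin> cset" "z = snd d p" unfolding im by blast
  have "transition d e z = snd e p"
    unfolding p(3) by (rule transition_snd[OF ch p(1)])
  moreover have "transition (cc d) (cc e) (snd (cc d) (Inl p)) = snd (cc e) (Inl p)"
    by (rule transition_snd[OF is_chart_cc[OF assms(1)]]) (use p in auto)
  ultimately show "transition d e z = transition (cc d) (cc e) z" using p(3) by simp
qed

text \<open>The overlap avoids the cut, so the transitions are those of \<open>X\<close> between
  \<open>(D, w)\<close> and \<open>d\<close>, composed with \<open>A\<close> or with its holomorphic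
  inverse \<open>B\<close>.\<close>

lemma compatible_fc_cc:
  assumes d: "d \<in> surf_atlas X"
  shows "compatible fc (cc d)"
proof -
  note ch = compact_riemann_surfaceD(1)[OF X d]
  note comp = compatible_D[OF d]
  have int: "fst fc \<inter> fst (cc d) = Inl ` (D \<inter> fst d - cset)"
    by auto
  obtain B where B: "B holomorphic_on A ` (w ` D - S)" "\<And>z. z \<in> w ` D - S \<Longrightarrow> B (A z) = z"
    using holomorphic_has_inverse[OF A(1) open_wD(2) A(2)] by metis
  have 1: "transition fc (cc d) holomorphic_on snd fc ` (fst fc \<inter> fst (cc d))"
  proof (rule holomorphic_transform)
    have "transition (D, w) d holomorphic_on w ` (D \<inter> fst d)"
      using comp by (simp add: compatible_def)
    moreover have "B holomorphic_on snd fc ` (fst fc \<inter> fst (cc d))"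
      using B(1) by (rule holomorphic_on_subset) (auto simp: int)
    moreover have "B ` snd fc ` (fst fc \<inter> fst (cc d)) \<subseteq> w ` (D \<inter> fst d)"
      unfolding int using B(2) by auto
    ultimately show "transition (D, w) d \<circ> B holomorphic_on snd fc ` (fst fc \<inter> fst (cc d))"
      using holomorphic_on_compose_gen by blast
    fix z assume "z \<in> snd fc ` (fst fc \<inter> fst (cc d))"
    then obtain p where p: "p \<in> D" "p \<in> fst d" "w p \<notin> S" "z = A (w p)" unfolding int by auto
    have "transition (D, w) d (w p) = snd d p"
      using transition_snd[OF chart_D, of p d] p by simp
    moreover have "transition fc (cc d) (snd fc (Inl p)) = snd (cc d) (Inl p)"
      by (rule transition_snd[OF is_chart_fc]) (use p in auto)
    ultimately show "(transition (D, w) d \<circ> B) z = transition fc (cc d) z"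
      using p B(2)[of "w p"] by simp
  qed
  have 2: "transition (cc d) fc holomorphic_on snd (cc d) ` (fst fc \<inter> fst (cc d))"
  proof (rule holomorphic_transform)
    have im: "snd (cc d) ` (fst fc \<inter> fst (cc d)) = snd d ` (D \<inter> fst d - cset)"
      unfolding int by (force simp: image_iff)
    have tr: "transition d (D, w) (snd d p) = w p" if "p \<in> fst d" for p
      using transition_snd[OF ch that, of "(D, w)"] by simp
    have "transition d (D, w) holomorphic_on snd d ` (D \<inter> fst d)"
      using comp by (simp add: compatible_def)
    hence "transition d (D, w) holomorphic_on snd (cc d) ` (fst fc \<inter> fst (cc d))"
      by (rule holomorphic_on_subset) (auto simp: im)
    moreover have "transition d (D, w) ` snd (cc d) ` (fst fc \<inter> fst (cc d)) \<subseteq> w ` D - S"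
      unfolding im using tr by auto
    ultimately show "A \<circ> transition d (D, w) holomorphic_on snd (cc d) ` (fst fc \<inter> fst (cc d))"
      using holomorphic_on_compose_gen A(1) by blast
    fix z assume "z \<in> snd (cc d) ` (fst fc \<inter> fst (cc d))"
    then obtain p where p: "p \<in> D" "p \<in> fst d" "w p \<notin> S" "z = snd d p" unfolding im by auto
    have "transition (cc d) fc (snd (cc d) (Inl p)) = snd fc (Inl p)"
      by (rule transition_snd[OF is_chart_cc[OF d]]) (use p in auto)
    thus "(A \<circ> transition d (D, w)) z = transition (cc d) fc z"
      using p tr by simp
  qed
  show ?thesis unfolding compatible_def using 1 2 by simp
qed

lemma compatible_fc: "compatible fc fc"
proof -
  have "transition fc fc holomorphic_on snd fc ` fst fc"
  proof (rule holomorphic_transform[OF holomorphic_on_ident])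
    fix z assume "z \<in> snd fc ` fst fc"
    then obtain q where "q \<in> fst fc" "z = snd fc q" by blast
    thus "z = transition fc fc z" using transition_snd[OF is_chart_fc, of q fc] by simp
  qed
  thus ?thesis by (simp only: compatible_def Int_absorb)
qed

lemma Y_atlas_charts: "c \<in> surf_atlas Y \<Longrightarrow> is_chart (surf_top Y) c"
  using is_chart_fc is_chart_cc unfolding atlas_Y by blast

lemma Y_atlas_compatible:
  assumes "c \<in> surf_atlas Y" "d \<in> surf_atlas Y"
  shows "compatible c d"
proof -
  have sym: "compatible d c" if "compatible c d" for c d :: "('a + complex) chart"
    using that by (simp add: compatible_def Int_commute)
  have cc: "compatible (cc d) (cc e)" if "d \<in> surf_atlas X" "e \<in> surf_atlas X" for d e
    using compatible_cc[OF that] compatible_cc[OF that(2,1)]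
    by (simp only: compatible_def Int_commute)
  show ?thesis
    using assms compatible_fc compatible_fc_cc sym[OF compatible_fc_cc] cc unfolding atlas_Y by blast
qed

lemma Y_atlas_cover: "(\<Union>c\<in>surf_atlas Y. fst c) = topspace (surf_top Y)"
proof -
  have "(\<Union>c\<in>surf_atlas Y. fst c) = fst fc \<union> (\<Union>d\<in>surf_atlas X. Inl ` (fst d - cset))"
    unfolding atlas_Y by simp
  also have "(\<Union>d\<in>surf_atlas X. Inl ` (fst d - cset)) = Inl ` M"
    unfolding compact_riemann_surfaceD(3)[OF X, symmetric] by blast
  also have "fst fc \<union> Inl ` M = topspace (surf_top Y)"
    unfolding topspace_Y using D_open(2) by auto
  finally show ?thesis .
qed

section \<open>Hausdorff, compact, connected\<close>

text \<open>The critical Hausdorff case, since \<open>p\<close> may be on the boundary of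
  \<open>D\<close>. The points with coordinate in the compact set \<open>K\<close> form a closed set
  missing \<open>p\<close>, while \<open>N\<close>, with its cut refilled, is a neighbourhood of
  \<open>s\<close> inside what \<open>K\<close> gives.\<close>

lemma separate_filled:
  assumes "p \<in> topspace T" "p \<notin> D" "s \<in> S"
  shows "\<exists>U V. openin (surf_top Y) U \<and> openin (surf_top Y) V \<and> Inl p \<in> U \<and> Inr s \<in> V \<and> disjnt U V"
proof -
  let ?K = "{q \<in> D. w q \<in> K}"
  let ?V = "A ` (N - S) \<union> S"
  have "openin T (topspace T - ?K)"
    using closedin_preimage_compact[OF K] by (simp add: closedin_def)
  moreover have subM: "topspace T - ?K \<subseteq> M" using S N by auto
  ultimately have "openin (surf_top Y) (Inl ` (topspace T - ?K))" by (simp only: openin_Inl)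
  moreover have sub: "?V \<subseteq> \<Omega>" using N K by (auto simp: filled_region_def)
  hence "openin (surf_top Y) (G ` ?V)" using fill(3) by (intro openin_glue)
  moreover have "Inr s \<in> G ` ?V" using assms(3) glue_S by (metis UnI2 image_eqI)
  moreover have "disjnt (Inl ` (topspace T - ?K)) (G ` ?V)"
    unfolding disjnt_iff
  proof (intro allI notI, elim conjE)
    fix q assume q: "q \<in> Inl ` (topspace T - ?K)" "q \<in> G ` ?V"
    then obtain x where x: "q = Inl x" "x \<notin> ?K" by blast
    from q(2) consider s where "s \<in> S" "q = G s" | z where "z \<in> N - S" "q = G (A z)" by blast
    thus False
    proof cases
      case 1
      thus False using x by (simp add: glue_S)
    next
      case 2
      have "z \<in> w ` D" using 2(1) N(2) K(2) by blast
      then obtain y where y: "y \<in> D" "z = w y" by blast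
      hence "q = Inl y" using 2 by (simp add: glue_A)
      thus False using x y 2(1) N(2) by auto
    qed
  qed
  ultimately show ?thesis using assms(1,2) by blast
qed

lemma Hausdorff_Y: "Hausdorff_space (surf_top Y)"
  unfolding Hausdorff_space_def
proof (intro allI impI, elim conjE)
  fix x y assume xy: "x \<in> topspace (surf_top Y)" "y \<in> topspace (surf_top Y)" "x \<noteq> y"
  let ?P = "\<lambda>x y. \<exists>U V. openin (surf_top Y) U \<and> openin (surf_top Y) V \<and> x \<in> U \<and> y \<in> V \<and> disjnt U V"
  have sym: "?P y x" if "?P x y" for x y using that disjnt_sym by blast
  have both: "?P x y" if "x \<in> fst fc" "y \<in> fst fc" "x \<noteq> y" for x y
  proof -
    have "snd fc x \<noteq> snd fc y" using that glue_fc by metis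
    then obtain U V where UV: "open U" "open V" "snd fc x \<in> U" "snd fc y \<in> V" "U \<inter> V = {}"
      using hausdorff[of "snd fc x" "snd fc y"] by metis
    have "openin (surf_top Y) {q \<in> fst fc. snd fc q \<in> U}" "openin (surf_top Y) {q \<in> fst fc. snd fc q \<in> V}"
      by (rule is_chart_open_preimage[OF is_chart_fc]; fact UV)+
    moreover have "disjnt {q \<in> fst fc. snd fc q \<in> U} {q \<in> fst fc. snd fc q \<in> V}"
      using UV(5) unfolding disjnt_iff by blast
    ultimately show ?thesis using that UV(3,4) by blast
  qed
  have inl: "?P (Inl p) (Inl q)" if pq: "p \<in> M" "q \<in> M" "p \<noteq> q" for p q
  proof -
    obtain U V where UV: "openin T U" "openin T V" "p \<in> U" "q \<in> V" "disjnt U V"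
      using compact_riemann_surfaceD(4)[OF X, unfolded Hausdorff_space_def, rule_format, of p q] pq
      by auto
    have "openin (surf_top Y) (Inl ` (U \<inter> M))" "openin (surf_top Y) (Inl ` (V \<inter> M))"
      using UV(1,2) open_M by (simp_all add: openin_Inl openin_Int)
    moreover have "disjnt (Inl ` (U \<inter> M)) (Inl ` (V \<inter> M) :: ('a + complex) set)"
      using UV(5) unfolding disjnt_iff by blast
    ultimately show ?thesis using UV(3,4) pq by blast
  qed
  have mixed: "?P (Inl p) (Inr s)" if "p \<in> M" "s \<in> S" for p s
  proof (cases "p \<in> D")
    case True
    thus ?thesis using that by (intro both) auto
  next
    case False
    thus ?thesis using that by (intro separate_filled) auto
  qed
  have inr: "?P (Inr s) (Inr t)" if "s \<in> S" "t \<in> S" "s \<noteq> t" for s t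
    using that by (intro both) auto
  show "?P x y"
  proof (cases x)
    case x: (Inl p)
    hence p: "p \<in> M" using xy(1) unfolding topspace_Y by blast
    show ?thesis
    proof (cases y)
      case y: (Inl q)
      hence "q \<in> M" "p \<noteq> q" using x xy(2,3) unfolding topspace_Y by blast+
      thus ?thesis unfolding x y by (rule inl[OF p])
    next
      case y: (Inr s)
      hence "s \<in> S" using xy(2) unfolding topspace_Y by blast
      thus ?thesis unfolding x y by (rule mixed[OF p])
    qed
  next
    case x: (Inr s)
    hence s: "s \<in> S" using xy(1) unfolding topspace_Y by blast
    show ?thesis
    proof (cases y)
      case y: (Inl q)
      hence "q \<in> M" using xy(2) unfolding topspace_Y by blast
      thus ?thesis unfolding x y by (rule sym[OF mixed[OF _ s]])
    next
      case y: (Inr t)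
      hence "t \<in> S" "s \<noteq> t" using x xy(2,3) unfolding topspace_Y by blast+
      thus ?thesis unfolding x y by (rule inr[OF s])
    qed
  qed
qed

lemma continuous_map_Inl: "continuous_map (subtopology T M) (surf_top Y) Inl"
  unfolding continuous_map_def
proof (intro conjI allI impI)
  show "Inl \<in> topspace (subtopology T M) \<rightarrow> topspace (surf_top Y)"
    by (auto simp: topspace_Y)
  fix U assume "openin (surf_top Y) U"
  hence "openin T {p \<in> M. Inl p \<in> U}" by (rule openin_Y_D)
  moreover have "{p \<in> topspace (subtopology T M). Inl p \<in> U} = {p \<in> M. Inl p \<in> U}" by auto
  ultimately show "openin (subtopology T M) {p \<in> topspace (subtopology T M). Inl p \<in> U}"
    using openin_open_subtopology[OF open_M] by auto
qed

lemma continuous_map_glue: "continuous_map (top_of_set \<Omega>) (surf_top Y) G"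
  unfolding continuous_map_def
proof (intro conjI allI impI)
  show "G \<in> topspace (top_of_set \<Omega>) \<rightarrow> topspace (surf_top Y)"
    unfolding topspace_euclidean_subtopology
    using glue_in_fc openin_subset[OF is_chart_openin[OF is_chart_fc]] by blast
  fix U assume "openin (surf_top Y) U"
  hence "open {\<zeta> \<in> \<Omega>. G \<zeta> \<in> U}" by (rule openin_Y_D)
  thus "openin (top_of_set \<Omega>) {\<zeta> \<in> topspace (top_of_set \<Omega>). G \<zeta> \<in> U}"
    using openin_open_eq[OF open_region(1)] by auto
qed

text \<open>Two compact sets cover: the old surface without the points over \<open>N\<close>, which
  is closed in \<open>X\<close> and avoids the cut, and the refilled image of
  \<open>K\<close>.\<close>

lemma compact_Y: "compact_space (surf_top Y)"
proof -
  let ?N = "{q \<in> D. w q \<in> N}"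
  let ?K = "A ` (K - S) \<union> S"
  have subM: "topspace T - ?N \<subseteq> M" using S by auto
  have "openin T ?N" using is_chart_open_preimage[OF chart_D N(1)] by simp
  hence "compactin T (topspace T - ?N)"
    using compact_riemann_surfaceD(6)[OF X] by (intro closedin_compact_space) auto
  hence "compactin (subtopology T M) (topspace T - ?N)"
    using subM by (simp add: compactin_subtopology)
  hence c1: "compactin (surf_top Y) (Inl ` (topspace T - ?N))"
    by (rule image_compactin[OF _ continuous_map_Inl])
  have sub: "?K \<subseteq> \<Omega>" using K by (auto simp: filled_region_def)
  hence "compactin (top_of_set \<Omega>) ?K" using fill(4) by (simp add: compactin_subtopology)
  hence c2: "compactin (surf_top Y) (G ` ?K)"
    by (rule image_compactin[OF _ continuous_map_glue])
  have "topspace (surf_top Y) \<subseteq> Inl ` (topspace T - ?N) \<union> G ` ?K"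
  proof
    fix q assume "q \<in> topspace (surf_top Y)"
    then consider p where "p \<in> M" "q = Inl p" | s where "s \<in> S" "q = Inr s"
      unfolding topspace_Y by blast
    thus "q \<in> Inl ` (topspace T - ?N) \<union> G ` ?K"
    proof cases
      case 1
      show ?thesis
      proof (cases "p \<in> ?N")
        case True
        hence "G (A (w p)) = q" "A (w p) \<in> ?K" using 1 N(2) by (auto simp: glue_A)
        thus ?thesis by blast
      qed (use 1 in auto)
    next
      case 2
      hence "q = G s" by (simp add: glue_S)
      thus ?thesis using 2 by blast
    qed
  qed
  moreover have c: "compactin (surf_top Y) (Inl ` (topspace T - ?N) \<union> G ` ?K)"
    using c1 c2 by (rule compactin_Un)
  ultimately have "topspace (surf_top Y) = Inl ` (topspace T - ?N) \<union> G ` ?K"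
    using compactin_subset_topspace by (intro subset_antisym)
  thus ?thesis unfolding compact_space_def using c by (simp only:)
qed

text \<open>Connectedness is pulled back to \<open>X\<close>: the filled chart lies in one part of a
  separation, so the trace of the other part misses \<open>D\<close>. Adding \<open>D\<close> to the
  trace of the first part gives the open complement in \<open>X\<close>, and a clopen set missing
  \<open>D\<close> is empty.\<close>

lemma connected_Y: "connected_space (surf_top Y)"
proof -
  have F_conn: "connectedin (surf_top Y) (fst fc)"
  proof -
    have "connectedin (top_of_set \<Omega>) \<Omega>"
      unfolding connectedin_subtopology connectedin_iff_connected using open_region(2) by blast
    hence "connectedin (surf_top Y) (G ` \<Omega>)"
      by (rule connectedin_continuous_map_image[OF continuous_map_glue])
    thus ?thesis by (simp only: glue_region)
  qed
  have D_ne: "D \<noteq> {}" using S(2) S_sub by blast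
  have no: "V = {}" if V: "openin (surf_top Y) V" and U: "openin (surf_top Y) U"
    and UV: "U \<inter> V = {}" "U \<union> V = topspace (surf_top Y)" and F: "fst fc \<subseteq> U" for U V
  proof -
    define V' where "V' = {p \<in> M. Inl p \<in> V}"
    have VD: "V' \<inter> D = {}"
    proof (rule ccontr)
      assume "V' \<inter> D \<noteq> {}"
      then obtain p where "p \<in> D" "p \<in> M" "Inl p \<in> V" by (auto simp: V'_def)
      moreover from this have "Inl p \<in> fst fc" by auto
      ultimately show False using F UV(1) by blast
    qed
    have "openin T V'" unfolding V'_def using V by (rule openin_Y_D)
    have "topspace T - V' = {p \<in> M. Inl p \<in> U} \<union> D"
    proof (intro equalityI subsetI)
      fix p assume p: "p \<in> topspace T - V'"
      show "p \<in> {p \<in> M. Inl p \<in> U} \<union> D"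
      proof (cases "p \<in> D")
        case False
        hence "p \<in> M" using p by auto
        hence "Inl p \<in> U \<union> V" unfolding UV topspace_Y by blast
        thus ?thesis using p \<open>p \<in> M\<close> by (auto simp: V'_def)
      qed auto
    next
      fix p assume "p \<in> {p \<in> M. Inl p \<in> U} \<union> D"
      thus "p \<in> topspace T - V'" using VD D_open(2) UV(1) by (auto simp: V'_def)
    qed
    moreover have "openin T ({p \<in> M. Inl p \<in> U} \<union> D)"
      using openin_Y_D(2)[OF U] D_open(1) by (rule openin_Un)
    moreover have "V' \<subseteq> topspace T" by (auto simp: V'_def)
    ultimately have "closedin T V'" by (simp add: closedin_def)
    hence "V' = {} \<or> V' = topspace T"
      using compact_riemann_surfaceD(5)[OF X] \<open>openin T V'\<close> unfolding connected_space_clopen_in by blast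
    hence "V' = {}" using VD D_ne D_open(2) by blast
    show "V = {}"
    proof (rule ccontr)
      assume "V \<noteq> {}"
      then obtain q where q: "q \<in> V" by blast
      hence "q \<in> Inl ` M \<union> Inr ` S" using openin_Y_D(1)[OF V] by blast
      moreover have "q \<notin> Inl ` M" using \<open>V' = {}\<close> q by (auto simp: V'_def)
      moreover have "q \<notin> Inr ` S" using q F UV(1) by auto
      ultimately show False by blast
    qed
  qed
  show ?thesis
    unfolding connected_space_def
  proof (intro notI, elim exE conjE)
    fix E1 E2 assume E: "openin (surf_top Y) E1" "openin (surf_top Y) E2"
      "topspace (surf_top Y) \<subseteq> E1 \<union> E2" "E1 \<inter> E2 = {}" "E1 \<noteq> {}" "E2 \<noteq> {}"
    have top: "E1 \<union> E2 = topspace (surf_top Y)" using E(1-3) openin_subset by blast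
    have F: "fst fc \<subseteq> E1 \<union> E2"
      unfolding top using openin_subset[OF is_chart_openin[OF is_chart_fc]] .
    have "E1 \<inter> E2 \<inter> fst fc = {}" using E(4) by blast
    hence "E1 \<inter> fst fc = {} \<or> E2 \<inter> fst fc = {}"
      using F_conn[unfolded connectedin] E(1,2) F by blast
    hence "fst fc \<subseteq> E1 \<or> fst fc \<subseteq> E2" using F by blast
    thus False
    proof
      assume "fst fc \<subseteq> E1"
      thus False using no[OF E(2,1) E(4) top] E(6) by blast
    next
      assume "fst fc \<subseteq> E2"
      thus False using no[OF E(1,2)] E(4,5) top by (metis Int_commute Un_commute)
    qed
  qed
qed

lemma compact_riemann_surface_reglue: "compact_riemann_surface Y"
  unfolding compact_riemann_surface_def
  by (intro conjI ballI Hausdorff_Y connected_Y compact_Y Y_atlas_cover Y_atlas_charts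
      Y_atlas_compatible)

lemma atlas_Y_cases:
  assumes "e \<in> surf_atlas Y"
  obtains "e = fc" | d where "d \<in> surf_atlas X" "e = cc d"
  using assms unfolding atlas_Y by blast

section \<open>The extended differential\<close>

text \<open>Allows a differential to be defined by cases on the chart: only the filled chart
  contains filled-in points, and there is at least one.\<close>

lemma fc_noteq_cc: "cc d \<noteq> fc"
proof
  assume eq: "cc d = fc"
  have "fst (cc d) = fst fc" by (simp only: eq)
  hence "Inl ` (fst d - cset) = Inl ` (D - cset) \<union> Inr ` S" by simp
  moreover obtain s where "s \<in> S" using S(2) by blast
  ultimately have "Inr s \<in> (Inl ` (fst d - cset) :: ('a + complex) set)" by blast
  thus False by blast
qed

lemma transition_deriv_cc:
  assumes d: "d \<in> surf_atlas X" and e: "e \<in> surf_atlas X" and p: "p \<in> fst d" "p \<in> fst e" "p \<notin> cset"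
  shows "transition_deriv (cc d) (cc e) (Inl p) = transition_deriv d e p"
proof -
  note chd = compact_riemann_surfaceD(1)[OF X d] and che = compact_riemann_surfaceD(1)[OF X e]
  have pM: "p \<in> M" using p openin_subset[OF is_chart_openin[OF chd]] by blast
  let ?O = "snd d ` (fst d \<inter> fst e \<inter> M)"
  have op: "open ?O"
    using chd che open_M by (intro is_chart_open_image[OF chd] openin_Int is_chart_openin) auto
  have "(transition d e has_field_derivative transition_deriv d e p) (at (snd d p))"
    using chd che compact_riemann_surfaceD(2)[OF X d e] p(1,2) by (rule has_field_derivative_transition)
  hence "(transition (cc d) (cc e) has_field_derivative transition_deriv d e p) (at (snd d p))"
    using op
  proof (rule has_field_derivative_transform_within_open)
    show "snd d p \<in> ?O" using p pM by blast
    fix z assume "z \<in> ?O"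
    then obtain q where q: "q \<in> fst d" "q \<in> fst e" "q \<in> M" "z = snd d q" by blast
    have "transition (cc d) (cc e) (snd (cc d) (Inl q)) = snd (cc e) (Inl q)"
      by (rule transition_snd[OF is_chart_cc[OF d]]) (use q in auto)
    thus "transition d e z = transition (cc d) (cc e) z"
      using transition_snd[OF chd q(1), of e] q(4) by simp
  qed
  thus ?thesis unfolding transition_deriv_def by (simp add: DERIV_imp_deriv)
qed

text \<open>Off the cut the transition from \<open>(D, w)\<close> to \<open>d\<close> factors
  through the filled chart, the first factor being \<open>A\<close>.\<close>

lemma transition_deriv_fc_cc:
  assumes d: "d \<in> surf_atlas X" and p: "p \<in> D" "p \<in> fst d" "w p \<notin> S"
  shows "transition_deriv (D, w) d p = transition_deriv fc (cc d) (Inl p) * deriv A (w p)"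
proof -
  note ch = compact_riemann_surfaceD(1)[OF X d]
  let ?O = "w ` (D \<inter> fst d \<inter> M)"
  have op: "open ?O"
    using is_chart_open_image[OF chart_D, of "D \<inter> fst d \<inter> M"] open_M D_open(1) is_chart_openin[OF ch]
    by (auto intro!: openin_Int)
  have "(transition fc (cc d) has_field_derivative transition_deriv fc (cc d) (Inl p)) (at (snd fc (Inl p)))"
    by (rule has_field_derivative_transition[OF is_chart_fc is_chart_cc[OF d] compatible_fc_cc[OF d]])
      (use p in auto)
  hence "(transition fc (cc d) has_field_derivative transition_deriv fc (cc d) (Inl p)) (at (A (w p)))"
    by simp
  moreover have "(A has_field_derivative deriv A (w p)) (at (w p))"
    using A(1) open_wD(2) by (rule holomorphic_derivI) (use p in auto)
  ultimately have "(transition fc (cc d) \<circ> A has_field_derivative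
      transition_deriv fc (cc d) (Inl p) * deriv A (w p)) (at (w p))"
    by (rule DERIV_chain)
  hence "(transition (D, w) d has_field_derivative
      transition_deriv fc (cc d) (Inl p) * deriv A (w p)) (at (w p))"
    using op
  proof (rule has_field_derivative_transform_within_open)
    show "w p \<in> ?O" using p D_open(2) by auto
    fix z assume "z \<in> ?O"
    then obtain q where q: "q \<in> D" "q \<in> fst d" "w q \<notin> S" "z = w q" by auto
    have "transition fc (cc d) (snd fc (Inl q)) = snd (cc d) (Inl q)"
      by (rule transition_snd[OF is_chart_fc]) (use q in auto)
    moreover have "transition (D, w) d (w q) = snd d q"
      using transition_snd[OF chart_D, of q d] q by simp
    ultimately show "(transition fc (cc d) \<circ> A) z = transition (D, w) d z" using q by simp
  qed
  thus ?thesis unfolding transition_deriv_def by (simp add: DERIV_imp_deriv)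
qed

text \<open>Two charts of \<open>X\<close> may restrict to the same chart off the cut.\<close>

lemma differential_cc_eq:
  assumes \<omega>: "abelian_differential X \<omega>" and d: "d \<in> surf_atlas X" and e: "e \<in> surf_atlas X"
    and eq: "cc d = cc e" and p: "p \<in> fst d" "p \<notin> cset"
  shows "\<omega> d p = \<omega> e p"
proof -
  have "(Inl ` (fst d - cset) :: ('a + complex) set) = Inl ` (fst e - cset)"
    using arg_cong[OF eq, of fst] by simp
  hence "p \<in> fst e" using p by blast
  have "transition_deriv (cc d) (cc e) (Inl p) = 1"
    unfolding eq by (rule transition_deriv_self[OF is_chart_cc[OF e]]) (use \<open>p \<in> fst e\<close> p in auto)
  hence "transition_deriv d e p = 1" using transition_deriv_cc[OF d e p(1) \<open>p \<in> fst e\<close> p(2)] by simp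
  moreover have "\<omega> d p = \<omega> e p * transition_deriv d e p"
    using \<omega> d e p(1) \<open>p \<in> fst e\<close> unfolding abelian_differential_def by blast
  ultimately show ?thesis by simp
qed

text \<open>The hypothesis on \<open>g\<close> says that \<open>g d\<zeta>\<close> extends the pushforward of \<open>f dw\<close> by \<open>A\<close>.\<close>

lemma exists_extended_differential:
  assumes \<omega>: "abelian_differential X \<omega>" and loc: "has_local_form X \<omega> (D, w) f"
    and g: "g holomorphic_on \<Omega>" "\<And>z. z \<in> w ` D - S \<Longrightarrow> g (A z) * deriv A z = f z"
  shows "\<exists>\<omega>'. abelian_differential Y \<omega>' \<and> extends_differential X (D, w) S \<omega> \<omega>'"
proof -
  \<comment> \<open>A restricted chart does not remember the chart of \<open>X\<close> it came from,
    so one is chosen; \<open>differential_cc_eq\<close> makes the value independent of the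
    choice.\<close>
  define \<omega>' :: "('a + complex) differential" where
    "\<omega>' = (\<lambda>e q. if e = fc then g (snd fc q) else \<omega> (SOME d. d \<in> surf_atlas X \<and> cc d = e) (projl q))"
  have fc: "\<omega>' fc q = g (snd fc q)" for q by (simp add: \<omega>'_def)
  have cc: "\<omega>' (cc d) (Inl p) = \<omega> d p" if d: "d \<in> surf_atlas X" and p: "p \<in> fst d" "p \<notin> cset" for d p
  proof -
    define e where "e = (SOME e. e \<in> surf_atlas X \<and> cc e = cc d)"
    have "e \<in> surf_atlas X \<and> cc e = cc d" unfolding e_def by (rule someI[of _ d]) (use d in blast)
    hence "\<omega> d p = \<omega> e p" by (intro differential_cc_eq[OF \<omega> d _ _ p]) auto
    thus ?thesis using fc_noteq_cc[of d] by (simp add: \<omega>'_def e_def)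
  qed
  have hol: "(\<lambda>z. \<omega>' e (inv_into (fst e) (snd e) z)) holomorphic_on snd e ` fst e"
    if "e \<in> surf_atlas Y" for e
    using that
  proof (cases rule: atlas_Y_cases)
    case 1
    have "snd fc ` fst fc \<subseteq> \<Omega>" using fc_in_region by blast
    with g(1) have "g holomorphic_on snd fc ` fst fc" by (rule holomorphic_on_subset)
    thus ?thesis unfolding 1
    proof (rule holomorphic_transform)
      fix z assume "z \<in> snd fc ` fst fc"
      thus "g z = \<omega>' fc (inv_into (fst fc) (snd fc) z)"
        unfolding fc using f_inv_into_f[of z "snd fc" "fst fc"] by simp
    qed
  next
    case (2 d)
    note ch = compact_riemann_surfaceD(1)[OF X 2(1)]
    have "(\<lambda>z. \<omega> d (inv_into (fst d) (snd d) z)) holomorphic_on snd d ` fst d"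
      using \<omega> 2(1) by (simp add: abelian_differential_def)
    hence "(\<lambda>z. \<omega> d (inv_into (fst d) (snd d) z)) holomorphic_on snd (cc d) ` fst (cc d)"
      by (rule holomorphic_on_subset) auto
    thus ?thesis unfolding 2(2)
    proof (rule holomorphic_transform)
      fix z assume "z \<in> snd (cc d) ` fst (cc d)"
      then obtain p where p: "p \<in> fst d" "p \<notin> cset" "z = snd (cc d) (Inl p)" by auto
      have "inv_into (fst (cc d)) (snd (cc d)) (snd (cc d) (Inl p)) = Inl p"
        by (rule chart_inv_snd[OF is_chart_cc[OF 2(1)]]) (use p in auto)
      moreover have "inv_into (fst d) (snd d) (snd d p) = p" by (rule chart_inv_snd[OF ch p(1)])
      ultimately show "\<omega> d (inv_into (fst d) (snd d) z) = \<omega>' (cc d) (inv_into (fst (cc d)) (snd (cc d)) z)"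
        using p cc[OF 2(1) p(1,2)] by simp
    qed
  qed
  have fc_cc: "\<omega>' fc q = \<omega>' (cc d) q * transition_deriv fc (cc d) q"
    if d: "d \<in> surf_atlas X" and q: "q \<in> fst fc" "q \<in> fst (cc d)" for d q
  proof -
    obtain p where p: "p \<in> fst d" "p \<notin> cset" "q = Inl p" using q(2) by auto
    have pD: "p \<in> D" "w p \<notin> S" using q p by auto
    have "g (A (w p)) * deriv A (w p) = f (w p)" using pD by (intro g(2)) auto
    also have "f (w p) = \<omega> d p * transition_deriv (D, w) d p"
      using loc d p pD unfolding has_local_form_def by (metis IntI fst_conv snd_conv)
    also have "\<dots> = \<omega> d p * transition_deriv fc (cc d) q * deriv A (w p)"
      using transition_deriv_fc_cc[OF d pD(1) p(1) pD(2)] p(3) by simp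
    finally have "g (A (w p)) * deriv A (w p) = \<omega> d p * transition_deriv fc (cc d) q * deriv A (w p)" .
    \<comment> \<open>An injective holomorphic map has no critical points, so this factor cancels
      and leaves the cocycle rule between \<open>fc\<close> and \<open>cc d\<close>.\<close>
    moreover have "deriv A (w p) \<noteq> 0"
      using pD by (intro holomorphic_injective_imp_regular[OF A(1) open_wD(2) A(2)]) auto
    ultimately have "g (A (w p)) = \<omega> d p * transition_deriv fc (cc d) q" by simp
    thus ?thesis using p cc[OF d p(1,2)] by (simp add: fc)
  qed
  have "abelian_differential Y \<omega>'"
    unfolding abelian_differential_def
  proof (intro conjI ballI hol)
    fix c e q assume c: "c \<in> surf_atlas Y" and e: "e \<in> surf_atlas Y" and q: "q \<in> fst c \<inter> fst e"
    show "\<omega>' c q = \<omega>' e q * transition_deriv c e q"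
    proof (cases rule: atlas_Y_cases[OF c])
      case c: 1
      show ?thesis
      proof (cases rule: atlas_Y_cases[OF e])
        case 1
        thus ?thesis using q transition_deriv_self[OF is_chart_fc, of q] by (simp only: c Int_iff) simp
      next
        case (2 d)
        thus ?thesis using fc_cc[OF 2(1)] q by (simp only: c Int_iff)
      qed
    next
      case c: (2 d)
      show ?thesis
      proof (cases rule: atlas_Y_cases[OF e])
        case 1
        have q': "q \<in> fst fc" "q \<in> fst (cc d)" using q unfolding c(2) 1 by blast+
        have "transition_deriv (cc d) fc q * transition_deriv fc (cc d) q = 1"
          by (rule transition_deriv_inverse[OF is_chart_fc is_chart_cc[OF c(1)] compatible_fc_cc[OF c(1)] q'])
        thus ?thesis unfolding 1 c(2) fc_cc[OF c(1) q'] by (simp add: mult.assoc mult.commute)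
      next
        case (2 d')
        have "q \<in> fst (cc d)" "q \<in> fst (cc d')" using q unfolding c(2) 2(2) by blast+
        then obtain p where p: "p \<in> fst d" "p \<in> fst d'" "p \<notin> cset" "q = Inl p" by auto
        have "\<omega> d p = \<omega> d' p * transition_deriv d d' p"
          using \<omega> c(1) 2(1) p unfolding abelian_differential_def by blast
        thus ?thesis
          unfolding c(2) 2(2) p(4) transition_deriv_cc[OF c(1) 2(1) p(1-3)]
          by (simp only: cc[OF c(1) p(1,3)] cc[OF 2(1) p(2,3)])
      qed
    qed
  qed
  moreover have "extends_differential X (D, w) S \<omega> \<omega>'"
    unfolding extends_differential_def using cc by blast
  ultimately show ?thesis by blast
qed

section \<open>Periods along cycles off the disc\<close>

lemma surface_path_Inl:
  assumes \<gamma>: "surface_path X \<gamma>" and avoid: "\<gamma> ` {0..1} \<inter> D = {}"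
  shows "surface_path Y (Inl \<circ> \<gamma>)"
  unfolding surface_path_def
proof (intro conjI ballI allI impI)
  have "pathin T \<gamma>" using \<gamma> by (simp add: surface_path_def)
  moreover have "\<gamma> ` {0..1} \<subseteq> M"
    using avoid \<open>pathin T \<gamma>\<close> by (auto simp: pathin_def continuous_map_def)
  ultimately have "pathin (subtopology T M) \<gamma>"
    by (auto simp: pathin_def continuous_map_in_subtopology)
  thus "pathin (surf_top Y) (Inl \<circ> \<gamma>)"
    using continuous_map_Inl by (rule pathin_compose)
  fix e and a b :: real
  assume e: "e \<in> surf_atlas Y" and ab: "0 \<le> a \<and> a \<le> b \<and> b \<le> 1 \<and> (Inl \<circ> \<gamma>) ` {a..b} \<subseteq> fst e"
  show "(snd e \<circ> (Inl \<circ> \<gamma>)) piecewise_C1_differentiable_on {a..b}"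
  proof (cases rule: atlas_Y_cases[OF e])
    case 1
    \<comment> \<open>This case is contradictory: \<open>a \<le> b\<close> makes the interval
      nonempty, and a path point in the filled chart would have to come from
      \<open>D\<close>.\<close>
    have "a \<in> {a..b}" "a \<in> {0..1}" using ab by auto
    hence "Inl (\<gamma> a) \<in> fst fc" using ab unfolding 1 by (metis comp_apply image_subset_iff)
    hence "\<gamma> a \<in> D" by auto
    thus ?thesis using avoid \<open>a \<in> {0..1}\<close> by blast
  next
    case (2 d)
    have "\<gamma> ` {a..b} \<subseteq> fst d" using ab unfolding 2(2) by auto
    hence "(snd d \<circ> \<gamma>) piecewise_C1_differentiable_on {a..b}"
      using \<gamma> 2(1) ab unfolding surface_path_def by blast
    moreover have "snd e \<circ> (Inl \<circ> \<gamma>) = snd d \<circ> \<gamma>" unfolding 2(2) by (simp add: fun_eq_iff)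
    ultimately show ?thesis by simp
  qed
qed

text \<open>Both integrals are first rewritten with matching charts, \<open>d t\<close> on
  \<open>X\<close> and its restriction on the new surface; the integrands then agree at every
  parameter.\<close>

lemma line_integral_Inl:
  assumes \<omega>: "abelian_differential X \<omega>"
    and \<omega>': "abelian_differential Y \<omega>'" "extends_differential X (D, w) S \<omega> \<omega>'"
    and \<gamma>: "surface_path X \<gamma>" and avoid: "\<gamma> ` {0..1} \<inter> D = {}"
  shows "line_integral Y \<omega>' (Inl \<circ> \<gamma>) = line_integral X \<omega> \<gamma>"
proof -
  have "\<exists>d. d \<in> surf_atlas X \<and> \<gamma> t \<in> fst d" if "t \<in> {0..1}" for t
  proof -
    have "\<gamma> t \<in> topspace T"
      using \<gamma> that by (auto simp: surface_path_def pathin_def continuous_map_def)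
    thus ?thesis unfolding compact_riemann_surfaceD(3)[OF X, symmetric] by blast
  qed
  then obtain d where d: "\<And>t. t \<in> {0..1} \<Longrightarrow> d t \<in> surf_atlas X" "\<And>t. t \<in> {0..1} \<Longrightarrow> \<gamma> t \<in> fst (d t)"
    by metis
  have nD: "\<gamma> t \<notin> cset" if "t \<in> {0..1}" for t
    using imageI[OF that, of \<gamma>] avoid by (simp only: mem_cut) blast
  have "line_integral Y \<omega>' (Inl \<circ> \<gamma>) = integral {0..1} (\<lambda>t. \<omega>' (cc (d t)) ((Inl \<circ> \<gamma>) t) *
      vector_derivative (snd (cc (d t)) \<circ> (Inl \<circ> \<gamma>)) (at t within {0..1}))"
  proof (rule line_integral_chart_choice[OF compact_riemann_surface_reglue \<omega>'(1) surface_path_Inl[OF \<gamma> avoid]])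
    fix t :: real assume t: "t \<in> {0..1}"
    show "cc (d t) \<in> surf_atlas Y" unfolding atlas_Y using d(1)[OF t] by blast
    show "(Inl \<circ> \<gamma>) t \<in> fst (cc (d t))" using d(2)[OF t] nD[OF t] by simp
  qed
  also have "\<dots> = integral {0..1} (\<lambda>t. \<omega> (d t) (\<gamma> t) *
      vector_derivative (snd (d t) \<circ> \<gamma>) (at t within {0..1}))"
  proof (rule integral_cong)
    fix t :: real assume t: "t \<in> {0..1}"
    have "\<omega>' (cc (d t)) (Inl (\<gamma> t)) = \<omega> (d t) (\<gamma> t)"
      using \<omega>'(2) d(1)[OF t] d(2)[OF t] nD[OF t] unfolding extends_differential_def by blast
    moreover have "snd (cc (d t)) \<circ> (Inl \<circ> \<gamma>) = snd (d t) \<circ> \<gamma>" by (simp add: fun_eq_iff)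
    ultimately show "\<omega>' (cc (d t)) ((Inl \<circ> \<gamma>) t) *
        vector_derivative (snd (cc (d t)) \<circ> (Inl \<circ> \<gamma>)) (at t within {0..1})
      = \<omega> (d t) (\<gamma> t) * vector_derivative (snd (d t) \<circ> \<gamma>) (at t within {0..1})" by simp
  qed
  also have "\<dots> = line_integral X \<omega> \<gamma>"
    by (rule line_integral_chart_choice[OF X \<omega> \<gamma> d, symmetric])
  finally show ?thesis .
qed

text \<open>The boundary at \<open>Inl p\<close> is the old boundary at \<open>p\<close>, and no
  path ends at a filled-in point.\<close>

lemma is_cycle_Inl:
  assumes C: "is_cycle X C" and avoid: "\<forall>(m, \<gamma>)\<in>set C. \<gamma> ` {0..1} \<inter> D = {}"
  shows "is_cycle Y (map (\<lambda>(m, \<gamma>). (m, Inl \<circ> \<gamma>)) C)"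
  unfolding is_cycle_def
proof (intro conjI allI)
  show "\<forall>(m, \<gamma>)\<in>set (map (\<lambda>(m, \<gamma>). (m, Inl \<circ> \<gamma>)) C). surface_path Y \<gamma>"
  proof (clarify, unfold set_map, elim imageE, clarify)
    fix m \<gamma> assume m: "(m, \<gamma>) \<in> set C"
    have "surface_path X \<gamma>" using C m by (auto simp: is_cycle_def)
    moreover have "\<gamma> ` {0..1} \<inter> D = {}" using bspec[OF avoid m] by simp
    ultimately show "surface_path Y (Inl \<circ> \<gamma>)" by (rule surface_path_Inl)
  qed
  fix q :: "'a + complex"
  have "(\<Sum>(m, \<gamma>)\<leftarrow>map (\<lambda>(m, \<gamma>). (m, Inl \<circ> \<gamma>)) C. m * (of_bool (\<gamma> 1 = q) - of_bool (\<gamma> 0 = q)))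
      = (\<Sum>(m, \<gamma>)\<leftarrow>C. m * (of_bool (Inl (\<gamma> 1) = q) - of_bool (Inl (\<gamma> 0) = q)))"
    by (simp add: case_prod_unfold o_def)
  also have "\<dots> = 0"
  proof (cases q)
    case (Inl p)
    thus ?thesis using C by (simp add: is_cycle_def)
  qed (simp add: case_prod_unfold)
  finally show "(\<Sum>(m, \<gamma>)\<leftarrow>map (\<lambda>(m, \<gamma>). (m, Inl \<circ> \<gamma>)) C.
      m * (of_bool (\<gamma> 1 = q) - of_bool (\<gamma> 0 = q))) = 0" .
qed

lemma period_Inl:
  assumes \<omega>: "abelian_differential X \<omega>"
    and \<omega>': "abelian_differential Y \<omega>'" "extends_differential X (D, w) S \<omega> \<omega>'"
    and C: "is_cycle X C" and avoid: "\<forall>(m, \<gamma>)\<in>set C. \<gamma> ` {0..1} \<inter> D = {}"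
  shows "period Y \<omega>' (map (\<lambda>(m, \<gamma>). (m, Inl \<circ> \<gamma>)) C) = period X \<omega> C"
proof -
  have "map ((\<lambda>(m, \<gamma>). of_int m * line_integral Y \<omega>' \<gamma>) \<circ> (\<lambda>(m, \<gamma>). (m, Inl \<circ> \<gamma>))) C
      = map (\<lambda>(m, \<gamma>). of_int m * line_integral X \<omega> \<gamma>) C"
  proof (rule map_cong[OF refl])
    fix x assume x: "x \<in> set C"
    obtain m \<gamma> where m: "x = (m, \<gamma>)" by (cases x)
    have "surface_path X \<gamma>" using C x m by (auto simp: is_cycle_def)
    moreover have "\<gamma> ` {0..1} \<inter> D = {}" using bspec[OF avoid x] m by simp
    ultimately have "line_integral Y \<omega>' (Inl \<circ> \<gamma>) = line_integral X \<omega> \<gamma>"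
      by (rule line_integral_Inl[OF \<omega> \<omega>'])
    thus "((\<lambda>(m, \<gamma>). of_int m * line_integral Y \<omega>' \<gamma>) \<circ> (\<lambda>(m, \<gamma>). (m, Inl \<circ> \<gamma>))) x
        = (\<lambda>(m, \<gamma>). of_int m * line_integral X \<omega> \<gamma>) x" by (simp add: m)
  qed
  thus ?thesis unfolding period_def map_map by (simp only:)
qed

section \<open>Invariance of the norm\<close>

text \<open>Applies \<open>area_sum_transfer\<close> to the embedding \<open>Inl\<close> of the
  complement of the cut. What is missing on either side is the cut or its replacement, both
  null.\<close>

lemma integral_norm_reglue:
  assumes \<omega>: "abelian_differential X \<omega>"
    and \<omega>': "abelian_differential Y \<omega>'" "extends_differential X (D, w) S \<omega> \<omega>'"
    and null: "negligible S"
  shows "integral_norm Y \<omega>' = integral_norm X \<omega>"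
proof -
  note crsY = compact_riemann_surface_reglue
  obtain cs where cs: "finite_chart_cover X cs"
    "integral_norm X \<omega> = of_real (enn2real (\<Sum>i<length cs. area_on \<omega> (cs ! i) (cover_piece cs i)))"
    using integral_norm_eq_area[OF X \<omega>] by blast
  obtain ds where ds: "finite_chart_cover Y ds"
    "integral_norm Y \<omega>' = of_real (enn2real (\<Sum>i<length ds. area_on \<omega>' (ds ! i) (cover_piece ds i)))"
    using integral_norm_eq_area[OF crsY \<omega>'(1)] by blast
  have "(\<Sum>i<length cs. area_on \<omega> (cs ! i) (cover_piece cs i))
      = (\<Sum>i<length ds. area_on \<omega>' (ds ! i) (cover_piece ds i))"
  proof (rule area_sum_transfer[OF X \<omega> cs(1) crsY \<omega>'(1) ds(1) open_M])
    show "inj_on Inl M" by simp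
    show "Inl ` M \<subseteq> topspace (surf_top Y)" unfolding topspace_Y by blast
    show "openin (surf_top Y) (Inl ` V) \<longleftrightarrow> openin T V" if "V \<subseteq> M" for V
      using that by (rule openin_Inl)
  next
    fix d assume d: "d \<in> surf_atlas X"
    \<comment> \<open>The cut has to be measured in an arbitrary chart of the atlas; differentiable
      images of null sets in the plane are null.\<close>
    have "negligible (transition (D, w) d ` (S \<inter> w ` (D \<inter> fst d)))"
    proof (rule negligible_differentiable_image_negligible)
      show "negligible (S \<inter> w ` (D \<inter> fst d))" using null negligible_subset by blast
      have "transition (D, w) d holomorphic_on w ` (D \<inter> fst d)"
        using compatible_D[OF d] by (simp add: compatible_def)
      hence "transition (D, w) d holomorphic_on S \<inter> w ` (D \<inter> fst d)"
        by (rule holomorphic_on_subset) blast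
      thus "transition (D, w) d differentiable_on S \<inter> w ` (D \<inter> fst d)"
        unfolding holomorphic_on_def differentiable_on_def field_differentiable_def
          has_field_derivative_def differentiable_def by blast
    qed simp
    moreover have "snd d ` (fst d - M) \<subseteq> transition (D, w) d ` (S \<inter> w ` (D \<inter> fst d))"
    proof
      fix z assume "z \<in> snd d ` (fst d - M)"
      then obtain p where p0: "p \<in> fst d" "p \<notin> M" "z = snd d p" by blast
      moreover from this have "p \<in> cset"
        using openin_subset[OF is_chart_openin[OF compact_riemann_surfaceD(1)[OF X d]]] by blast
      ultimately have p: "p \<in> fst d" "p \<in> D" "w p \<in> S" "z = snd d p" by auto
      hence "z = transition (D, w) d (w p)" using transition_snd[OF chart_D, of p d] by simp
      thus "z \<in> transition (D, w) d ` (S \<inter> w ` (D \<inter> fst d))" using p by blast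
    qed
    ultimately have "negligible (snd d ` (fst d - M))" by (rule negligible_subset)
    thus "area_on \<omega> d (fst d - M) = 0" by (rule area_on_negligible)
  next
    fix e assume e: "e \<in> surf_atlas Y"
    show "area_on \<omega>' e (fst e - Inl ` M) = 0"
    proof (cases rule: atlas_Y_cases[OF e])
      case 1
      have "snd fc ` (fst fc - Inl ` M) \<subseteq> S" using D_open(2) by auto
      hence "negligible (snd fc ` (fst fc - Inl ` M))" using null negligible_subset by blast
      thus ?thesis unfolding 1 by (rule area_on_negligible)
    next
      case (2 d)
      have "fst (cc d) \<subseteq> Inl ` M"
        using openin_subset[OF is_chart_openin[OF compact_riemann_surfaceD(1)[OF X 2(1)]]] by auto
      hence "fst (cc d) - Inl ` M = {}" by blast
      thus ?thesis unfolding 2(2) by (simp only: area_on_negligible image_empty negligible_empty)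
    qed
  next
    fix c e E
    assume c: "c \<in> surf_atlas X" and e: "e \<in> surf_atlas Y" and E: "diff_of_opens T E"
      "E \<subseteq> fst c \<inter> M" "Inl ` E \<subseteq> fst e"
    have ccY: "cc c \<in> surf_atlas Y" unfolding atlas_Y using c by blast
    have Ecc: "Inl ` E \<subseteq> fst (cc c)" using E(2) by auto
    have img: "snd (cc c) ` Inl ` E = snd c ` E" by (simp add: image_comp)
    obtain U V where UV: "openin T U" "openin T V" "E = U - V"
      using E(1) by (auto simp: diff_of_opens_def)
    have "Inl ` E = Inl ` (U \<inter> M) - (Inl ` (V \<inter> M) :: ('a + complex) set)"
      using UV(3) E(2) by blast
    moreover have "openin (surf_top Y) (Inl ` (U \<inter> M))" "openin (surf_top Y) (Inl ` (V \<inter> M))"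
      using UV open_M by (simp_all add: openin_Inl openin_Int)
    ultimately have dE: "diff_of_opens (surf_top Y) (Inl ` E)" by (simp only: diff_of_opensI)
    have "area_on \<omega> c E = area_on \<omega>' (cc c) (Inl ` E)"
      unfolding area_on_def img
    proof (rule nn_integral_cong)
      fix z
      show "ennreal (indicator (snd c ` E) z * (norm (\<omega> c (inv_into (fst c) (snd c) z)))\<^sup>2)
        = ennreal (indicator (snd c ` E) z * (norm (\<omega>' (cc c) (inv_into (fst (cc c)) (snd (cc c)) z)))\<^sup>2)"
      proof (cases "z \<in> snd c ` E")
        case True
        then obtain p where p: "p \<in> E" "z = snd c p" by blast
        have pc: "p \<in> fst c" "p \<notin> cset" using p(1) E(2) by blast+
        have "inv_into (fst c) (snd c) z = p"
          unfolding p(2) by (rule chart_inv_snd[OF compact_riemann_surfaceD(1)[OF X c] pc(1)])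
        moreover have "inv_into (fst (cc c)) (snd (cc c)) (snd (cc c) (Inl p)) = Inl p"
          by (rule chart_inv_snd[OF is_chart_cc[OF c]]) (use p Ecc in blast)
        hence "inv_into (fst (cc c)) (snd (cc c)) z = Inl p" using p(2) by simp
        moreover have "\<omega>' (cc c) (Inl p) = \<omega> c p"
          using \<omega>'(2) c pc unfolding extends_differential_def by blast
        ultimately show ?thesis by (simp only:)
      qed simp
    qed
    \<comment> \<open>Up to here the integrand was literally the same. When \<open>e\<close> is the
      filled chart, this change of chart on the new surface is where the area is carried through the
      map \<open>A\<close>.\<close>
    also have "\<dots> = area_on \<omega>' e (Inl ` E)"
      by (rule area_on_chart_change[OF crsY \<omega>'(1) ccY e dE Ecc E(3)])
    finally show "area_on \<omega> c E = area_on \<omega>' e (Inl ` E)" .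
  qed
  thus ?thesis using cs(2) ds(2) by simp
qed

end


section \<open>Regluing along the slits\<close>

text \<open>The closed tip of a slit lies in the open ball, so there is room for a radius between
  the slit length and \<open>\<rho>\<close>.\<close>

lemma slits_subset_ballD:
  assumes "n > 0" "\<epsilon> > 0" "\<rho> > 0" "slits n \<epsilon> \<subseteq> ball 0 \<rho>"
  obtains R where "0 < R" "R < \<rho>" "4 * \<epsilon> ^ n < R ^ n"
proof -
  \<comment> \<open>The tip of the slit at angle pi/n, whose modulus is the common length of the
    slits.\<close>
  define v where "v = of_real (\<epsilon> * 4 powr (1 / real n)) * e_root n"
  have v: "v ^ n = - of_real (4 * \<epsilon> ^ n)"
    using assms by (simp add: v_def power_mult_distrib powr_power flip: of_real_power)
  hence "v \<in> slits n \<epsilon>"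
    using assms unfolding mem_slits_iff[OF assms(1,2)] by (intro exI[of _ "4 * \<epsilon> ^ n"]) auto
  hence "norm v < \<rho>" using assms(4) by auto
  then obtain R where R: "norm v < R" "R < \<rho>" using dense by blast
  have "4 * \<epsilon> ^ n = norm v ^ n"
    using assms(2) unfolding norm_power[symmetric] v by (simp add: norm_mult norm_power)
  also have "\<dots> < R ^ n" using R assms(1) by (intro power_strict_mono) auto
  finally show ?thesis using R norm_ge_zero[of v] by (intro that[of R]) linarith+
qed

section \<open>The filled-in regions of the \<zeta>-plane\<close>

lemma slits_power_bound:
  assumes "n > 0" "\<epsilon> > 0" "w \<in> slits n \<epsilon>"
  shows "norm (w ^ n) \<le> 4 * \<epsilon> ^ n" "norm (w ^ n + 4 * of_real (\<epsilon> ^ n)) \<le> 4 * \<epsilon> ^ n"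
proof -
  obtain s :: real where s: "0 \<le> s" "s \<le> 4 * \<epsilon> ^ n" "w ^ n = - of_real s"
    using assms mem_slits_iff by blast
  thus "norm (w ^ n) \<le> 4 * \<epsilon> ^ n" by simp
  have "w ^ n + 4 * of_real (\<epsilon> ^ n) = of_real (4 * \<epsilon> ^ n - s)" using s by simp
  thus "norm (w ^ n + 4 * of_real (\<epsilon> ^ n)) \<le> 4 * \<epsilon> ^ n"
    using s by (simp only: norm_of_real)
qed

lemma slits_subset_ball:
  assumes "n > 0" "\<epsilon> > 0" "R > 0" "4 * \<epsilon> ^ n < R ^ n"
  shows "slits n \<epsilon> \<subseteq> ball 0 R"
proof
  fix w assume "w \<in> slits n \<epsilon>"
  hence "norm w ^ n < R ^ n"
    using slits_power_bound(1)[OF assms(1,2)] assms(4) by (force simp: norm_power)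
  hence "norm w < R" using assms(3) by (intro power_less_imp_less_base[of "norm w" n R]) auto
  thus "w \<in> ball 0 R" by simp
qed

text \<open>By \<open>slit_map_power\<close>, \<open>norm w ^ n\<close> equals
  \<open>norm (\<zeta> ^ n + 4 * \<epsilon> ^ n)\<close> for \<open>\<zeta> = A w\<close>. The
  hypothesis on \<open>P\<close> puts the slits themselves into the region, and leaving
  \<open>P\<close> free treats open and closed discs at once.\<close>

lemma filled_slit_image:
  assumes "n > 0" "\<epsilon> > 0"
    and P: "\<And>x. x \<le> 4 * \<epsilon> ^ n \<Longrightarrow> P x"
  shows "slit_map n \<epsilon> ` ({w. P (norm w ^ n)} - slits n \<epsilon>) \<union> slits n \<epsilon>
           = {\<zeta>. P (norm (\<zeta> ^ n + 4 * of_real (\<epsilon> ^ n)))}"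
proof (intro equalityI subsetI)
  have norm_eq: "norm (slit_map n \<epsilon> w ^ n + 4 * of_real (\<epsilon> ^ n)) = norm w ^ n"
    if "w \<notin> slits n \<epsilon>" for w
    using slit_map_power[OF assms(1,2) that] by (simp add: norm_power)
  show "\<zeta> \<in> {\<zeta>. P (norm (\<zeta> ^ n + 4 * of_real (\<epsilon> ^ n)))}"
    if "\<zeta> \<in> slit_map n \<epsilon> ` ({w. P (norm w ^ n)} - slits n \<epsilon>) \<union> slits n \<epsilon>" for \<zeta> :: complex
    using that norm_eq P[OF slits_power_bound(2)[OF assms(1,2)]] by auto
  fix \<zeta> :: complex assume \<zeta>: "\<zeta> \<in> {\<zeta>. P (norm (\<zeta> ^ n + 4 * of_real (\<epsilon> ^ n)))}"
  show "\<zeta> \<in> slit_map n \<epsilon> ` ({w. P (norm w ^ n)} - slits n \<epsilon>) \<union> slits n \<epsilon>"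
  proof (cases "\<zeta> \<in> slits n \<epsilon>")
    case False
    hence "\<zeta> \<in> slit_map n \<epsilon> ` (- slits n \<epsilon>)"
      using bij_betw_imp_surj_on[OF bij_betw_slit_map[OF assms(1,2)]] by simp
    then obtain w where w: "w \<notin> slits n \<epsilon>" "\<zeta> = slit_map n \<epsilon> w" by blast
    hence "P (norm w ^ n)" using \<zeta> norm_eq by simp
    thus ?thesis using w by blast
  qed blast
qed

lemma filled_slit_ball:
  assumes "n > 0" "\<epsilon> > 0" "R > 0" "4 * \<epsilon> ^ n < R ^ n"
  shows "slit_map n \<epsilon> ` (ball 0 R - slits n \<epsilon>) \<union> slits n \<epsilon>
           = {\<zeta>. norm (\<zeta> ^ n + 4 * of_real (\<epsilon> ^ n)) < R ^ n}"
proof -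
  have "R ^ n \<le> norm w ^ n \<longleftrightarrow> R \<le> norm w" for w :: complex
    using assms by (intro power_mono_iff) auto
  hence "ball 0 R = {w::complex. norm w ^ n < R ^ n}"
    by (simp add: set_eq_iff flip: not_le)
  thus ?thesis
    using filled_slit_image[OF assms(1,2), of "\<lambda>x. x < R ^ n"] assms(4) by simp
qed

lemma filled_slit_cball:
  assumes "n > 0" "\<epsilon> > 0" "R > 0" "4 * \<epsilon> ^ n < R ^ n"
  shows "slit_map n \<epsilon> ` (cball 0 R - slits n \<epsilon>) \<union> slits n \<epsilon>
           = {\<zeta>. norm (\<zeta> ^ n + 4 * of_real (\<epsilon> ^ n)) \<le> R ^ n}"
proof -
  have "norm w ^ n \<le> R ^ n \<longleftrightarrow> norm w \<le> R" for w :: complex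
    using assms by (intro power_mono_iff) auto
  hence "cball 0 R = {w::complex. norm w ^ n \<le> R ^ n}"
    by (simp add: set_eq_iff)
  thus ?thesis
    using filled_slit_image[OF assms(1,2), of "\<lambda>x. x \<le> R ^ n"] assms(4) by simp
qed

lemma open_filled_slit:
  fixes c :: complex
  shows "open {\<zeta>. norm (\<zeta> ^ n + c) < r}"
  by (intro open_Collect_less continuous_intros)

lemma compact_filled_slit:
  fixes c :: complex
  assumes "n > 0"
  shows "compact {\<zeta>. norm (\<zeta> ^ n + c) \<le> r}"
  unfolding compact_eq_bounded_closed
proof
  show "closed {\<zeta>. norm (\<zeta> ^ n + c) \<le> r}" by (intro closed_Collect_le continuous_intros)
  \<comment> \<open>The 1 covers the small \<open>\<zeta>\<close>, for which
    \<open>norm \<zeta> \<le> norm \<zeta> ^ n\<close> fails.\<close>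
  have "norm \<zeta> \<le> max 1 (r + norm c)" if "norm (\<zeta> ^ n + c) \<le> r" for \<zeta>
  proof (cases "norm \<zeta> \<le> 1")
    case False
    hence "norm \<zeta> \<le> norm \<zeta> ^ n" using assms by (intro self_le_power) auto
    also have "\<dots> \<le> norm (\<zeta> ^ n + c) + norm c"
      using norm_triangle_ineq4[of "\<zeta> ^ n + c" c] by (simp add: norm_power)
    finally show ?thesis using that by simp
  qed auto
  thus "bounded {\<zeta>. norm (\<zeta> ^ n + c) \<le> r}" unfolding bounded_iff by blast
qed

text \<open>The preimage of a disc containing \<open>0\<close> under \<open>\<zeta> \<mapsto> \<zeta> ^ n\<close> is starlike about \<open>0\<close>.\<close>

lemma connected_filled_slit:
  fixes c :: complex
  assumes "n > 0" "norm c < r"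
  shows "connected {\<zeta>. norm (\<zeta> ^ n + c) < r}"
proof (rule starlike_imp_connected, unfold starlike_def, intro bexI[of _ 0] ballI subsetI)
  show "0 \<in> {\<zeta>. norm (\<zeta> ^ n + c) < r}" using assms by (simp add: zero_power)
  fix \<zeta> x assume \<zeta>: "\<zeta> \<in> {\<zeta>. norm (\<zeta> ^ n + c) < r}" and "x \<in> closed_segment 0 \<zeta>"
  then obtain u where u: "0 \<le> u" "u \<le> 1" "x = of_real u * \<zeta>"
    by (auto simp: closed_segment_def scaleR_conv_of_real)
  have un: "0 \<le> u ^ n" "u ^ n \<le> 1" using u by (auto intro: power_le_one)
  \<comment> \<open>Shrinking \<open>\<zeta>\<close> by \<open>u\<close> moves
    \<open>\<zeta> ^ n + c\<close> towards \<open>c\<close> along a segment with weight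
    \<open>u ^ n\<close>, and both ends lie in the disc of radius \<open>r\<close>.\<close>
  have "x ^ n + c = u ^ n *\<^sub>R (\<zeta> ^ n + c) + (1 - u ^ n) *\<^sub>R c"
    by (simp add: u power_mult_distrib scaleR_conv_of_real algebra_simps)
  moreover have "u ^ n *\<^sub>R (\<zeta> ^ n + c) + (1 - u ^ n) *\<^sub>R c \<in> ball 0 r"
    using convex_ball[of 0 r] un \<zeta> assms(2) by (intro convexD) auto
  ultimately show "x \<in> {\<zeta>. norm (\<zeta> ^ n + c) < r}" by simp
qed

text \<open>The neighbourhoods are concentric discs of one radius \<open>R\<close>: larger than the
  slit length, so that both contain the slits, and smaller than \<open>\<rho>\<close>, so that the
  closed disc stays in the coordinate image.\<close>

lemma regluing_slit_map:
  assumes n: "n > 0" and X: "compact_riemann_surface X" and \<rho>: "\<rho> > 0"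
    and coord: "coordinate X (D, w)" "w ` D = ball 0 \<rho>" and \<epsilon>: "\<epsilon> > 0" "slits n \<epsilon> \<subseteq> ball 0 \<rho>"
  obtains R where "regluing X D w (slits n \<epsilon>) (ball 0 R) (cball 0 R) (slit_map n \<epsilon>)"
proof -
  obtain R where R: "0 < R" "R < \<rho>" "4 * \<epsilon> ^ n < R ^ n"
    using slits_subset_ballD[OF n \<epsilon>(1) \<rho> \<epsilon>(2)] .
  have "R ^ n < \<rho> ^ n" using R n by (intro power_strict_mono) auto
  hence R\<rho>: "4 * \<epsilon> ^ n < \<rho> ^ n" using R by simp
  have c: "norm (4 * of_real (\<epsilon> ^ n) :: complex) < \<rho> ^ n"
    using R\<rho> \<epsilon> by (simp add: norm_mult norm_power)
  have bij: "bij_betw (slit_map n \<epsilon>) (- slits n \<epsilon>) (- slits n \<epsilon>)"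
    by (rule bij_betw_slit_map[OF n \<epsilon>(1)])
  have "regluing X D w (slits n \<epsilon>) (ball 0 R) (cball 0 R) (slit_map n \<epsilon>)"
  proof
    show "compact (slits n \<epsilon>)" by (rule compact_slits[OF \<epsilon>(1)])
    show "slits n \<epsilon> \<noteq> {}" using zero_in_slits[OF n \<epsilon>(1)] by blast
    show "slits n \<epsilon> \<subseteq> ball 0 R" using slits_subset_ball[OF n \<epsilon>(1) R(1,3)] .
    show "cball 0 R \<subseteq> w ` D" using R(2) by (simp add: coord(2) subset_eq)
    show "slit_map n \<epsilon> holomorphic_on w ` D - slits n \<epsilon>"
      using holomorphic_slit_map[OF n \<epsilon>(1)] by (rule holomorphic_on_subset) blast
    show "inj_on (slit_map n \<epsilon>) (w ` D - slits n \<epsilon>)"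
      using bij_betw_imp_inj_on[OF bij] by (rule inj_on_subset) blast
    have "slit_map n \<epsilon> ` (w ` D - slits n \<epsilon>) \<subseteq> slit_map n \<epsilon> ` (- slits n \<epsilon>)" by blast
    thus "slit_map n \<epsilon> ` (w ` D - slits n \<epsilon>) \<inter> slits n \<epsilon> = {}"
      unfolding bij_betw_imp_surj_on[OF bij] by blast
    show "open (slit_map n \<epsilon> ` (w ` D - slits n \<epsilon>) \<union> slits n \<epsilon>)"
      unfolding coord(2) filled_slit_ball[OF n \<epsilon>(1) \<rho> R\<rho>] by (rule open_filled_slit)
    show "connected (slit_map n \<epsilon> ` (w ` D - slits n \<epsilon>) \<union> slits n \<epsilon>)"
      unfolding coord(2) filled_slit_ball[OF n \<epsilon>(1) \<rho> R\<rho>] using n c by (rule connected_filled_slit)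
    show "open (slit_map n \<epsilon> ` (ball 0 R - slits n \<epsilon>) \<union> slits n \<epsilon>)"
      unfolding filled_slit_ball[OF n \<epsilon>(1) R(1,3)] by (rule open_filled_slit)
    show "compact (slit_map n \<epsilon> ` (cball 0 R - slits n \<epsilon>) \<union> slits n \<epsilon>)"
      unfolding filled_slit_cball[OF n \<epsilon>(1) R(1,3)] by (rule compact_filled_slit[OF n])
  qed (use X coord(1) in auto)
  thus ?thesis by (rule that)
qed

lemma slit_regluing_isoperiodic:
  fixes X :: "'a surface"
  assumes n: "n > 1" and X: "compact_riemann_surface X" and \<omega>: "abelian_differential X \<omega>"
    and \<rho>: "\<rho> > 0" and coord: "coordinate X (D, w)" "w ` D = ball 0 \<rho>"
    and loc: "has_local_form X \<omega> (D, w) (\<lambda>z. - (z ^ (n - 1)))"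
    and \<epsilon>: "\<epsilon> > 0" "slits n \<epsilon> \<subseteq> ball 0 \<rho>"
  shows "let Y = reglue X (D, w) (slits n \<epsilon>) (slit_map n \<epsilon>) in
           compact_riemann_surface Y \<and>
           (\<exists>\<omega>'. abelian_differential Y \<omega>' \<and>
                 extends_differential X (D, w) (slits n \<epsilon>) \<omega> \<omega>') \<and>
           (\<forall>\<omega>'. abelian_differential Y \<omega>' \<and>
                 extends_differential X (D, w) (slits n \<epsilon>) \<omega> \<omega>' \<longrightarrow>
              (\<forall>C. is_cycle X C \<and> (\<forall>(m, \<gamma>)\<in>set C. \<gamma> ` {0..1} \<inter> D = {}) \<longrightarrow>
                 is_cycle Y (map (\<lambda>(m, \<gamma>). (m, Inl \<circ> \<gamma>)) C) \<and>
                 period Y \<omega>' (map (\<lambda>(m, \<gamma>). (m, Inl \<circ> \<gamma>)) C) = period X \<omega> C) \<and>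
              integral_norm Y \<omega>' = integral_norm X \<omega>)"
proof -
  have n0: "n > 0" using n by simp
  obtain R where "regluing X D w (slits n \<epsilon>) (ball 0 R) (cball 0 R) (slit_map n \<epsilon>)"
    using regluing_slit_map[OF n0 X \<rho> coord \<epsilon>] .
  then interpret regluing X D w "slits n \<epsilon>" "ball 0 R" "cball 0 R" "slit_map n \<epsilon>" .
  have ex: "\<exists>\<omega>'. abelian_differential Y \<omega>' \<and> extends_differential X (D, w) (slits n \<epsilon>) \<omega> \<omega>'"
  proof (rule exists_extended_differential[OF \<omega> loc])
    \<comment> \<open>The coefficient carries no minus sign: in the sum relation between the
      \<open>n\<close>-th powers of \<open>w\<close> and \<open>\<zeta>\<close>, differentiation
      reverses it.\<close>
    show "(\<lambda>\<zeta>. \<zeta> ^ (n - 1)) holomorphic_on \<Omega>" by (intro holomorphic_intros)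
    show "slit_map n \<epsilon> z ^ (n - 1) * deriv (slit_map n \<epsilon>) z = - (z ^ (n - 1))"
      if "z \<in> w ` D - slits n \<epsilon>" for z
      using that by (intro slit_map_power_deriv[OF n0 \<epsilon>(1)]) blast
  qed
  have per: "is_cycle Y (map (\<lambda>(m, \<gamma>). (m, Inl \<circ> \<gamma>)) C) \<and>
      period Y \<omega>' (map (\<lambda>(m, \<gamma>). (m, Inl \<circ> \<gamma>)) C) = period X \<omega> C"
    if "abelian_differential Y \<omega>' \<and> extends_differential X (D, w) (slits n \<epsilon>) \<omega> \<omega>'"
      "is_cycle X C \<and> (\<forall>(m, \<gamma>)\<in>set C. \<gamma> ` {0..1} \<inter> D = {})" for \<omega>' C
    using that by (elim conjE) (intro conjI is_cycle_Inl period_Inl[OF \<omega>])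
  have nrm: "integral_norm Y \<omega>' = integral_norm X \<omega>"
    if "abelian_differential Y \<omega>' \<and> extends_differential X (D, w) (slits n \<epsilon>) \<omega> \<omega>'" for \<omega>'
    using that by (elim conjE) (rule integral_norm_reglue[OF \<omega> _ _ negligible_slits[OF \<epsilon>(1)]])
  show ?thesis
    unfolding Let_def
  proof (rule conjI[OF compact_riemann_surface_reglue conjI[OF ex]], intro allI impI, rule conjI,
      intro allI impI)
  qed (rule per nrm; assumption)+
qed

theorem mainTheorem7:
  fixes n :: nat
  assumes "n > 1"
  shows
    "(\<forall>r>0. \<exists>\<delta>>0. \<exists>F.
        holomorphic_family {t. norm t < \<delta>} {w. norm w > r} F \<and>
        (\<forall>w. norm w > r \<longrightarrow>
           F 0 w = w \<and>
           (\<forall>\<epsilon>>0. \<epsilon> ^ n < \<delta> \<longrightarrow>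
              w \<notin> slits n \<epsilon> \<and> inverse (e_root n) * slit_map n \<epsilon> w = F (of_real (\<epsilon> ^ n)) w) \<and>
           deriv (\<lambda>t. F t w) 0 = 4 / (of_nat n * w ^ (n - 1)) \<and>
           (deriv ^^ 2) (\<lambda>t. F t w) 0
             = 16 * (1 - of_nat n) / ((of_nat n)\<^sup>2 * w ^ (2 * n - 1))))
     \<and>
     (\<forall>\<epsilon>>0.
        bij_betw (slit_map n \<epsilon>) (- slits n \<epsilon>) (- slits n \<epsilon>) \<and>
        slit_map n \<epsilon> holomorphic_on (- slits n \<epsilon>) \<and>
        (\<exists>g. g holomorphic_on UNIV \<and>
             (\<forall>\<zeta>\<in>- slits n \<epsilon>.
                g \<zeta> = pushforward (slit_map n \<epsilon>) (- slits n \<epsilon>) (\<lambda>w. - (w ^ (n - 1))) \<zeta>) \<and>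
             (\<exists>\<zeta>. g \<zeta> \<noteq> 0) \<and> g 0 = 0 \<and> zorder g 0 = int n - 1))
     \<and>
     (\<forall>(X :: 'a surface) \<omega> D w \<rho> \<epsilon>.
        compact_riemann_surface X \<and> abelian_differential X \<omega> \<and>
        \<rho> > 0 \<and> coordinate X (D, w) \<and> w ` D = ball 0 \<rho> \<and>
        has_local_form X \<omega> (D, w) (\<lambda>z. - (z ^ (n - 1))) \<and>
        \<epsilon> > 0 \<and> slits n \<epsilon> \<subseteq> ball 0 \<rho> \<longrightarrow>
        (let Y = reglue X (D, w) (slits n \<epsilon>) (slit_map n \<epsilon>) in
           compact_riemann_surface Y \<and>
           (\<exists>\<omega>'. abelian_differential Y \<omega>' \<and>
                 extends_differential X (D, w) (slits n \<epsilon>) \<omega> \<omega>') \<and>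
           (\<forall>\<omega>'. abelian_differential Y \<omega>' \<and>
                 extends_differential X (D, w) (slits n \<epsilon>) \<omega> \<omega>' \<longrightarrow>
              (\<forall>C. is_cycle X C \<and> (\<forall>(m, \<gamma>)\<in>set C. \<gamma> ` {0..1} \<inter> D = {}) \<longrightarrow>
                 is_cycle Y (map (\<lambda>(m, \<gamma>). (m, Inl \<circ> \<gamma>)) C) \<and>
                 period Y \<omega>' (map (\<lambda>(m, \<gamma>). (m, Inl \<circ> \<gamma>)) C) = period X \<omega> C) \<and>
              integral_norm Y \<omega>' = integral_norm X \<omega>)))"
proof (intro conjI)
  have n: "n > 0" using assms by simp
  show "\<forall>r>0. \<exists>\<delta>>0. \<exists>F.
        holomorphic_family {t. norm t < \<delta>} {w. norm w > r} F \<and>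
        (\<forall>w. norm w > r \<longrightarrow>
           F 0 w = w \<and>
           (\<forall>\<epsilon>>0. \<epsilon> ^ n < \<delta> \<longrightarrow>
              w \<notin> slits n \<epsilon> \<and> inverse (e_root n) * slit_map n \<epsilon> w = F (of_real (\<epsilon> ^ n)) w) \<and>
           deriv (\<lambda>t. F t w) 0 = 4 / (of_nat n * w ^ (n - 1)) \<and>
           (deriv ^^ 2) (\<lambda>t. F t w) 0
             = 16 * (1 - of_nat n) / ((of_nat n)\<^sup>2 * w ^ (2 * n - 1)))"
    by (intro allI impI slit_map_family[OF n])
next
  show "\<forall>\<epsilon>>0.
        bij_betw (slit_map n \<epsilon>) (- slits n \<epsilon>) (- slits n \<epsilon>) \<and>
        slit_map n \<epsilon> holomorphic_on (- slits n \<epsilon>) \<and>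
        (\<exists>g. g holomorphic_on UNIV \<and>
             (\<forall>\<zeta>\<in>- slits n \<epsilon>.
                g \<zeta> = pushforward (slit_map n \<epsilon>) (- slits n \<epsilon>) (\<lambda>w. - (w ^ (n - 1))) \<zeta>) \<and>
             (\<exists>\<zeta>. g \<zeta> \<noteq> 0) \<and> g 0 = 0 \<and> zorder g 0 = int n - 1)"
    using assms
    by (intro allI impI conjI bij_betw_slit_map holomorphic_slit_map pushforward_slit_map_extends)
      simp_all
qed (intro allI impI, elim conjE, rule slit_regluing_isoperiodic[OF assms])

end
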